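(* Let $K$ be a field and let $A=\Lambda[x_1,\ldots,x_n]$ be the $n$-th exterior algebra over $K$. Consider $HH^\ast(A;A)$ as a $K$-algebra under the cup product. (1) If $\operatorname{char}K=2$, then $$HH^\ast(A;A)\cong\Lambda[x_1,\ldots,x_n]\otimes_KK[x_1,\ldots,x_n],$$ where $x_\sigma\otimes x_\tau$ corresponds to $\varphi_{\tau,\sigma}\in\operatorname{Hom}_K(A^{\otimes k},A)$, for a subset $\sigma$ of $[n]=\{1,\ldots,n\}$ and a $k$-element multiset $\tau$ of elements of $[n]$. (2) If $\operatorname{char}K\ne2$, then $HH^\ast(A;A)$ is isomorphic to the subalgebra of $\Lambda[x_1,\ldots,x_n]\otimes_KK[x_1,\ldots,x_n]$ spanned by $$\big\{x_\sigma\otimes x_\tau:\ (-1)^{|\sigma|}=(-1)^{|\tau|}\big\}\cup\big\{x_{[n]}\otimes1\big\}.$$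
   Context: $x_\sigma=\bigwedge_{i\in\sigma}x_i$ (increasing order), $\sigma\subseteq[n]$, is the $K$-basis of the exterior algebra $\Lambda[x_1,\ldots,x_n]$ ($x_i^2=0$, $x_ix_j=-x_jx_i$), and $x_\tau=\prod_{i\in\tau}x_i$ (with multiplicities), $\tau$ a finite multiset of elements of $[n]$, is the monomial basis of the polynomial algebra $K[x_1,\ldots,x_n]$; $|\tau|$ counts multiplicities. $A$ is regarded as an ordinary (ungraded) algebra. $HH^\ast(A;A)$ is the cohomology of $\operatorname{Hom}_{A^e}(B_\ast,A)$, where $A^e=A\otimes_KA^{\mathrm{op}}$ and $B_\ast$ is the bar resolution: $B_k=A^{\otimes k+2}$ with $b_k(a_0\otimes\cdots\otimes a_{k+1})=\sum_{i=0}^k(-1)^ia_0\otimes\cdots\otimes a_ia_{i+1}\otimes\cdots\otimes a_{k+1}$ (which may be replaced by the normalized bar resolution). One identifies $\operatorname{Hom}_{A^e}(A^{\otimes k+2},A)\cong\operatorname{Hom}_K(A^{\otimes k},A)$ by $\varphi\mapsto(a_1\otimes\cdots\otimes a_k\mapsto\varphi(1\otimes a_1\otimes\cdots\otimes a_k\otimes1))$. The cup product of $f\in\operatorname{Hom}_K(A^{\otimes k},A)$ and $g\in\operatorname{Hom}_K(A^{\otimes l},A)$ is $(f\smile g)(a_1\otimes\cdots\otimes a_{k+l})=f(a_1\otimes\cdots\otimes a_k)\cdot g(a_{k+1}\otimes\cdots\otimes a_{k+l})$. The elements $\varphi_{\tau,\sigma}$: let $\mathring{B}_\ast$ be the free $A^e$-resolution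 of $A$ with $\mathring{B}_k$ free on symbols $x_{(\tau)}$, $\tau$ a $k$-element multiset of elements of $[n]$, and $\mathring{b}_k(x_{(\tau)})=\sum_{i\in\overline{\tau}}(x_i\otimes1+(-1)^k1\otimes x_i)x_{(\tau\setminus\{i\})}$, where $\overline{\tau}$ is the underlying set of $\tau$ and $\tau\setminus\{i\}$ removes one copy of $i$. There is a homotopy equivalence $h:\mathring{B}_\ast\to B_\ast$ sending $x_{(\tau)}$, $\tau=\{i_1\le\cdots\le i_k\}$, to the sum of $1\otimes x_{j_1}\otimes\cdots\otimes x_{j_k}\otimes1$ over all distinct rearrangements $(j_1,\ldots,j_k)$ of $(i_1,\ldots,i_k)$, with a homotopy inverse $h^{-1}$ sending $1\otimes x_{j_1}\otimes\cdots\otimes x_{j_k}\otimes1$ to $x_{(\tau)}$ if $j_1\le\cdots\le j_k$ and $\tau=\{j_1\le\cdots\le j_k\}$, and to $0$ if $(j_1,\ldots,j_k)$ is not increasing. For a $k$-element multiset $\tau$ and $\sigma\subseteq[n]$, $\varphi_{\tau,\sigma}$ is the $A^e$-linear map $\mathring{B}_k\to A$ with $\varphi_{\tau,\sigma}(x_{(\tau)})=x_\sigma$ and $\varphi_{\tau,\sigma}(x_{(\tau')})=0$ for $\tau'\ne\tau$; it is regarded as an element of $\operatorname{Hom}_K(A^{\otimes k},A)$ via $\varphi_{\tau,\sigma}\mapsto\varphi_{\tau,\sigma}\circ h^{-1}$ and the identification above, and in the claim it stands for the class it represents.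
   Formalization: In (2) the span is not a subalgebra for odd n (x_[n]⊗1 times 1⊗x_1^2 leaves it, while this product is 0 in HH). For odd n the result proved is an isomorphism with the span under the product followed by dropping basis elements outside it; even n is as stated. *)

theory Defs
  imports
    "HOL-Library.Poly_Mapping"
    "HOL-Library.Multiset"
    "HOL-Algebra.QuotRing"
    "HOL-Algebra.Subrings"
    "HOL-Algebra.Module"
begin

section \<open>Free modules with a chosen basis\<close>

text \<open>
  The free \<open>K\<close>-module on a set \<open>S\<close> consists of the finitely supported functions
  \<open>'s \<Rightarrow>\<^sub>0 'k\<close> with support in \<open>S\<close>; \<open>gen s\<close> is the basis element belonging to \<open>s\<close>.
\<close>

definition free_mod :: "'s set \<Rightarrow> ('s \<Rightarrow>\<^sub>0 'k::field) set"
  where "free_mod S = {t. Poly_Mapping.keys t \<subseteq> S}"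

definition gen :: "'s \<Rightarrow> ('s \<Rightarrow>\<^sub>0 'k::field)"
  where "gen s = Poly_Mapping.single s 1"

definition kscale :: "'k \<Rightarrow> ('s \<Rightarrow>\<^sub>0 'k::field) \<Rightarrow> ('s \<Rightarrow>\<^sub>0 'k)"
  where "kscale c t = Poly_Mapping.map ((*) c) t"

text \<open>\<open>klin f\<close> is the \<open>K\<close>-linear extension of a map \<open>f\<close> given on basis elements.\<close>

definition klin :: "('s \<Rightarrow> ('r \<Rightarrow>\<^sub>0 'k)) \<Rightarrow> ('s \<Rightarrow>\<^sub>0 'k::field) \<Rightarrow> ('r \<Rightarrow>\<^sub>0 'k)"
  where "klin f t = (\<Sum>s\<in>Poly_Mapping.keys t. kscale (Poly_Mapping.lookup t s) (f s))"


section \<open>The exterior algebra and its tensor powers\<close>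

text \<open>
  The basis element \<open>gen \<sigma>\<close> is \<open>x\<^sub>\<sigma>\<close>, the product of the \<open>x\<^sub>i\<close>, \<open>i \<in> \<sigma>\<close>, in increasing order.
  For disjoint \<open>\<sigma>\<close>, \<open>\<rho>\<close>, sorting the word \<open>x\<^sub>\<sigma> x\<^sub>\<rho>\<close> takes one sign for each pair
  \<open>(i, j) \<in> \<sigma> \<times> \<rho>\<close> with \<open>j < i\<close>; if \<open>\<sigma>\<close> and \<open>\<rho>\<close> meet, the product vanishes.
\<close>

type_synonym 'k ext = "nat set \<Rightarrow>\<^sub>0 'k"

definition ext_sign :: "nat set \<Rightarrow> nat set \<Rightarrow> 'k::field"
  where "ext_sign \<sigma> \<rho> =
    (if \<sigma> \<inter> \<rho> = {} then (- 1) ^ card {(i, j). i \<in> \<sigma> \<and> j \<in> \<rho> \<and> j < i} else 0)"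

definition ext_carrier :: "nat \<Rightarrow> 'k::field ext set"
  where "ext_carrier n = free_mod (Pow {1..n})"

definition ext_mult :: "'k::field ext \<Rightarrow> 'k ext \<Rightarrow> 'k ext"
  where "ext_mult a b =
    klin (\<lambda>\<sigma>. klin (\<lambda>\<rho>. kscale (ext_sign \<sigma> \<rho>) (gen (\<sigma> \<union> \<rho>))) b) a"

text \<open>
  The \<open>m\<close>-fold tensor power of \<open>A\<close> has as basis the lists of length \<open>m\<close> of subsets of
  \<open>{1..n}\<close>; \<open>ptensor [a\<^sub>1, \<dots>, a\<^sub>m]\<close> is the pure tensor \<open>a\<^sub>1 \<otimes> \<dots> \<otimes> a\<^sub>m\<close>.
\<close>

type_synonym 'k tens = "nat set list \<Rightarrow>\<^sub>0 'k"

definition tens_pow :: "nat \<Rightarrow> nat \<Rightarrow> 'k::field tens set"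
  where "tens_pow n m = free_mod {L. length L = m \<and> set L \<subseteq> Pow {1..n}}"

primrec ptensor :: "'k::field ext list \<Rightarrow> 'k tens"
  where
    "ptensor [] = gen []"
  | "ptensor (a # as) = klin (\<lambda>\<sigma>. klin (\<lambda>L. gen (\<sigma> # L)) (ptensor as)) a"


section \<open>Bimodules over the exterior algebra\<close>

text \<open>
  Modules over \<open>A \<otimes> A\<^sup>o\<^sup>p\<close> are treated as \<open>A\<close>-bimodules on which \<open>K\<close> acts centrally. Homomorphisms
  are made extensional by requiring the value \<open>0\<close> outside the carrier of the domain.
\<close>

record (overloaded) ('s, 'k) bimod =
  bcarrier :: "('s \<Rightarrow>\<^sub>0 'k) set"
  lact :: "'k ext \<Rightarrow> ('s \<Rightarrow>\<^sub>0 'k) \<Rightarrow> ('s \<Rightarrow>\<^sub>0 'k)"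
  ract :: "('s \<Rightarrow>\<^sub>0 'k) \<Rightarrow> 'k ext \<Rightarrow> ('s \<Rightarrow>\<^sub>0 'k)"

definition bimod_hom ::
  "nat \<Rightarrow> ('s, 'k::field) bimod \<Rightarrow> ('r, 'k) bimod \<Rightarrow> (('s \<Rightarrow>\<^sub>0 'k) \<Rightarrow> ('r \<Rightarrow>\<^sub>0 'k)) set"
  where "bimod_hom n M N = {f.
     (\<forall>t\<in>bcarrier M. f t \<in> bcarrier N) \<and>
     (\<forall>t. t \<notin> bcarrier M \<longrightarrow> f t = 0) \<and>
     (\<forall>t\<in>bcarrier M. \<forall>u\<in>bcarrier M. f (t + u) = f t + f u) \<and>
     (\<forall>c. \<forall>t\<in>bcarrier M. f (kscale c t) = kscale c (f t)) \<and>
     (\<forall>a\<in>ext_carrier n. \<forall>t\<in>bcarrier M. f (lact M a t) = lact N a (f t)) \<and>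
     (\<forall>a\<in>ext_carrier n. \<forall>t\<in>bcarrier M. f (ract M t a) = ract N (f t) a)}"

definition zero_outside :: "('s \<Rightarrow>\<^sub>0 'k) set \<Rightarrow> (('s \<Rightarrow>\<^sub>0 'k) \<Rightarrow> ('r \<Rightarrow>\<^sub>0 'k)) \<Rightarrow>
    (('s \<Rightarrow>\<^sub>0 'k) \<Rightarrow> ('r \<Rightarrow>\<^sub>0 'k::field))"
  where "zero_outside S f = (\<lambda>t. if t \<in> S then f t else 0)"

definition ext_bimod :: "nat \<Rightarrow> (nat set, 'k::field) bimod"
  where "ext_bimod n = \<lparr>bcarrier = ext_carrier n, lact = ext_mult, ract = ext_mult\<rparr>"


section \<open>The bar resolution\<close>

definition bar_bimod :: "nat \<Rightarrow> nat \<Rightarrow> (nat set list, 'k::field) bimod"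
  where "bar_bimod n k = \<lparr>
     bcarrier = tens_pow n (k + 2),
     lact = (\<lambda>a. klin (\<lambda>L. ptensor (ext_mult a (gen (hd L)) # map gen (tl L)))),
     ract = (\<lambda>t a. klin (\<lambda>L. ptensor (map gen (butlast L) @ [ext_mult (gen (last L)) a])) t)\<rparr>"

definition bar_d :: "nat \<Rightarrow> 'k::field tens \<Rightarrow> 'k tens"
  where "bar_d k = klin (\<lambda>L. \<Sum>i\<le>k. kscale ((- 1) ^ i)
     (ptensor (map gen (take i L) @ [ext_mult (gen (L ! i)) (gen (L ! (i + 1)))] @
               map gen (drop (i + 2) L))))"


section \<open>Hochschild cohomology with the cup product\<close>

type_synonym 'k cochain = "'k tens \<Rightarrow> 'k ext"

definition hoch_cochains :: "nat \<Rightarrow> nat \<Rightarrow> 'k::field cochain set"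
  where "hoch_cochains n k = bimod_hom n (bar_bimod n k) (ext_bimod n)"

definition hoch_d :: "nat \<Rightarrow> nat \<Rightarrow> 'k::field cochain \<Rightarrow> 'k cochain"
  where "hoch_d n k F = zero_outside (tens_pow n (k + 3)) (\<lambda>t. F (bar_d (k + 1) t))"

text \<open>
  The identification of bimodule maps \<open>A\<^sup>\<otimes>\<^sup>k\<^sup>+\<^sup>2 \<rightarrow> A\<close> with linear maps \<open>A\<^sup>\<otimes>\<^sup>k \<rightarrow> A\<close>, in both directions.
\<close>

definition to_klin :: "nat \<Rightarrow> nat \<Rightarrow> 'k::field cochain \<Rightarrow> 'k cochain"
  where "to_klin n k F =
     zero_outside (tens_pow n k) (\<lambda>t. F (klin (\<lambda>L. gen ([{}] @ L @ [{}])) t))"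

definition of_klin :: "nat \<Rightarrow> nat \<Rightarrow> 'k::field cochain \<Rightarrow> 'k cochain"
  where "of_klin n k f = zero_outside (tens_pow n (k + 2))
     (klin (\<lambda>L. ext_mult (gen (hd L)) (ext_mult (f (gen (butlast (tl L)))) (gen (last L)))))"

definition cup_klin :: "nat \<Rightarrow> nat \<Rightarrow> nat \<Rightarrow> 'k::field cochain \<Rightarrow> 'k cochain \<Rightarrow> 'k cochain"
  where "cup_klin n k l f g = zero_outside (tens_pow n (k + l))
     (klin (\<lambda>L. ext_mult (f (gen (take k L))) (g (gen (drop k L)))))"

definition cup :: "nat \<Rightarrow> nat \<Rightarrow> nat \<Rightarrow> 'k::field cochain \<Rightarrow> 'k cochain \<Rightarrow> 'k cochain"
  where "cup n k l F G = of_klin n (k + l) (cup_klin n k l (to_klin n k F) (to_klin n l G))"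

text \<open>
  Elements of the direct sum of all cochain spaces are families of cochains, almost all zero.
\<close>

definition in_degree :: "nat \<Rightarrow> 'k::field cochain \<Rightarrow> (nat \<Rightarrow> 'k cochain)"
  where "in_degree k F = (\<lambda>j. if j = k then F else (\<lambda>_. 0))"

definition hoch_cocycles :: "nat \<Rightarrow> (nat \<Rightarrow> 'k::field cochain) ring"
  where "hoch_cocycles n = \<lparr>
     carrier = {F. (\<forall>k. F k \<in> hoch_cochains n k) \<and> finite {k. F k \<noteq> (\<lambda>_. 0)} \<and>
                   (\<forall>k. hoch_d n k (F k) = (\<lambda>_. 0))},
     monoid.mult = (\<lambda>F G m t. \<Sum>k\<le>m. cup n k (m - k) (F k) (G (m - k)) t),
     one = in_degree 0 (of_klin n 0 (klin (\<lambda>_. gen {}))),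
     zero = (\<lambda>_ _. 0),
     add = (\<lambda>F G k t. F k t + G k t)\<rparr>"

definition hoch_coboundaries :: "nat \<Rightarrow> (nat \<Rightarrow> 'k::field cochain) set"
  where "hoch_coboundaries n = {F \<in> carrier (hoch_cocycles n).
     F 0 = (\<lambda>_. 0) \<and> (\<forall>k. \<exists>G\<in>hoch_cochains n k. F (k + 1) = hoch_d n k G)}"

definition hoch_class :: "nat \<Rightarrow> (nat \<Rightarrow> 'k::field cochain) \<Rightarrow> (nat \<Rightarrow> 'k cochain) set"
  where "hoch_class n F = hoch_coboundaries n +>\<^bsub>hoch_cocycles n\<^esub> F"

definition HH :: "nat \<Rightarrow> ('k::field, (nat \<Rightarrow> 'k cochain) set) module"
  where "HH n = ring.extend (hoch_cocycles n Quot hoch_coboundaries n)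
     (module.fields (\<lambda>c X. \<Union>F\<in>X. hoch_class n (\<lambda>k t. kscale c (F k t))))"


section \<open>The small resolution\<close>

text \<open>
  The basis element \<open>gen (\<alpha>, \<tau>, \<beta>)\<close> stands for \<open>(x\<^sub>\<alpha> \<otimes> x\<^sub>\<beta>) x\<^sub>(\<^sub>\<tau>\<^sub>)\<close>, i.e.\ \<open>x\<^sub>\<alpha> x\<^sub>(\<^sub>\<tau>\<^sub>) x\<^sub>\<beta>\<close>.
\<close>

type_synonym 'k small = "(nat set \<times> nat multiset \<times> nat set) \<Rightarrow>\<^sub>0 'k"

definition small_bimod :: "nat \<Rightarrow> nat \<Rightarrow> (nat set \<times> nat multiset \<times> nat set, 'k::field) bimod"
  where "small_bimod n k = \<lparr>
     bcarrier = free_mod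
       (Pow {1..n} \<times> {\<tau>. set_mset \<tau> \<subseteq> {1..n} \<and> size \<tau> = k} \<times> Pow {1..n}),
     lact = (\<lambda>a. klin (\<lambda>(\<alpha>, \<tau>, \<beta>). klin (\<lambda>\<rho>. gen (\<rho>, \<tau>, \<beta>)) (ext_mult a (gen \<alpha>)))),
     ract = (\<lambda>t a. klin (\<lambda>(\<alpha>, \<tau>, \<beta>). klin (\<lambda>\<rho>. gen (\<alpha>, \<tau>, \<rho>)) (ext_mult (gen \<beta>) a)) t)\<rparr>"

text \<open>The bimodule map with prescribed values on the symbols \<open>x\<^sub>(\<^sub>\<tau>\<^sub>)\<close>.\<close>

definition small_extend ::
  "(nat multiset \<Rightarrow> ('r \<Rightarrow>\<^sub>0 'k)) \<Rightarrow> ('r, 'k::field) bimod \<Rightarrow> 'k small \<Rightarrow> ('r \<Rightarrow>\<^sub>0 'k)"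
  where "small_extend v N = klin (\<lambda>(\<alpha>, \<tau>, \<beta>). lact N (gen \<alpha>) (ract N (v \<tau>) (gen \<beta>)))"

definition small_d :: "nat \<Rightarrow> nat \<Rightarrow> 'k::field small \<Rightarrow> 'k small"
  where "small_d n k = small_extend
     (\<lambda>\<tau>. \<Sum>i\<in>set_mset \<tau>. gen ({i}, \<tau> - {#i#}, {}) + kscale ((- 1) ^ k) (gen ({}, \<tau> - {#i#}, {i})))
     (small_bimod n (k - 1))"

definition small_to_bar :: "nat \<Rightarrow> nat \<Rightarrow> 'k::field small \<Rightarrow> 'k tens"
  where "small_to_bar n k = small_extend
     (\<lambda>\<tau>. \<Sum>js | mset js = \<tau>. gen ([{}] @ map (\<lambda>j. {j}) js @ [{}]))
     (bar_bimod n k)"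

definition homotopic_to_id :: "nat \<Rightarrow> (nat \<Rightarrow> ('s, 'k::field) bimod) \<Rightarrow>
    (nat \<Rightarrow> ('s \<Rightarrow>\<^sub>0 'k) \<Rightarrow> ('s \<Rightarrow>\<^sub>0 'k)) \<Rightarrow> (nat \<Rightarrow> ('s \<Rightarrow>\<^sub>0 'k) \<Rightarrow> ('s \<Rightarrow>\<^sub>0 'k)) \<Rightarrow> bool"
  where "homotopic_to_id n M d f \<longleftrightarrow>
     (\<exists>s. (\<forall>k. s k \<in> bimod_hom n (M k) (M (k + 1))) \<and>
          (\<forall>k. \<forall>t\<in>bcarrier (M k).
             f k t - t = d (k + 1) (s k t) + (if k = 0 then 0 else s (k - 1) (d k t))))"

definition homotopy_inverse :: "nat \<Rightarrow> (nat \<Rightarrow> 'k::field tens \<Rightarrow> 'k small) \<Rightarrow> bool"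
  where "homotopy_inverse n g \<longleftrightarrow>
     (\<forall>k. g k \<in> bimod_hom n (bar_bimod n k) (small_bimod n k)) \<and>
     (\<forall>k. \<forall>t\<in>bcarrier (bar_bimod n (k + 1)).
        small_d n (k + 1) (g (k + 1) t) = g k (bar_d (k + 1) t)) \<and>
     homotopic_to_id n (bar_bimod n) bar_d (\<lambda>k t. small_to_bar n k (g k t)) \<and>
     homotopic_to_id n (small_bimod n) (small_d n) (\<lambda>k t. g k (small_to_bar n k t))"

definition small_phi :: "nat \<Rightarrow> nat multiset \<Rightarrow> nat set \<Rightarrow> 'k::field small \<Rightarrow> 'k ext"
  where "small_phi n \<tau> \<sigma> = small_extend (\<lambda>\<tau>'. if \<tau>' = \<tau> then gen \<sigma> else 0) (ext_bimod n)"

text \<open>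
  The class represented by \<open>\<phi>\<^sub>\<tau>\<^sub>,\<^sub>\<sigma> \<circ> g\<close>, for a homotopy inverse \<open>g\<close> of \<open>small_to_bar n\<close>. It does
  not depend on \<open>g\<close>, since homotopy inverses are unique up to homotopy.
\<close>

definition phi_class :: "nat \<Rightarrow> (nat \<Rightarrow> 'k::field tens \<Rightarrow> 'k small) \<Rightarrow>
    nat multiset \<Rightarrow> nat set \<Rightarrow> (nat \<Rightarrow> 'k cochain) set"
  where "phi_class n g \<tau> \<sigma> = hoch_class n (in_degree (size \<tau>)
     (zero_outside (tens_pow n (size \<tau> + 2)) (\<lambda>t. small_phi n \<tau> \<sigma> (g (size \<tau>) t))))"


section \<open>The tensor product of the exterior and the polynomial algebra\<close>

text \<open>
  Polynomials are finitely supported functions on the monoid \<open>nat multiset\<close> of monomials, with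
  the convolution product of \<^theory>\<open>HOL-Library.Poly_Mapping\<close>; \<open>gen (\<sigma>, \<tau>)\<close> is \<open>x\<^sub>\<sigma> \<otimes> x\<^sub>\<tau>\<close>.
\<close>

type_synonym 'k ext_poly = "(nat set \<times> nat multiset) \<Rightarrow>\<^sub>0 'k"

definition tensor :: "'k::field ext \<Rightarrow> (nat multiset \<Rightarrow>\<^sub>0 'k) \<Rightarrow> 'k ext_poly"
  where "tensor a p = klin (\<lambda>\<sigma>. klin (\<lambda>\<tau>. gen (\<sigma>, \<tau>)) p) a"

definition ext_poly_index :: "nat \<Rightarrow> (nat set \<times> nat multiset) set"
  where "ext_poly_index n = Pow {1..n} \<times> {\<tau>. set_mset \<tau> \<subseteq> {1..n}}"

definition ext_poly_mult :: "'k::field ext_poly \<Rightarrow> 'k ext_poly \<Rightarrow> 'k ext_poly"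
  where "ext_poly_mult u v =
     klin (\<lambda>(\<sigma>, \<tau>). klin (\<lambda>(\<sigma>', \<tau>').
       tensor (ext_mult (gen \<sigma>) (gen \<sigma>')) (gen \<tau> * gen \<tau>')) v) u"

definition ext_poly_alg :: "nat \<Rightarrow> ('k::field, 'k ext_poly) module"
  where "ext_poly_alg n = \<lparr>
     carrier = free_mod (ext_poly_index n),
     monoid.mult = ext_poly_mult,
     one = gen ({}, {#}),
     zero = 0,
     add = (+),
     smult = kscale\<rparr>"

definition parity_index :: "nat \<Rightarrow> (nat set \<times> nat multiset) set"
  where "parity_index n =
     {(\<sigma>, \<tau>) \<in> ext_poly_index n. (- 1 :: int) ^ card \<sigma> = (- 1) ^ size \<tau>} \<union> {({1..n}, {#})}"

definition parity_span :: "nat \<Rightarrow> 'k::field ext_poly set"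
  where "parity_span n = Modules.module.span kscale (gen ` parity_index n)"

definition parity_alg :: "nat \<Rightarrow> ('k::field, 'k ext_poly) module"
  where "parity_alg n = (ext_poly_alg n)\<lparr>carrier := parity_span n\<rparr>"

text \<open>
  For odd \<open>n\<close> the span of the basis elements indexed by \<open>parity_index n\<close> is not closed under
  multiplication: for \<open>\<tau> \<noteq> {#}\<close> of even size, the product of \<open>x\<^sub>[\<^sub>n\<^sub>] \<otimes> 1\<close> and \<open>1 \<otimes> x\<^sub>\<tau>\<close> is
  \<open>x\<^sub>[\<^sub>n\<^sub>] \<otimes> x\<^sub>\<tau>\<close>, which is outside the span (these are the only basis products leaving it). In
  cohomology those products vanish, since \<open>\<phi>\<^sub>\<tau>\<^sub>,\<^sub>[\<^sub>n\<^sub>]\<close> is then a coboundary. Accordingly the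
  multiplication of \<open>parity_alg_trunc\<close> is the one of \<open>ext_poly_alg\<close> followed by the projection that
  discards the basis elements outside the span.
\<close>

definition parity_proj :: "nat \<Rightarrow> 'k::field ext_poly \<Rightarrow> 'k ext_poly"
  where "parity_proj n = klin (\<lambda>p. if p \<in> parity_index n then gen p else 0)"

definition parity_alg_trunc :: "nat \<Rightarrow> ('k::field, 'k ext_poly) module"
  where "parity_alg_trunc n =
     (parity_alg n)\<lparr>monoid.mult := (\<lambda>u v. parity_proj n (ext_poly_mult u v))\<rparr>"


section \<open>Subalgebras and isomorphisms of algebras\<close>

definition is_subalgebra :: "'v set \<Rightarrow> ('k, 'v) module \<Rightarrow> bool"
  where "is_subalgebra V M \<longleftrightarrow> subring V M \<and> (\<forall>c. \<forall>v\<in>V. c \<odot>\<^bsub>M\<^esub> v \<in> V)"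

definition alg_iso :: "('k, 'v) module \<Rightarrow> ('k, 'w) module \<Rightarrow> ('v \<Rightarrow> 'w) set"
  where "alg_iso M N =
     {f \<in> ring_iso M N. \<forall>c. \<forall>v\<in>carrier M. f (c \<odot>\<^bsub>M\<^esub> v) = c \<odot>\<^bsub>N\<^esub> f v}"

end

theory Submission
  imports Defs
begin

text \<open>
  The complex \<open>Hom(\<B>, A)\<close>, with \<open>\<B>\<close> the small resolution, computes the cohomology because \<open>\<B>\<close> and
  the bar complex are free resolutions of \<open>A\<close>: maps between them exist and are unique up to
  homotopy. The differential of \<open>\<B>\<close> is the sum of a part acting on the left tensor factor, which raises
  the degree there, and of a Koszul differential acting on the other two factors, which is contractible;
  hence \<open>\<B>\<close> is exact by induction on the degree of the left factor.
  
  Restricting a cochain on the bar complex to the sums of all rearrangements of \<open>x\<^sub>i\<^sub>1 \<otimes> \<dots> \<otimes> x\<^sub>i\<^sub>k\<close> turns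
  the cup product strictly into the product of \<open>\<Lambda>[x] \<otimes> K[x]\<close>, because every word splits uniquely into a
  prefix and a suffix of prescribed lengths. The induced differential sends \<open>x\<^sub>\<sigma> \<otimes> x\<^sub>\<tau>\<close> to
  \<open>(1 - (-1)\<^sup>k) \<Sum>\<^sub>i x\<^sub>i x\<^sub>\<sigma> \<otimes> x\<^sub>i x\<^sub>\<tau>\<close> with \<open>k = |\<sigma>| + |\<tau>|\<close>. It vanishes in characteristic \<open>2\<close>; otherwise it
  vanishes on the basis elements with even \<open>k\<close>, and those with odd \<open>k\<close> form part of a Koszul complex
  whose cohomology is spanned by \<open>x\<^sub>[\<^sub>n\<^sub>] \<otimes> 1\<close>.
\<close>

section \<open>Linear maps between free modules\<close>

lemma lookup_kscale [simp]: "Poly_Mapping.lookup (kscale c t) s = c * Poly_Mapping.lookup t s"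
  by (simp add: kscale_def Poly_Mapping.map.rep_eq when_def)

interpretation kmod: vector_space "kscale :: 'k::field \<Rightarrow> ('s \<Rightarrow>\<^sub>0 'k) \<Rightarrow> _"
  by unfold_locales (auto intro!: poly_mapping_eqI simp: lookup_add algebra_simps)

abbreviation klinear :: "(('s \<Rightarrow>\<^sub>0 'k::field) \<Rightarrow> ('r \<Rightarrow>\<^sub>0 'k)) \<Rightarrow> bool"
  where "klinear \<equiv> Vector_Spaces.linear kscale kscale"

lemma klinearI:
  assumes "\<And>t u. f (t + u) = f t + f u" and "\<And>c t. f (kscale c t) = kscale c (f t)"
  shows "klinear f"
  using assms
  by (auto simp: Vector_Spaces.linear_def module_hom_def module_hom_axioms_def kmod.vector_space_axioms
      kmod.module_axioms)

lemma klinear_add: "klinear f \<Longrightarrow> f (t + u) = f t + f u"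
  and klinear_scale: "klinear f \<Longrightarrow> f (kscale c t) = kscale c (f t)"
  unfolding Vector_Spaces.linear_def by (metis module_hom.add, metis module_hom.scale)

lemma klinear_zero: "klinear f \<Longrightarrow> f 0 = 0"
  using klinear_add[of f 0 0] by simp

lemma klinear_minus: "klinear f \<Longrightarrow> f (- t) = - f t"
  using klinear_add[of f t "- t"] klinear_zero[of f] by (simp add: eq_neg_iff_add_eq_0 add.commute)

lemma klinear_diff: "klinear f \<Longrightarrow> f (t - u) = f t - f u"
  using klinear_add[of f t "- u"] klinear_minus[of f u] by simp

lemma klinear_sum: "klinear f \<Longrightarrow> f (\<Sum>i\<in>I. g i) = (\<Sum>i\<in>I. f (g i))"
  by (induction I rule: infinite_finite_induct) (auto simp: klinear_zero klinear_add)

lemmas klinear_dist = klinear_add klinear_scale klinear_zero klinear_minus klinear_diff klinear_sum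

named_theorems klin_intros

lemma klinear_id [klin_intros]: "klinear (\<lambda>t. t)"
  by (rule klinearI) auto

lemma klinear_const_0 [klin_intros]: "klinear (\<lambda>t. 0)"
  by (rule klinearI) auto

lemma klinear_plus [klin_intros]: "klinear f \<Longrightarrow> klinear g \<Longrightarrow> klinear (\<lambda>t. f t + g t)"
  by (rule klinearI) (auto simp: klinear_dist kmod.scale_right_distrib)

lemma klinear_sub [klin_intros]: "klinear f \<Longrightarrow> klinear g \<Longrightarrow> klinear (\<lambda>t. f t - g t)"
  by (rule klinearI) (auto simp: klinear_dist kmod.scale_right_diff_distrib)

lemma klinear_kscale [klin_intros]: "klinear f \<Longrightarrow> klinear (\<lambda>t. kscale c (f t))"
  by (rule klinearI) (auto simp: klinear_dist kmod.scale_right_distrib mult.commute)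

lemma klinear_sums [klin_intros]: "(\<And>i. i \<in> I \<Longrightarrow> klinear (f i)) \<Longrightarrow> klinear (\<lambda>t. \<Sum>i\<in>I. f i t)"
  by (induction I rule: infinite_finite_induct) (auto intro: klin_intros)

lemma klinear_if [klin_intros]: "klinear f \<Longrightarrow> klinear g \<Longrightarrow> klinear (\<lambda>t. if b then f t else g t)"
  by (cases b) auto

lemma klinear_comp: "klinear f \<Longrightarrow> klinear g \<Longrightarrow> klinear (\<lambda>t. f (g t))"
  by (rule klinearI) (auto simp: klinear_dist)

lemma klin_superset:
  assumes "finite S" "Poly_Mapping.keys t \<subseteq> S"
  shows "klin f t = (\<Sum>s\<in>S. kscale (Poly_Mapping.lookup t s) (f s))"
  unfolding klin_def using assms
  by (intro sum.mono_neutral_left) (auto simp: in_keys_iff)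

lemma klinear_klin:
  fixes f :: "'s \<Rightarrow> ('r \<Rightarrow>\<^sub>0 'k::field)"
  shows "klinear (klin f)"
proof (rule klinearI)
  fix t u :: "'s \<Rightarrow>\<^sub>0 'k" and c
  let ?S = "Poly_Mapping.keys t \<union> Poly_Mapping.keys u"
  have "Poly_Mapping.keys (t + u) \<subseteq> ?S"
    by (rule Poly_Mapping.keys_add)
  then have "klin f (t + u) = (\<Sum>s\<in>?S. kscale (Poly_Mapping.lookup (t + u) s) (f s))"
    by (intro klin_superset) auto
  also have "\<dots> = klin f t + klin f u"
    by (subst (1 2) klin_superset[of ?S])
      (auto simp: lookup_add kmod.scale_left_distrib sum.distrib)
  finally show "klin f (t + u) = klin f t + klin f u" .
  have "klin f (kscale c t) = (\<Sum>s\<in>Poly_Mapping.keys t. kscale (Poly_Mapping.lookup (kscale c t) s) (f s))"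
    by (intro klin_superset) (auto simp: in_keys_iff)
  then show "klin f (kscale c t) = kscale c (klin f t)"
    by (simp add: klin_def kmod.scale_sum_right)
qed

lemma klinear_klin_arg [klin_intros]: "klinear g \<Longrightarrow> klinear (\<lambda>t. klin f (g t))"
  by (rule klinear_comp[OF klinear_klin])

lemma klinear_klin_fun [klin_intros]: "(\<And>s. klinear (f s)) \<Longrightarrow> klinear (\<lambda>t. klin (\<lambda>s. f s t) u)"
  unfolding klin_def by (intro klin_intros)

lemma klin_gen [simp]: "klin f (gen s) = f s"
  by (simp add: klin_def gen_def)

lemmas klin_dist = klinear_dist[OF klinear_klin]

lemma klin_klinear: "klinear g \<Longrightarrow> g (klin f t) = klin (\<lambda>s. g (f s)) t"
  unfolding klin_def by (simp add: klinear_dist)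

lemma klin_klin [simp]: "klin f (klin g t) = klin (\<lambda>s. klin f (g s)) t"
  by (rule klin_klinear[OF klinear_klin])

lemma klin_fun_dist:
  "klin (\<lambda>s. f s + g s) t = klin f t + klin g t" "klin (\<lambda>s. f s - g s) t = klin f t - klin g t"
  "klin (\<lambda>s. kscale c (f s)) t = kscale c (klin f t)" "klin (\<lambda>s. - f s) t = - klin f t"
  "klin (\<lambda>s. 0) t = 0"
  by (simp_all add: klin_def kmod.scale_right_distrib kmod.scale_right_diff_distrib sum.distrib
      sum_subtractf sum_negf kmod.scale_sum_right mult.commute)

lemma klin_cong: "(\<And>s. s \<in> Poly_Mapping.keys t \<Longrightarrow> f s = g s) \<Longrightarrow> klin f t = klin g t"
  unfolding klin_def by (auto intro: sum.cong)

lemma lookup_gen: "Poly_Mapping.lookup (gen s) r = (if s = r then 1 else 0)"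
  by (simp add: gen_def lookup_single when_def)

lemma keys_gen [simp]: "Poly_Mapping.keys (gen s :: 's \<Rightarrow>\<^sub>0 'k::field) = {s}"
  by (simp add: gen_def)

lemma klin_gen_id [simp]: "klin gen t = t"
proof (rule poly_mapping_eqI)
  fix s
  have "Poly_Mapping.lookup (klin gen t) s =
      (\<Sum>r\<in>Poly_Mapping.keys t. if r = s then Poly_Mapping.lookup t r else 0)"
    unfolding klin_def lookup_sum by (intro sum.cong) (auto simp: lookup_gen)
  then show "Poly_Mapping.lookup (klin gen t) s = Poly_Mapping.lookup t s"
    by (simp add: in_keys_iff)
qed

lemma klinear_eq_klin: "klinear f \<Longrightarrow> f t = klin (\<lambda>s. f (gen s)) t"
  using klin_klinear[of f gen t] by simp

lemma klinear_eqI: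
  assumes "klinear f" "klinear g" "t \<in> free_mod S" "\<And>s. s \<in> S \<Longrightarrow> f (gen s) = g (gen s)"
  shows "f t = g t"
  using assms by (subst (1 2) klinear_eq_klin) (auto simp: free_mod_def intro!: klin_cong)

lemma bilinear_eqI:
  assumes "\<And>t. klinear (\<lambda>a. F a t)" "\<And>a. klinear (F a)" "\<And>t. klinear (\<lambda>a. G a t)" "\<And>a. klinear (G a)"
    and "a \<in> free_mod A" "t \<in> free_mod S"
    and eq: "\<And>x s. x \<in> A \<Longrightarrow> s \<in> S \<Longrightarrow> F (gen x) (gen s) = G (gen x) (gen s)"
  shows "F a t = G a t"
proof (rule klinear_eqI[of "\<lambda>a. F a t" "\<lambda>a. G a t" a A])
  fix x assume "x \<in> A"
  then show "F (gen x) t = G (gen x) t"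
    using assms by (intro klinear_eqI[of "F (gen x)" "G (gen x)" t S]) auto
qed (use assms in auto)

lemma trilinear_eqI:
  assumes "\<And>b t. klinear (\<lambda>a. F a b t)" "\<And>a t. klinear (\<lambda>b. F a b t)" "\<And>a b. klinear (F a b)"
    and "\<And>b t. klinear (\<lambda>a. G a b t)" "\<And>a t. klinear (\<lambda>b. G a b t)" "\<And>a b. klinear (G a b)"
    and "a \<in> free_mod A" "b \<in> free_mod B" "t \<in> free_mod S"
    and eq: "\<And>x y s. x \<in> A \<Longrightarrow> y \<in> B \<Longrightarrow> s \<in> S \<Longrightarrow> F (gen x) (gen y) (gen s) = G (gen x) (gen y) (gen s)"
  shows "F a b t = G a b t"
proof (rule klinear_eqI[of "\<lambda>a. F a b t" "\<lambda>a. G a b t" a A])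
  fix x assume "x \<in> A"
  then show "F (gen x) b t = G (gen x) b t"
    using assms by (intro bilinear_eqI[of "F (gen x)" "G (gen x)" b B t S]) auto
qed (use assms in auto)

lemma gen_in_free_mod [simp]: "(gen s :: 's \<Rightarrow>\<^sub>0 'k::field) \<in> free_mod S \<longleftrightarrow> s \<in> S"
  by (simp add: free_mod_def)

lemma free_mod_iff: "t \<in> free_mod S \<longleftrightarrow> (\<forall>s. s \<notin> S \<longrightarrow> Poly_Mapping.lookup t s = 0)"
  by (auto simp: free_mod_def in_keys_iff)

lemma subspace_free_mod: "kmod.subspace (free_mod S)"
  unfolding kmod.subspace_def by (simp add: free_mod_iff lookup_add)

lemmas free_mod_closed [simp, intro] =
  kmod.subspace_0[OF subspace_free_mod] kmod.subspace_add[OF subspace_free_mod]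
  kmod.subspace_scale[OF subspace_free_mod] kmod.subspace_neg[OF subspace_free_mod]
  kmod.subspace_diff[OF subspace_free_mod] kmod.subspace_sum[OF subspace_free_mod]

lemma klin_in_subspace:
  assumes "kmod.subspace W" "t \<in> free_mod S" "\<And>s. s \<in> S \<Longrightarrow> f s \<in> W"
  shows "klin f t \<in> W"
  unfolding klin_def using assms
  by (intro kmod.subspace_sum kmod.subspace_scale) (auto simp: free_mod_def)

lemma klinear_in_subspace:
  assumes "klinear f" "kmod.subspace W" "t \<in> free_mod S" "\<And>s. s \<in> S \<Longrightarrow> f (gen s) \<in> W"
  shows "f t \<in> W"
  using assms by (subst klinear_eq_klin) (auto intro: klin_in_subspace)

lemmas klin_in_free_mod = klin_in_subspace[OF subspace_free_mod]
lemmas klinear_in_free_mod = klinear_in_subspace[OF _ subspace_free_mod]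

lemma free_mod_UNIV [simp]: "t \<in> free_mod UNIV"
  by (simp add: free_mod_iff)

lemma free_mod_mono: "S \<subseteq> T \<Longrightarrow> free_mod S \<subseteq> free_mod T"
  by (auto simp: free_mod_def)

lemma free_mod_empty: "free_mod {} = {0}"
  by (auto simp: free_mod_def)

section \<open>The exterior algebra\<close>

lemma ext_sign_empty [simp]: "ext_sign {} \<rho> = 1" "ext_sign \<sigma> {} = 1"
  by (auto simp: ext_sign_def)

lemma ext_sign_meet: "\<sigma> \<inter> \<rho> \<noteq> {} \<Longrightarrow> ext_sign \<sigma> \<rho> = 0"
  by (auto simp: ext_sign_def)

lemma finite_inversions:
  "finite \<sigma> \<Longrightarrow> finite \<rho> \<Longrightarrow> finite {(i :: nat, j :: nat). i \<in> \<sigma> \<and> j \<in> \<rho> \<and> j < i}"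
  by (rule finite_subset[of _ "\<sigma> \<times> \<rho>"]) auto

lemma ext_sign_Un_left:
  assumes "finite \<sigma>" "finite \<rho>" "finite \<omega>" "\<sigma> \<inter> \<rho> = {}"
  shows "(ext_sign (\<sigma> \<union> \<rho>) \<omega> :: 'k::field) = ext_sign \<sigma> \<omega> * ext_sign \<rho> \<omega>"
proof -
  have "{(i, j). i \<in> \<sigma> \<union> \<rho> \<and> j \<in> \<omega> \<and> j < i} =
      {(i, j). i \<in> \<sigma> \<and> j \<in> \<omega> \<and> j < i} \<union> {(i, j). i \<in> \<rho> \<and> j \<in> \<omega> \<and> j < i}"
    by auto
  moreover have "{(i, j). i \<in> \<sigma> \<and> j \<in> \<omega> \<and> j < i} \<inter> {(i, j). i \<in> \<rho> \<and> j \<in> \<omega> \<and> j < i} = {}"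
    using assms by auto
  ultimately have "card {(i, j). i \<in> \<sigma> \<union> \<rho> \<and> j \<in> \<omega> \<and> j < i} =
      card {(i, j). i \<in> \<sigma> \<and> j \<in> \<omega> \<and> j < i} + card {(i, j). i \<in> \<rho> \<and> j \<in> \<omega> \<and> j < i}"
    using assms by (simp add: card_Un_disjoint finite_inversions)
  then show ?thesis
    by (auto simp: ext_sign_def power_add Int_Un_distrib2)
qed

lemma ext_sign_Un_right:
  assumes "finite \<sigma>" "finite \<rho>" "finite \<omega>" "\<rho> \<inter> \<omega> = {}"
  shows "(ext_sign \<sigma> (\<rho> \<union> \<omega>) :: 'k::field) = ext_sign \<sigma> \<rho> * ext_sign \<sigma> \<omega>"
proof -
  have "{(i, j). i \<in> \<sigma> \<and> j \<in> \<rho> \<union> \<omega> \<and> j < i} =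
      {(i, j). i \<in> \<sigma> \<and> j \<in> \<rho> \<and> j < i} \<union> {(i, j). i \<in> \<sigma> \<and> j \<in> \<omega> \<and> j < i}"
    by auto
  moreover have "{(i, j). i \<in> \<sigma> \<and> j \<in> \<rho> \<and> j < i} \<inter> {(i, j). i \<in> \<sigma> \<and> j \<in> \<omega> \<and> j < i} = {}"
    using assms by auto
  ultimately have "card {(i, j). i \<in> \<sigma> \<and> j \<in> \<rho> \<union> \<omega> \<and> j < i} =
      card {(i, j). i \<in> \<sigma> \<and> j \<in> \<rho> \<and> j < i} + card {(i, j). i \<in> \<sigma> \<and> j \<in> \<omega> \<and> j < i}"
    using assms by (simp add: card_Un_disjoint finite_inversions)
  then show ?thesis
    by (auto simp: ext_sign_def power_add Int_Un_distrib)
qed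

lemma ext_sign_assoc:
  assumes "finite \<sigma>" "finite \<rho>" "finite \<omega>"
  shows "(ext_sign \<sigma> \<rho> * ext_sign (\<sigma> \<union> \<rho>) \<omega> :: 'k::field) = ext_sign \<rho> \<omega> * ext_sign \<sigma> (\<rho> \<union> \<omega>)"
proof (cases "\<sigma> \<inter> \<rho> = {} \<and> \<rho> \<inter> \<omega> = {}")
  case True
  then show ?thesis
    using assms by (simp add: ext_sign_Un_left ext_sign_Un_right)
next
  case False
  moreover have "ext_sign \<sigma> (\<rho> \<union> \<omega>) = (0 :: 'k) \<and> ext_sign \<sigma> \<rho> = (0 :: 'k)" if "\<sigma> \<inter> \<rho> \<noteq> {}"
    using that by (intro conjI ext_sign_meet) auto
  moreover have "ext_sign (\<sigma> \<union> \<rho>) \<omega> = (0 :: 'k) \<and> ext_sign \<rho> \<omega> = (0 :: 'k)" if "\<rho> \<inter> \<omega> \<noteq> {}"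
    using that by (intro conjI ext_sign_meet) auto
  ultimately show ?thesis
    by (metis mult_zero_left mult_zero_right)
qed

lemma ext_sign_commute:
  assumes "finite \<sigma>"
  shows "(ext_sign \<sigma> {i} :: 'k::field) = (- 1) ^ card \<sigma> * ext_sign {i} \<sigma>"
proof (cases "i \<in> \<sigma>")
  case False
  have "{(a, b). a \<in> \<sigma> \<and> b \<in> {i} \<and> b < a} = (\<lambda>a. (a, i)) ` {a \<in> \<sigma>. i < a}"
    "{(a, b). a \<in> {i} \<and> b \<in> \<sigma> \<and> b < a} = Pair i ` {a \<in> \<sigma>. a < i}"
    by auto
  then have *: "card {(a, b). a \<in> \<sigma> \<and> b \<in> {i} \<and> b < a} = card {a \<in> \<sigma>. i < a}"
    "card {(a, b). a \<in> {i} \<and> b \<in> \<sigma> \<and> b < a} = card {a \<in> \<sigma>. a < i}"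
    by (auto intro!: card_image inj_onI)
  have "\<sigma> = {a \<in> \<sigma>. i < a} \<union> {a \<in> \<sigma>. a < i}"
    using False by (auto simp: not_less order.order_iff_strict)
  then have "card \<sigma> = card {a \<in> \<sigma>. i < a} + card {a \<in> \<sigma>. a < i}"
    using assms card_Un_disjoint[of "{a \<in> \<sigma>. i < a}" "{a \<in> \<sigma>. a < i}"] by fastforce
  then have "even (card \<sigma> + card {a \<in> \<sigma>. a < i}) = even (card {a \<in> \<sigma>. i < a})"
    by presburger
  then show ?thesis
    using False * by (simp add: ext_sign_def flip: power_add) (simp add: minus_one_power_iff)
qed (simp add: ext_sign_def)

lemma ext_sign_square: "\<sigma> \<inter> \<rho> = {} \<Longrightarrow> (ext_sign \<sigma> \<rho> * ext_sign \<sigma> \<rho> :: 'k::field) = 1"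
  by (simp add: ext_sign_def flip: power_add mult_2)

lemma ext_sign_singletons: "i \<noteq> j \<Longrightarrow> (ext_sign {i} {j} :: 'k::field) = - ext_sign {j} {i}"
  using ext_sign_commute[of "{i}" j] by simp

lemma ext_sign_insert_anticommute:
  assumes "finite \<sigma>" "i \<noteq> j" "i \<notin> \<sigma>" "j \<notin> \<sigma>"
  shows "(ext_sign {j} (insert i \<sigma>) * ext_sign {i} \<sigma> :: 'k::field) =
    - (ext_sign {i} (insert j \<sigma>) * ext_sign {j} \<sigma>)"
  using assms ext_sign_Un_right[of "{j}" "{i}" \<sigma>, where 'k = 'k]
    ext_sign_Un_right[of "{i}" "{j}" \<sigma>, where 'k = 'k]
    ext_sign_singletons[of i j, where 'k = 'k] by (simp add: mult_ac)

lemma ext_mult_gen [simp]: "ext_mult (gen \<sigma>) (gen \<rho>) = kscale (ext_sign \<sigma> \<rho>) (gen (\<sigma> \<union> \<rho>))"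
  by (simp add: ext_mult_def)

lemma klinear_ext_mult_left [klin_intros]: "klinear f \<Longrightarrow> klinear (\<lambda>t. ext_mult (f t) b)"
  unfolding ext_mult_def by (intro klin_intros)

lemma klinear_ext_mult_right [klin_intros]: "klinear f \<Longrightarrow> klinear (\<lambda>t. ext_mult a (f t))"
  unfolding ext_mult_def by (intro klin_intros)

lemmas ext_mult_dist =
  klinear_dist[OF klinear_ext_mult_left[OF klinear_id]]
  klinear_dist[OF klinear_ext_mult_right[OF klinear_id]]

lemma gen_in_ext_carrier [simp]: "(gen \<sigma> :: 'k::field ext) \<in> ext_carrier n \<longleftrightarrow> \<sigma> \<subseteq> {1..n}"
  by (simp add: ext_carrier_def)

lemma subspace_ext_carrier: "kmod.subspace (ext_carrier n)"
  by (simp add: ext_carrier_def subspace_free_mod)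

lemmas ext_carrier_closed [simp, intro] =
  kmod.subspace_0[OF subspace_ext_carrier] kmod.subspace_add[OF subspace_ext_carrier]
  kmod.subspace_scale[OF subspace_ext_carrier] kmod.subspace_neg[OF subspace_ext_carrier]
  kmod.subspace_diff[OF subspace_ext_carrier] kmod.subspace_sum[OF subspace_ext_carrier]

lemma ext_mult_closed [simp, intro]:
  assumes "a \<in> ext_carrier n" "b \<in> ext_carrier n"
  shows "ext_mult a b \<in> ext_carrier n"
  using assms unfolding ext_mult_def
  by (auto simp: ext_carrier_def intro!: klin_in_free_mod[where S = "Pow {1..n}"])

lemma finite_ext_index: "\<sigma> \<subseteq> {1..n::nat} \<Longrightarrow> finite \<sigma>"
  using finite_subset by blast

lemma ext_mult_assoc:
  assumes "a \<in> ext_carrier n" "b \<in> ext_carrier n" "c \<in> ext_carrier n"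
  shows "ext_mult (ext_mult a b) c = ext_mult a (ext_mult b c)"
proof -
  have 1: "ext_mult (ext_mult (gen \<sigma>) (gen \<rho>)) (gen \<omega>) = ext_mult (gen \<sigma>) (ext_mult (gen \<rho>) (gen \<omega> :: 'a ext))"
    if "\<sigma> \<subseteq> {1..n}" "\<rho> \<subseteq> {1..n}" "\<omega> \<subseteq> {1..n}" for \<sigma> \<rho> \<omega>
    using that[THEN finite_ext_index] by (simp add: ext_mult_dist ext_sign_assoc Un_assoc)
  show ?thesis
    by (rule trilinear_eqI[of "\<lambda>a b c. ext_mult (ext_mult a b) c" "\<lambda>a b c. ext_mult a (ext_mult b c)"
          a "Pow {1..n}" b "Pow {1..n}" c "Pow {1..n}"])
      (use assms 1 in \<open>auto intro!: klin_intros simp: ext_carrier_def simp del: ext_mult_gen\<close>)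
qed

lemma ext_mult_unit [simp]: "ext_mult (gen {}) a = a" "ext_mult a (gen {}) = a"
  unfolding ext_mult_def by simp_all

section \<open>Bimodules\<close>

locale exterior_bimodule =
  fixes n :: nat and N :: "('s, 'k::field) bimod"
  assumes subspace_carrier: "kmod.subspace (bcarrier N)"
    and lact_closed: "a \<in> ext_carrier n \<Longrightarrow> t \<in> bcarrier N \<Longrightarrow> lact N a t \<in> bcarrier N"
    and ract_closed: "a \<in> ext_carrier n \<Longrightarrow> t \<in> bcarrier N \<Longrightarrow> ract N t a \<in> bcarrier N"
    and klinear_lact: "klinear (lact N a)"
    and klinear_lact_scalar: "klinear (\<lambda>a. lact N a t)"
    and klinear_ract: "klinear (\<lambda>t. ract N t a)"
    and klinear_ract_scalar: "klinear (ract N t)"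
    and lact_lact: "a \<in> ext_carrier n \<Longrightarrow> b \<in> ext_carrier n \<Longrightarrow> t \<in> bcarrier N \<Longrightarrow>
      lact N a (lact N b t) = lact N (ext_mult a b) t"
    and ract_ract: "a \<in> ext_carrier n \<Longrightarrow> b \<in> ext_carrier n \<Longrightarrow> t \<in> bcarrier N \<Longrightarrow>
      ract N (ract N t a) b = ract N t (ext_mult a b)"
    and lact_ract: "a \<in> ext_carrier n \<Longrightarrow> b \<in> ext_carrier n \<Longrightarrow> t \<in> bcarrier N \<Longrightarrow>
      lact N a (ract N t b) = ract N (lact N a t) b"
    and lact_unit: "t \<in> bcarrier N \<Longrightarrow> lact N (gen {}) t = t"
    and ract_unit: "t \<in> bcarrier N \<Longrightarrow> ract N t (gen {}) = t"
begin

lemmas carrier_closed =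
  kmod.subspace_0[OF subspace_carrier] kmod.subspace_add[OF subspace_carrier]
  kmod.subspace_scale[OF subspace_carrier] kmod.subspace_neg[OF subspace_carrier]
  kmod.subspace_diff[OF subspace_carrier] kmod.subspace_sum[OF subspace_carrier]

lemmas act_dist =
  klinear_dist[OF klinear_lact] klinear_dist[OF klinear_lact_scalar]
  klinear_dist[OF klinear_ract] klinear_dist[OF klinear_ract_scalar]

end

lemma exterior_bimodule_ext: "exterior_bimodule n (ext_bimod n)"
  by (rule exterior_bimodule.intro; simp add: ext_bimod_def subspace_ext_carrier ext_mult_assoc[of _ n])
    (rule klinear_ext_mult_left[OF klinear_id] klinear_ext_mult_right[OF klinear_id])+

definition bimod_map ::
  "nat \<Rightarrow> ('s, 'k::field) bimod \<Rightarrow> ('r, 'k) bimod \<Rightarrow> (('s \<Rightarrow>\<^sub>0 'k) \<Rightarrow> ('r \<Rightarrow>\<^sub>0 'k)) \<Rightarrow> bool"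
  where "bimod_map n M N f \<longleftrightarrow>
     (\<forall>t\<in>bcarrier M. f t \<in> bcarrier N) \<and>
     (\<forall>t\<in>bcarrier M. \<forall>u\<in>bcarrier M. f (t + u) = f t + f u) \<and>
     (\<forall>c. \<forall>t\<in>bcarrier M. f (kscale c t) = kscale c (f t)) \<and>
     (\<forall>a\<in>ext_carrier n. \<forall>t\<in>bcarrier M. f (lact M a t) = lact N a (f t)) \<and>
     (\<forall>a\<in>ext_carrier n. \<forall>t\<in>bcarrier M. f (ract M t a) = ract N (f t) a)"

lemma bimod_hom_iff:
  "f \<in> bimod_hom n M N \<longleftrightarrow> bimod_map n M N f \<and> (\<forall>t. t \<notin> bcarrier M \<longrightarrow> f t = 0)"
  by (auto simp: bimod_hom_def bimod_map_def)

lemma bimod_map_closed: "bimod_map n M N f \<Longrightarrow> t \<in> bcarrier M \<Longrightarrow> f t \<in> bcarrier N"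
  and bimod_map_add: "bimod_map n M N f \<Longrightarrow> t \<in> bcarrier M \<Longrightarrow> u \<in> bcarrier M \<Longrightarrow> f (t + u) = f t + f u"
  and bimod_map_scale: "bimod_map n M N f \<Longrightarrow> t \<in> bcarrier M \<Longrightarrow> f (kscale c t) = kscale c (f t)"
  and bimod_map_lact: "bimod_map n M N f \<Longrightarrow> t \<in> bcarrier M \<Longrightarrow> a \<in> ext_carrier n \<Longrightarrow>
    f (lact M a t) = lact N a (f t)"
  and bimod_map_ract: "bimod_map n M N f \<Longrightarrow> t \<in> bcarrier M \<Longrightarrow> a \<in> ext_carrier n \<Longrightarrow>
    f (ract M t a) = ract N (f t) a"
  by (simp_all add: bimod_map_def)

lemma bimod_map_cong:
  assumes "exterior_bimodule n M" "bimod_map n M N f" "\<And>t. t \<in> bcarrier M \<Longrightarrow> f t = g t"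
  shows "bimod_map n M N g"
proof -
  interpret exterior_bimodule n M by fact
  show ?thesis
    using assms(2) unfolding bimod_map_def
    by (simp add: assms(3)[symmetric] carrier_closed lact_closed ract_closed)
qed

lemma bimod_map_comp:
  "bimod_map n M N f \<Longrightarrow> bimod_map n N P g \<Longrightarrow> bimod_map n M P (\<lambda>t. g (f t))"
  unfolding bimod_map_def by simp

lemma bimod_map_zero_outside:
  assumes "exterior_bimodule n M" "bimod_map n M N f"
  shows "zero_outside (bcarrier M) f \<in> bimod_hom n M N"
  unfolding bimod_hom_iff
  using bimod_map_cong[OF assms, of "zero_outside (bcarrier M) f"] by (simp add: zero_outside_def)

context exterior_bimodule
begin

lemma map_zero: "bimod_map n N P f \<Longrightarrow> f 0 = 0"
  using bimod_map_scale[of n N P f 0 0] by (simp add: carrier_closed)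

lemma map_diff:
  assumes "bimod_map n N P f" "t \<in> bcarrier N" "u \<in> bcarrier N"
  shows "f (t - u) = f t - f u"
  using bimod_map_add[OF assms(1), of "t - u" u] assms by (simp add: carrier_closed)

lemma map_sum:
  assumes "bimod_map n N P f" "\<And>i. i \<in> I \<Longrightarrow> g i \<in> bcarrier N"
  shows "f (\<Sum>i\<in>I. g i) = (\<Sum>i\<in>I. f (g i))"
  using assms(2)
  by (induction I rule: infinite_finite_induct)
    (auto simp: map_zero[OF assms(1)] bimod_map_add[OF assms(1)] carrier_closed)

lemma bimod_map_id: "bimod_map n N N (\<lambda>t. t)"
  by (simp add: bimod_map_def)

lemma bimod_map_0: "bimod_map n M N (\<lambda>t. 0)"
  by (simp add: bimod_map_def carrier_closed act_dist)

lemma bimod_map_plus: "bimod_map n M N f \<Longrightarrow> bimod_map n M N g \<Longrightarrow> bimod_map n M N (\<lambda>t. f t + g t)"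
  by (simp add: bimod_map_def carrier_closed act_dist kmod.scale_right_distrib)

lemma bimod_map_kscale: "bimod_map n M N f \<Longrightarrow> bimod_map n M N (\<lambda>t. kscale c (f t))"
  by (simp add: bimod_map_def carrier_closed act_dist kmod.scale_right_distrib mult.commute)

lemma bimod_map_minus: "bimod_map n M N f \<Longrightarrow> bimod_map n M N g \<Longrightarrow> bimod_map n M N (\<lambda>t. f t - g t)"
  by (simp add: bimod_map_def carrier_closed act_dist kmod.scale_right_diff_distrib)

lemma bimod_map_sums: "(\<And>i. i \<in> I \<Longrightarrow> bimod_map n M N (f i)) \<Longrightarrow> bimod_map n M N (\<lambda>t. \<Sum>i\<in>I. f i t)"
  by (induction I rule: infinite_finite_induct) (auto intro: bimod_map_0 bimod_map_plus)

lemma subspace_image: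
  assumes "bimod_map n N P f"
  shows "kmod.subspace (f ` bcarrier N)"
  unfolding kmod.subspace_def
proof (intro conjI ballI allI)
  show "0 \<in> f ` bcarrier N"
    using map_zero[OF assms] carrier_closed(1) by (intro image_eqI[of _ _ 0]) auto
next
  fix x y assume "x \<in> f ` bcarrier N" "y \<in> f ` bcarrier N"
  then show "x + y \<in> f ` bcarrier N"
    by (auto simp: bimod_map_add[OF assms, symmetric] carrier_closed)
next
  fix c x assume "x \<in> f ` bcarrier N"
  then show "kscale c x \<in> f ` bcarrier N"
    by (auto simp: bimod_map_scale[OF assms, symmetric] carrier_closed)
qed

end

locale free_bimodule =
  fixes n :: nat and M :: "('s, 'k::field) bimod"
    and mk :: "nat set \<Rightarrow> 'e \<Rightarrow> nat set \<Rightarrow> 's" and V :: "'e set"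
  assumes mk_eq_iff: "mk \<alpha> e \<beta> = mk \<alpha>' e' \<beta>' \<longleftrightarrow> \<alpha> = \<alpha>' \<and> e = e' \<and> \<beta> = \<beta>'"
    and carrier_eq: "bcarrier M =
      free_mod {mk \<alpha> e \<beta> | \<alpha> e \<beta>. \<alpha> \<subseteq> {1..n} \<and> e \<in> V \<and> \<beta> \<subseteq> {1..n}}"
    and klinear_lact': "klinear (lact M a)"
    and klinear_lact_scalar': "klinear (\<lambda>a. lact M a t)"
    and klinear_ract': "klinear (\<lambda>t. ract M t a)"
    and klinear_ract_scalar': "klinear (ract M t)"
    and lact_gen: "lact M (gen \<rho>) (gen (mk \<alpha> e \<beta>)) = kscale (ext_sign \<rho> \<alpha>) (gen (mk (\<rho> \<union> \<alpha>) e \<beta>))"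
    and ract_gen: "ract M (gen (mk \<alpha> e \<beta>)) (gen \<rho>) = kscale (ext_sign \<beta> \<rho>) (gen (mk \<alpha> e (\<beta> \<union> \<rho>)))"
begin

abbreviation index :: "'s set"
  where "index \<equiv> {mk \<alpha> e \<beta> | \<alpha> e \<beta>. \<alpha> \<subseteq> {1..n} \<and> e \<in> V \<and> \<beta> \<subseteq> {1..n}}"

lemma klinear_lact_comp: "klinear f \<Longrightarrow> klinear (\<lambda>x. lact M a (f x))"
  and klinear_lact_scalar_comp: "klinear g \<Longrightarrow> klinear (\<lambda>x. lact M (g x) t)"
  and klinear_ract_comp: "klinear f \<Longrightarrow> klinear (\<lambda>x. ract M (f x) a)"
  and klinear_ract_scalar_comp: "klinear g \<Longrightarrow> klinear (\<lambda>x. ract M t (g x))"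
  using klinear_comp[OF klinear_lact'] klinear_comp[OF klinear_lact_scalar']
    klinear_comp[OF klinear_ract'] klinear_comp[OF klinear_ract_scalar'] by auto

lemmas act_klin_intros =
  klin_intros klinear_lact_comp klinear_lact_scalar_comp klinear_ract_comp klinear_ract_scalar_comp

lemmas act_dist' =
  klinear_dist[OF klinear_lact'] klinear_dist[OF klinear_lact_scalar']
  klinear_dist[OF klinear_ract'] klinear_dist[OF klinear_ract_scalar']

sublocale exterior_bimodule n M
proof (rule exterior_bimodule.intro)
  show "kmod.subspace (bcarrier M)"
    by (simp add: carrier_eq subspace_free_mod)
next
  fix a :: "'k ext" and t assume "a \<in> ext_carrier n" and t: "t \<in> bcarrier M"
  then have a: "a \<in> free_mod (Pow {1..n})"
    by (simp add: ext_carrier_def)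
  have "lact M (gen \<rho>) t \<in> free_mod index" if "\<rho> \<subseteq> {1..n}" for \<rho>
    by (rule klinear_in_free_mod[OF klinear_lact' t[unfolded carrier_eq]])
      (use that in \<open>fastforce simp: lact_gen intro!: free_mod_closed\<close>)
  then show "lact M a t \<in> bcarrier M"
    using klinear_in_free_mod[OF klinear_lact_scalar' a, of t index] by (simp add: carrier_eq)
  have "ract M t (gen \<rho>) \<in> free_mod index" if "\<rho> \<subseteq> {1..n}" for \<rho>
    by (rule klinear_in_free_mod[OF klinear_ract' t[unfolded carrier_eq]])
      (use that in \<open>fastforce simp: ract_gen intro!: free_mod_closed\<close>)
  then show "ract M t a \<in> bcarrier M"
    using klinear_in_free_mod[OF klinear_ract_scalar' a, of t index] by (simp add: carrier_eq)
next
  fix a b :: "'k ext" and t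
  assume ab: "a \<in> ext_carrier n" "b \<in> ext_carrier n" and t: "t \<in> bcarrier M"
  note prems = ab[unfolded ext_carrier_def] t[unfolded carrier_eq]
  show "lact M a (lact M b t) = lact M (ext_mult a b) t"
    by (rule trilinear_eqI[OF _ _ _ _ _ _ prems])
      (auto intro!: act_klin_intros simp: lact_gen act_dist' ext_sign_assoc finite_ext_index Un_assoc mult_ac)
  show "ract M (ract M t a) b = ract M t (ext_mult a b)"
    by (rule trilinear_eqI[OF _ _ _ _ _ _ prems])
      (auto intro!: act_klin_intros simp: ract_gen act_dist' ext_sign_assoc finite_ext_index Un_assoc mult_ac)
  show "lact M a (ract M t b) = ract M (lact M a t) b"
    by (rule trilinear_eqI[OF _ _ _ _ _ _ prems])
      (auto intro!: act_klin_intros simp: ract_gen lact_gen act_dist' mult_ac)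
next
  fix t assume t: "t \<in> bcarrier M"
  show "lact M (gen {}) t = t"
    by (rule klinear_eqI[OF _ _ t[unfolded carrier_eq]]) (auto intro!: act_klin_intros simp: lact_gen)
  show "ract M t (gen {}) = t"
    by (rule klinear_eqI[OF _ _ t[unfolded carrier_eq]]) (auto intro!: act_klin_intros simp: ract_gen)
qed (rule klinear_lact' klinear_lact_scalar' klinear_ract' klinear_ract_scalar')+

lemma gen_in_carrier [simp]:
  "(gen (mk \<alpha> e \<beta>) :: 's \<Rightarrow>\<^sub>0 'k) \<in> bcarrier M \<longleftrightarrow> \<alpha> \<subseteq> {1..n} \<and> e \<in> V \<and> \<beta> \<subseteq> {1..n}"
  by (auto simp: carrier_eq mk_eq_iff)

lemma gen_eq_act: "gen (mk \<alpha> e \<beta>) = lact M (gen \<alpha>) (ract M (gen (mk {} e {})) (gen \<beta>))"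
  by (simp add: lact_gen ract_gen)

lemma carrier_induct [consumes 1, case_names zero add scale gen]:
  assumes "t \<in> bcarrier M" "P 0"
    and "\<And>t u. t \<in> bcarrier M \<Longrightarrow> u \<in> bcarrier M \<Longrightarrow> P t \<Longrightarrow> P u \<Longrightarrow> P (t + u)"
    and "\<And>c t. t \<in> bcarrier M \<Longrightarrow> P t \<Longrightarrow> P (kscale c t)"
    and "\<And>\<alpha> e \<beta>. \<alpha> \<subseteq> {1..n} \<Longrightarrow> e \<in> V \<Longrightarrow> \<beta> \<subseteq> {1..n} \<Longrightarrow> P (gen (mk \<alpha> e \<beta>))"
  shows "P t"
proof -
  have "kmod.subspace {t \<in> bcarrier M. P t}"
    using assms(2-4) by (auto simp: kmod.subspace_def carrier_closed)
  moreover have "t \<in> free_mod index"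
    using assms(1) by (simp add: carrier_eq)
  ultimately have "klin gen t \<in> {t \<in> bcarrier M. P t}"
    by (rule klin_in_subspace) (use assms(5) in auto)
  then show ?thesis
    by simp
qed

lemma map_eq_klin:
  assumes "bimod_map n M N f" "t \<in> bcarrier M"
  shows "f t = klin (\<lambda>s. f (gen s)) t"
  using assms(2)
proof (induction rule: carrier_induct)
  case zero
  then show ?case
    by (simp add: map_zero[OF assms(1)] klin_dist)
next
  case (add t u)
  then show ?case
    by (simp add: bimod_map_add[OF assms(1)] klin_dist)
next
  case (scale c t)
  then show ?case
    by (simp add: bimod_map_scale[OF assms(1)] klin_dist)
qed simp

lemma bimod_map_eqI:
  assumes "bimod_map n M N f" "bimod_map n M N g" "t \<in> bcarrier M"
    and "\<And>e. e \<in> V \<Longrightarrow> f (gen (mk {} e {})) = g (gen (mk {} e {}))"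
  shows "f t = g t"
  using assms(3)
proof (induction rule: carrier_induct)
  case zero
  then show ?case
    using assms(1,2) by (simp add: map_zero)
next
  case (add t u)
  then show ?case
    using assms(1,2) by (simp add: bimod_map_add)
next
  case (scale c t)
  then show ?case
    using assms(1,2) by (simp add: bimod_map_scale)
next
  case (gen \<alpha> e \<beta>)
  then show ?case
    using assms(1,2,4)
    by (subst (1 2) gen_eq_act) (simp add: bimod_map_lact bimod_map_ract ract_closed)
qed

lemma bimod_mapI:
  assumes "exterior_bimodule n N" "klinear f" "\<And>e. e \<in> V \<Longrightarrow> v e \<in> bcarrier N"
    and f: "\<And>\<alpha> e \<beta>. \<alpha> \<subseteq> {1..n} \<Longrightarrow> e \<in> V \<Longrightarrow> \<beta> \<subseteq> {1..n} \<Longrightarrow>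
      f (gen (mk \<alpha> e \<beta>)) = lact N (gen \<alpha>) (ract N (v e) (gen \<beta>))"
  shows "bimod_map n M N f"
proof -
  interpret N: exterior_bimodule n N by fact
  note N_klin_intros = act_klin_intros klinear_comp[OF \<open>klinear f\<close>]
    klinear_comp[OF N.klinear_lact] klinear_comp[OF N.klinear_lact_scalar]
    klinear_comp[OF N.klinear_ract] klinear_comp[OF N.klinear_ract_scalar]
  have v: "v e \<in> bcarrier N" if "e \<in> V" for e
    using that assms by simp
  have closed: "f t \<in> bcarrier N" if "t \<in> bcarrier M" for t
    by (rule klinear_in_subspace[OF \<open>klinear f\<close> N.subspace_carrier that[unfolded carrier_eq]])
      (auto simp: f v N.lact_closed N.ract_closed)
  have l: "f (lact M a t) = lact N a (f t)" if "a \<in> ext_carrier n" "t \<in> bcarrier M" for a t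
    by (rule bilinear_eqI[of "\<lambda>a t. f (lact M a t)" "\<lambda>a t. lact N a (f t)",
          OF _ _ _ _ that(1)[unfolded ext_carrier_def] that(2)[unfolded carrier_eq]])
      (auto intro!: N_klin_intros
        simp: lact_gen f v N.ract_closed N.lact_lact N.act_dist klinear_dist[OF \<open>klinear f\<close>])
  have r: "f (ract M t a) = ract N (f t) a" if "a \<in> ext_carrier n" "t \<in> bcarrier M" for a t
    by (rule bilinear_eqI[of "\<lambda>a t. f (ract M t a)" "\<lambda>a t. ract N (f t) a",
          OF _ _ _ _ that(1)[unfolded ext_carrier_def] that(2)[unfolded carrier_eq]])
      (auto intro!: N_klin_intros
        simp: ract_gen f v N.ract_closed N.lact_closed N.ract_ract N.act_dist klinear_dist[OF \<open>klinear f\<close>]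
          N.lact_ract[symmetric])
  show ?thesis
    unfolding bimod_map_def using closed l r klinear_dist[OF \<open>klinear f\<close>] by auto
qed

lemma free_extension:
  assumes "exterior_bimodule n N" "\<And>e. e \<in> V \<Longrightarrow> v e \<in> bcarrier N"
  obtains f where "f \<in> bimod_hom n M N" "\<And>e. e \<in> V \<Longrightarrow> f (gen (mk {} e {})) = v e"
proof -
  interpret N: exterior_bimodule n N by fact
  define p where "p s = (THE x. case x of (\<alpha>, e, \<beta>) \<Rightarrow> s = mk \<alpha> e \<beta>)" for s
  have p: "p (mk \<alpha> e \<beta>) = (\<alpha>, e, \<beta>)" for \<alpha> e \<beta>
    unfolding p_def by (rule the_equality) (auto simp: mk_eq_iff)
  define f where "f = klin (\<lambda>s. case p s of (\<alpha>, e, \<beta>) \<Rightarrow> lact N (gen \<alpha>) (ract N (v e) (gen \<beta>)))"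
  have f: "f (gen (mk \<alpha> e \<beta>)) = lact N (gen \<alpha>) (ract N (v e) (gen \<beta>))" for \<alpha> e \<beta>
    by (simp add: f_def p)
  have "bimod_map n M N f"
    by (rule bimod_mapI[OF assms(1), where v = v]) (simp_all add: f assms(2), simp add: f_def klinear_klin)
  then have "zero_outside (bcarrier M) f \<in> bimod_hom n M N"
    by (rule bimod_map_zero_outside[OF exterior_bimodule_axioms])
  moreover have "zero_outside (bcarrier M) f (gen (mk {} e {})) = v e" if "e \<in> V" for e
    using that assms(2) by (simp add: zero_outside_def f N.lact_unit N.ract_unit)
  ultimately show ?thesis
    using that by blast
qed

lemma free_lifting:
  assumes "exterior_bimodule n P" "bimod_map n P N d" "bimod_map n M N f"
    and "\<And>e. e \<in> V \<Longrightarrow> f (gen (mk {} e {})) \<in> d ` bcarrier P"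
  obtains h where "h \<in> bimod_hom n M P" "\<And>t. t \<in> bcarrier M \<Longrightarrow> d (h t) = f t"
proof -
  have "\<forall>e\<in>V. \<exists>u. u \<in> bcarrier P \<and> d u = f (gen (mk {} e {}))"
    using assms(4) by force
  then obtain v where v: "\<forall>e\<in>V. v e \<in> bcarrier P \<and> d (v e) = f (gen (mk {} e {}))"
    by metis
  obtain h where h: "h \<in> bimod_hom n M P" "\<And>e. e \<in> V \<Longrightarrow> h (gen (mk {} e {})) = v e"
    using free_extension[OF assms(1), of v] v by blast
  then have "bimod_map n M N (\<lambda>t. d (h t))"
    using assms(2) by (auto simp: bimod_hom_iff intro: bimod_map_comp)
  then have "d (h t) = f t" if "t \<in> bcarrier M" for t
    using bimod_map_eqI[OF _ assms(3) that] h(2) v by simp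
  then show ?thesis
    using that h(1) by blast
qed

end

section \<open>Free resolutions\<close>

locale free_resolution =
  fixes n :: nat and M :: "nat \<Rightarrow> ('s, 'k::field) bimod"
    and mk :: "nat set \<Rightarrow> 'e \<Rightarrow> nat set \<Rightarrow> 's" and V :: "nat \<Rightarrow> 'e set"
    and d :: "nat \<Rightarrow> ('s \<Rightarrow>\<^sub>0 'k) \<Rightarrow> ('s \<Rightarrow>\<^sub>0 'k)" and aug :: "('s \<Rightarrow>\<^sub>0 'k) \<Rightarrow> 'k ext"
  assumes free: "free_bimodule n (M k) mk (V k)"
    and d_map: "bimod_map n (M (Suc k)) (M k) (d (Suc k))"
    and aug_map: "bimod_map n (M 0) (ext_bimod n) aug"
    and d_d: "t \<in> bcarrier (M (Suc (Suc k))) \<Longrightarrow> d (Suc k) (d (Suc (Suc k)) t) = 0"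
    and aug_d: "t \<in> bcarrier (M (Suc 0)) \<Longrightarrow> aug (d (Suc 0) t) = 0"
    and exact: "t \<in> bcarrier (M (Suc k)) \<Longrightarrow> d (Suc k) t = 0 \<Longrightarrow>
      t \<in> d (Suc (Suc k)) ` bcarrier (M (Suc (Suc k)))"
    and aug_exact: "t \<in> bcarrier (M 0) \<Longrightarrow> aug t = 0 \<Longrightarrow> t \<in> d (Suc 0) ` bcarrier (M (Suc 0))"
    and aug_surj: "a \<in> ext_carrier n \<Longrightarrow> a \<in> aug ` bcarrier (M 0)"
begin

lemma bimodule: "exterior_bimodule n (M k)"
proof -
  interpret free_bimodule n "M k" mk "V k" by (rule free)
  show ?thesis by (rule exterior_bimodule_axioms)
qed

lemma free_gen_in_carrier: "e \<in> V k \<Longrightarrow> (gen (mk {} e {}) :: 's \<Rightarrow>\<^sub>0 'k) \<in> bcarrier (M k)"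
  using free_bimodule.gen_in_carrier[OF free] by blast

lemma homotopic_to_idI:
  assumes f: "\<And>k. bimod_map n (M k) (M k) (f k)"
    and chain: "\<And>k t. t \<in> bcarrier (M (Suc k)) \<Longrightarrow> d (Suc k) (f (Suc k) t) = f k (d (Suc k) t)"
    and aug: "\<And>t. t \<in> bcarrier (M 0) \<Longrightarrow> aug (f 0 t) = aug t"
  shows "homotopic_to_id n M d f"
proof -
  define P where "P k s \<longleftrightarrow> s \<in> bimod_hom n (M k) (M (Suc k)) \<and>
     (\<forall>t\<in>bcarrier (M (Suc k)). d (Suc k) (s (d (Suc k) t)) = f k (d (Suc k) t) - d (Suc k) t) \<and>
     (k = 0 \<longrightarrow> (\<forall>t\<in>bcarrier (M 0). f 0 t - t = d (Suc 0) (s t)))" for k s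
  define Q where "Q k s s' \<longleftrightarrow> (\<forall>t\<in>bcarrier (M (Suc k)).
     f (Suc k) t - t = d (Suc (Suc k)) (s' t) + s (d (Suc k) t))" for k and s s' :: "('s \<Rightarrow>\<^sub>0 'k) \<Rightarrow> ('s \<Rightarrow>\<^sub>0 'k)"
  note minus = exterior_bimodule.bimod_map_minus[OF bimodule]
  note closed = bimod_map_closed[OF f] bimod_map_closed[OF d_map]
  have base: "\<exists>s. P 0 s"
  proof -
    interpret M0: free_bimodule n "M 0" mk "V 0" by (rule free)
    have map: "bimod_map n (M 0) (M 0) (\<lambda>t. f 0 t - t)"
      by (intro minus f M0.bimod_map_id)
    obtain s where s: "s \<in> bimod_hom n (M 0) (M (Suc 0))"
      "\<And>t. t \<in> bcarrier (M 0) \<Longrightarrow> d (Suc 0) (s t) = f 0 t - t"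
    proof (rule M0.free_lifting[OF bimodule d_map map])
      fix e assume "e \<in> V 0"
      then have e: "gen (mk {} e {}) \<in> bcarrier (M 0)"
        by (rule free_gen_in_carrier)
      then show "f 0 (gen (mk {} e {})) - gen (mk {} e {}) \<in> d (Suc 0) ` bcarrier (M (Suc 0))"
        by (intro aug_exact bimod_map_closed[OF map]) (auto simp: M0.map_diff[OF aug_map] closed aug)
    qed blast
    then show ?thesis
      unfolding P_def using closed by auto
  qed
  have step: "\<exists>s'. P (Suc k) s' \<and> Q k s s'" if Pk: "P k s" for k s
  proof -
    interpret Mk: free_bimodule n "M (Suc k)" mk "V (Suc k)" by (rule free)
    have s: "bimod_map n (M k) (M (Suc k)) s"
      using Pk by (simp add: P_def bimod_hom_iff)
    have map: "bimod_map n (M (Suc k)) (M (Suc k)) (\<lambda>t. f (Suc k) t - t - s (d (Suc k) t))"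
      by (intro minus f Mk.bimod_map_id bimod_map_comp[OF d_map s])
    obtain s' where s': "s' \<in> bimod_hom n (M (Suc k)) (M (Suc (Suc k)))"
      "\<And>t. t \<in> bcarrier (M (Suc k)) \<Longrightarrow> d (Suc (Suc k)) (s' t) = f (Suc k) t - t - s (d (Suc k) t)"
    proof (rule Mk.free_lifting[OF bimodule d_map map])
      fix e assume "e \<in> V (Suc k)"
      then have e: "gen (mk {} e {}) \<in> bcarrier (M (Suc k))"
        by (rule free_gen_in_carrier)
      then have "d (Suc k) (s (d (Suc k) (gen (mk {} e {})))) =
          f k (d (Suc k) (gen (mk {} e {}))) - d (Suc k) (gen (mk {} e {}))"
        using Pk by (simp add: P_def)
      then show "f (Suc k) (gen (mk {} e {})) - gen (mk {} e {}) - s (d (Suc k) (gen (mk {} e {})))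
          \<in> d (Suc (Suc k)) ` bcarrier (M (Suc (Suc k)))"
        using e by (intro exact bimod_map_closed[OF map] e)
          (simp add: Mk.map_diff[OF d_map] closed bimod_map_closed[OF s] chain Mk.carrier_closed)
    qed blast
    have "s (d (Suc k) (d (Suc (Suc k)) t)) = 0" if "t \<in> bcarrier (M (Suc (Suc k)))" for t
      using that exterior_bimodule.map_zero[OF bimodule s] by (simp add: d_d)
    then show ?thesis
      unfolding P_def Q_def using s' closed by (intro exI[of _ s']) auto
  qed
  obtain s where s: "\<forall>k. P k (s k)" "\<forall>k. Q k (s k) (s (Suc k))"
    using dependent_nat_choice[of P Q] base step by metis
  have "f k t - t = d (k + 1) (s k t) + (if k = 0 then 0 else s (k - 1) (d k t))"
    if "t \<in> bcarrier (M k)" for k t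
    using that s by (cases k) (auto simp: P_def Q_def)
  then show ?thesis
    unfolding homotopic_to_id_def using s(1) by (intro exI[of _ s]) (auto simp: P_def)
qed

end

locale resolution_comparison =
  M: free_resolution n M mk V d aug + N: free_resolution n N mk' V' d' aug'
  for n :: nat
    and M :: "nat \<Rightarrow> ('s, 'k::field) bimod" and mk :: "nat set \<Rightarrow> 'e \<Rightarrow> nat set \<Rightarrow> 's" and V d aug
    and N :: "nat \<Rightarrow> ('r, 'k::field) bimod" and mk' :: "nat set \<Rightarrow> 'f \<Rightarrow> nat set \<Rightarrow> 'r" and V' d' aug'
begin

lemma chain_map_exists:
  obtains g where "\<And>k. g k \<in> bimod_hom n (M k) (N k)"
    and "\<And>k t. t \<in> bcarrier (M (Suc k)) \<Longrightarrow> d' (Suc k) (g (Suc k) t) = g k (d (Suc k) t)"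
    and "\<And>t. t \<in> bcarrier (M 0) \<Longrightarrow> aug' (g 0 t) = aug t"
proof -
  define P where "P k g \<longleftrightarrow> g \<in> bimod_hom n (M k) (N k) \<and>
     (case k of 0 \<Rightarrow> \<forall>t\<in>bcarrier (M 0). aug' (g t) = aug t
      | Suc j \<Rightarrow> \<forall>t\<in>bcarrier (M (Suc (Suc j))). d' (Suc j) (g (d (Suc (Suc j)) t)) = 0)" for k g
  define Q where "Q k g g' \<longleftrightarrow> (\<forall>t\<in>bcarrier (M (Suc k)). d' (Suc k) (g' t) = g (d (Suc k) t))"
    for k and g g' :: "('s \<Rightarrow>\<^sub>0 'k) \<Rightarrow> ('r \<Rightarrow>\<^sub>0 'k)"
  note closed = bimod_map_closed[OF M.d_map]
  have base: "\<exists>g. P 0 g"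
  proof -
    interpret M0: free_bimodule n "M 0" mk "V 0" by (rule M.free)
    obtain g where "g \<in> bimod_hom n (M 0) (N 0)" "\<And>t. t \<in> bcarrier (M 0) \<Longrightarrow> aug' (g t) = aug t"
    proof (rule M0.free_lifting[OF N.bimodule N.aug_map M.aug_map])
      fix e assume "e \<in> V 0"
      then show "aug (gen (mk {} e {})) \<in> aug' ` bcarrier (N 0)"
        using bimod_map_closed[OF M.aug_map M.free_gen_in_carrier]
        by (intro N.aug_surj) (simp add: ext_bimod_def)
    qed blast
    then show ?thesis
      by (auto simp: P_def)
  qed
  have step: "\<exists>g'. P (Suc k) g' \<and> Q k g g'" if Pk: "P k g" for k g
  proof -
    interpret Mk: free_bimodule n "M (Suc k)" mk "V (Suc k)" by (rule M.free)
    have g: "bimod_map n (M k) (N k) g"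
      using Pk by (simp add: P_def bimod_hom_iff)
    have map: "bimod_map n (M (Suc k)) (N k) (\<lambda>t. g (d (Suc k) t))"
      by (rule bimod_map_comp[OF M.d_map g])
    obtain g' where g': "g' \<in> bimod_hom n (M (Suc k)) (N (Suc k))"
      "\<And>t. t \<in> bcarrier (M (Suc k)) \<Longrightarrow> d' (Suc k) (g' t) = g (d (Suc k) t)"
    proof (rule Mk.free_lifting[OF N.bimodule N.d_map map])
      fix e assume "e \<in> V (Suc k)"
      then have e: "gen (mk {} e {}) \<in> bcarrier (M (Suc k))"
        by (rule M.free_gen_in_carrier)
      show "g (d (Suc k) (gen (mk {} e {}))) \<in> d' (Suc k) ` bcarrier (N (Suc k))"
      proof (cases k)
        case 0
        then have "aug' (g (d (Suc k) (gen (mk {} e {})))) = 0"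
          using Pk e closed[of _ 0] by (simp add: P_def M.aug_d)
        then show ?thesis
          using bimod_map_closed[OF map e] 0 by (simp add: N.aug_exact)
      next
        case (Suc j)
        then have "d' k (g (d (Suc k) (gen (mk {} e {})))) = 0"
          using Pk e by (simp add: P_def)
        then show ?thesis
          using bimod_map_closed[OF map e] Suc by (simp add: N.exact)
      qed
    qed blast
    have "g (d (Suc k) (d (Suc (Suc k)) t)) = 0" if "t \<in> bcarrier (M (Suc (Suc k)))" for t
      using that exterior_bimodule.map_zero[OF M.bimodule g] by (simp add: M.d_d)
    then show ?thesis
      unfolding P_def Q_def using g' closed by (intro exI[of _ g']) auto
  qed
  obtain g where "\<forall>k. P k (g k)" "\<forall>k. Q k (g k) (g (Suc k))"
    using dependent_nat_choice[of P Q] base step by metis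
  then show ?thesis
    using that[of g] by (force simp: P_def Q_def split: nat.splits)
qed

end

section \<open>The bar resolution\<close>

declare One_nat_def [simp del]

lemma ptensor_map_gen [simp]: "ptensor (map gen xs) = gen xs"
  by (induction xs) auto

lemma ptensor_insert: "ptensor (map gen xs @ a # map gen ys) = klin (\<lambda>\<sigma>. gen (xs @ \<sigma> # ys)) a"
  by (induction xs) auto

lemma ptensor_snoc: "ptensor (map gen xs @ [a]) = klin (\<lambda>\<sigma>. gen (xs @ [\<sigma>])) a"
  using ptensor_insert[of xs a "[]"] by simp

lemma bar_lact_gen: "lact (bar_bimod n k) (gen \<rho>) (gen (\<sigma> # L)) = kscale (ext_sign \<rho> \<sigma>) (gen ((\<rho> \<union> \<sigma>) # L))"
  by (simp add: bar_bimod_def klin_dist)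

lemma bar_ract_gen: "ract (bar_bimod n k) (gen (L @ [\<sigma>])) (gen \<rho>) = kscale (ext_sign \<sigma> \<rho>) (gen (L @ [\<sigma> \<union> \<rho>]))"
  by (simp add: bar_bimod_def klin_dist ptensor_snoc)

abbreviation bar_gens :: "nat \<Rightarrow> nat \<Rightarrow> nat set list set"
  where "bar_gens n k \<equiv> {L. length L = k \<and> set L \<subseteq> Pow {1..n}}"

abbreviation bar_index :: "nat set \<Rightarrow> nat set list \<Rightarrow> nat set \<Rightarrow> nat set list"
  where "bar_index \<alpha> L \<beta> \<equiv> \<alpha> # L @ [\<beta>]"

lemma length_2_plusE:
  assumes "length L = k + 2"
  obtains \<alpha> M \<beta> where "L = \<alpha> # M @ [\<beta>]" "length M = k"
  using assms by (metis Suc_eq_plus1 add_2_eq_Suc' length_Suc_conv length_Suc_conv_rev)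

lemma klinear_bar_lact: "klinear (lact (bar_bimod n k) a)"
  by (simp add: bar_bimod_def klinear_klin)

lemma klinear_bar_ract: "klinear (\<lambda>t. ract (bar_bimod n k) t a)"
  by (simp add: bar_bimod_def klinear_klin)

lemma free_bimodule_bar: "free_bimodule n (bar_bimod n k :: (_, 'k::field) bimod) bar_index (bar_gens n k)"
proof (rule free_bimodule.intro)
  have "{L. length L = k + 2 \<and> set L \<subseteq> Pow X} =
      {bar_index \<alpha> L \<beta> | \<alpha> L \<beta>. \<alpha> \<subseteq> X \<and> L \<in> {L. length L = k \<and> set L \<subseteq> Pow X} \<and> \<beta> \<subseteq> X}"
    (is "?A = ?B") for X :: "nat set"
  proof
    show "?A \<subseteq> ?B"
    proof
      fix L assume L: "L \<in> ?A"
      then obtain \<alpha> M \<beta> where "L = \<alpha> # M @ [\<beta>]" "length M = k"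
        using length_2_plusE[of L k] by blast
      then show "L \<in> ?B"
        using L by auto
    qed
  qed (auto, blast+)
  then show "bcarrier (bar_bimod n k) =
      free_mod {bar_index \<alpha> L \<beta> | \<alpha> L \<beta>. \<alpha> \<subseteq> {1..n} \<and> L \<in> bar_gens n k \<and> \<beta> \<subseteq> {1..n}}"
    by (simp add: bar_bimod_def tens_pow_def)
  show "ract (bar_bimod n k) (gen (bar_index \<alpha> L \<beta>)) (gen \<rho>) =
      kscale (ext_sign \<beta> \<rho>) (gen (bar_index \<alpha> L (\<beta> \<union> \<rho>)))" for \<alpha> L \<beta> \<rho>
    using bar_ract_gen[of n k "\<alpha> # L" \<beta> \<rho>] by simp
  show "klinear (\<lambda>a. lact (bar_bimod n k) a t)" for t :: "'k tens"
    by (auto simp: bar_bimod_def intro!: klin_intros)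
  show "klinear (ract (bar_bimod n k) t)" for t :: "'k tens"
    by (auto simp: bar_bimod_def ptensor_snoc intro!: klin_intros)
qed (auto simp: bar_lact_gen klinear_bar_lact klinear_bar_ract)

interpretation bar: free_bimodule n "bar_bimod n k" bar_index "bar_gens n k" for n k
  by (rule free_bimodule_bar)

fun bar_diff :: "nat set list \<Rightarrow> 'k::field tens"
  where
    "bar_diff (\<sigma> # \<rho> # L) =
      kscale (ext_sign \<sigma> \<rho>) (gen ((\<sigma> \<union> \<rho>) # L)) - klin (\<lambda>M. gen (\<sigma> # M)) (bar_diff (\<rho> # L))"
  | "bar_diff _ = 0"

lemma bar_d_gen:
  assumes "length L = k + 2"
  shows "bar_d k (gen L) = (bar_diff L :: 'k::field tens)"
proof -
  define face :: "nat \<Rightarrow> nat set list \<Rightarrow> 'k tens" where "face i L = kscale ((- 1) ^ i * ext_sign (L ! i) (L ! (i + 1)))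
      (gen (take i L @ (L ! i \<union> L ! (i + 1)) # drop (i + 2) L))" for i L
  have "bar_d k (gen L) = (\<Sum>i\<le>k. face i L)"
    by (simp add: bar_d_def face_def ptensor_insert klin_dist)
  moreover have "(\<Sum>i\<le>k. face i L) = bar_diff L"
    using assms
  proof (induction k arbitrary: L)
    case 0
    then show ?case
      by (auto simp: face_def klin_dist length_Suc_conv numeral_2_eq_2)
  next
    case (Suc k)
    then obtain \<sigma> \<rho> M where L: "L = \<sigma> # \<rho> # M"
      by (auto simp: length_Suc_conv numeral_2_eq_2)
    have "face (Suc i) L = - klin (\<lambda>M. gen (\<sigma> # M)) (face i (\<rho> # M))" for i
      by (simp add: face_def L klin_dist)
    then have "(\<Sum>i\<le>Suc k. face i L) = face 0 L - klin (\<lambda>M. gen (\<sigma> # M)) (\<Sum>i\<le>k. face i (\<rho> # M))"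
      by (subst sum.atMost_Suc_shift) (simp add: klin_dist sum_negf)
    also have "(\<Sum>i\<le>k. face i (\<rho> # M)) = bar_diff (\<rho> # M)"
      using Suc.prems by (intro Suc.IH) (simp add: L)
    finally show ?case
      by (simp add: L face_def)
  qed
  ultimately show ?thesis
    by simp
qed

lemma klinear_bar_d: "klinear (bar_d k)"
  unfolding bar_d_def by (rule klinear_klin)

lemma bar_d_eq: "t \<in> tens_pow n (k + 2) \<Longrightarrow> bar_d k t = klin bar_diff t"
  unfolding tens_pow_def
  by (rule klinear_eqI[OF klinear_bar_d klinear_klin]) (auto simp: bar_d_gen)

lemma bar_diff_split:
  "bar_diff (U @ \<rho> # V) =
    klin (\<lambda>L. gen (L @ V)) (bar_diff (U @ [\<rho>])) +
    kscale ((- 1) ^ length U) (klin (\<lambda>L. gen (U @ L)) (bar_diff (\<rho> # V)))"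
proof (induction U)
  case (Cons \<sigma> U)
  show ?case
  proof (cases U)
    case (Cons \<omega> U')
    then show ?thesis
      using Cons.IH by (simp add: klin_dist kmod.scale_right_distrib)
  qed (simp add: klin_dist)
qed (simp add: klin_dist)

lemma bar_diff_closed: "set L \<subseteq> Pow {1..n} \<Longrightarrow> (bar_diff L :: 'k::field tens) \<in> tens_pow n (length L - 1)"
proof (induction L rule: bar_diff.induct)
  case (1 \<sigma> \<rho> L)
  then have "klin (\<lambda>M. gen (\<sigma> # M)) (bar_diff (\<rho> # L)) \<in> (tens_pow n (Suc (length L)) :: 'k tens set)"
    unfolding tens_pow_def
    by (intro klin_in_free_mod[where S = "{M. length M = length L \<and> set M \<subseteq> Pow {1..n}}"])
      (auto simp: tens_pow_def)
  then show ?case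
    using 1 by (auto simp: tens_pow_def)
qed (auto simp: tens_pow_def)

lemma bar_lact_diff: "lact (bar_bimod n k) (gen \<alpha>) (bar_diff ({} # \<rho> # L)) = bar_diff (\<alpha> # \<rho> # L)"
  by (simp add: klinear_dist[OF klinear_bar_lact] bar_lact_gen klin_klinear[OF klinear_bar_lact])

lemma bar_ract_diff: "ract (bar_bimod n k) (bar_diff (U @ [\<rho>, {}])) (gen \<beta>) = bar_diff (U @ [\<rho>, \<beta>])"
  using bar_diff_split[of U \<rho> "[{}]", where 'a = 'a] bar_diff_split[of U \<rho> "[\<beta>]", where 'a = 'a]
  by (simp add: klinear_dist[OF klinear_bar_ract] bar_ract_gen klin_klinear[OF klinear_bar_ract] klin_dist)

lemma bar_d_map: "bimod_map n (bar_bimod n (Suc k)) (bar_bimod n k :: (_, 'k::field) bimod) (bar_d (Suc k))"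
proof (rule bar.bimod_mapI[where v = "\<lambda>L. bar_diff ({} # L @ [{}])"])
  fix L assume "L \<in> bar_gens n (Suc k)"
  then show "(bar_diff ({} # L @ [{}]) :: 'k tens) \<in> bcarrier (bar_bimod n k)"
    using bar_diff_closed[of "{} # L @ [{}]" n] by (auto simp: bar_bimod_def)
next
  fix \<alpha> \<beta> and L assume L: "L \<in> bar_gens n (Suc k)"
  then obtain \<rho> M where M: "L = \<rho> # M"
    by (auto simp: length_Suc_conv)
  obtain U \<omega> where U: "\<rho> # M = U @ [\<omega>]"
    by (metis list.distinct(1) rev_exhaust)
  have "ract (bar_bimod n k) (bar_diff ({} # L @ [{}]) :: 'k tens) (gen \<beta>) = bar_diff ({} # L @ [\<beta>])"
    using bar_ract_diff[of n k "{} # U" \<omega> \<beta>] by (simp add: M U)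
  then show "bar_d (Suc k) (gen (bar_index \<alpha> L \<beta>)) = lact (bar_bimod n k) (gen \<alpha>)
      (ract (bar_bimod n k) (bar_diff ({} # L @ [{}]) :: 'k tens) (gen \<beta>))"
    using L by (simp add: bar_d_gen M bar_lact_diff del: bar_diff.simps)
qed (auto intro: bar.exterior_bimodule_axioms klinear_bar_d)

lemma bar_diff_bar_diff:
  assumes "\<And>\<sigma>. \<sigma> \<in> set L \<Longrightarrow> finite \<sigma>"
  shows "klin bar_diff (bar_diff L) = 0"
  using assms
proof (induction L rule: bar_diff.induct)
  case (1 \<sigma> \<rho> L)
  then have IH: "klin bar_diff (bar_diff (\<rho> # L)) = (0 :: 'a tens)"
    by simp
  show ?case
  proof (cases L)
    case (Cons \<omega> M)
    have fin: "finite \<sigma>" "finite \<rho>" "finite \<omega>"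
      using 1 Cons by auto
    have "klin (\<lambda>M. gen (\<sigma> # M)) (klin bar_diff (bar_diff (\<rho> # L))) = (0 :: 'a tens)"
      using IH by (simp add: klin_dist del: klin_klin)
    then have *: "kscale (ext_sign \<rho> \<omega>) (klin (\<lambda>M. gen (\<sigma> # M)) (bar_diff ((\<rho> \<union> \<omega>) # M))) =
        klin (\<lambda>N. klin (\<lambda>M. gen (\<sigma> # M)) (bar_diff (\<rho> # N))) (bar_diff (\<omega> # M) :: 'a tens)"
      by (simp add: Cons klin_dist klin_fun_dist)
    show ?thesis
      using ext_sign_assoc[OF fin, where 'k = 'a]
      by (simp add: Cons klin_dist klin_fun_dist kmod.scale_right_diff_distrib * Un_assoc)
  qed (simp add: klin_dist)
qed (simp_all add: klin_dist)

definition bar_aug :: "'k::field tens \<Rightarrow> 'k ext"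
  where "bar_aug = klin (\<lambda>L. ext_mult (gen (hd L)) (gen (last L)))"

lemma bar_aug_map: "bimod_map n (bar_bimod n 0) (ext_bimod n) (bar_aug :: 'k::field tens \<Rightarrow> _)"
  by (rule bar.bimod_mapI[where v = "\<lambda>L. gen {}"])
    (auto intro: exterior_bimodule_ext klinear_klin simp: bar_aug_def, auto simp: ext_bimod_def)

lemma bar_contraction:
  assumes "t \<in> tens_pow n (Suc k)"
  shows "klin bar_diff (klin (\<lambda>L. gen ({} # L)) t) = t - klin (\<lambda>L. gen ({} # L)) (klin bar_diff t)"
  using assms unfolding tens_pow_def
  by (rule klinear_eqI[rotated 2]) (auto intro!: klin_intros klinear_klin simp: length_Suc_conv klin_dist)

lemma bar_aug_eq:
  assumes "t \<in> tens_pow n 2"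
  shows "klin bar_diff t = klin (\<lambda>\<sigma>. gen [\<sigma>]) (bar_aug t)"
  using assms unfolding tens_pow_def bar_aug_def
  by (rule klinear_eqI[rotated 2])
    (auto intro!: klin_intros klinear_klin simp: length_Suc_conv numeral_2_eq_2 klin_dist)

lemma bcarrier_bar [simp]: "bcarrier (bar_bimod n k) = tens_pow n (Suc (Suc k))"
  by (simp add: bar_bimod_def)

lemma bar_d_bar_d:
  assumes "t \<in> tens_pow n (k + 3)"
  shows "bar_d k (bar_d (Suc k) t) = 0"
proof -
  have closed: "bar_diff L \<in> tens_pow n (k + 2)" if "length L = k + 3" "set L \<subseteq> Pow {1..n}" for L
    using bar_diff_closed[OF that(2)] that(1) by simp
  have "klin bar_diff t \<in> tens_pow n (k + 2)"
    unfolding tens_pow_def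
    by (rule klin_in_free_mod[OF assms[unfolded tens_pow_def]])
      (simp add: closed[simplified] flip: tens_pow_def)
  then have "bar_d k (klin bar_diff t) = klin bar_diff (klin bar_diff t)"
    by (rule bar_d_eq)
  moreover have "bar_d (Suc k) t = klin bar_diff t"
    using assms by (intro bar_d_eq[of _ n]) (simp add: numeral_3_eq_3 numeral_2_eq_2)
  moreover have "klin bar_diff (klin bar_diff t) = 0"
  proof (rule klinear_eqI[of "\<lambda>t. klin bar_diff (klin bar_diff t)" "\<lambda>t. 0", OF _ _ assms[unfolded tens_pow_def]])
    fix L assume "L \<in> {L. length L = k + 3 \<and> set L \<subseteq> Pow {1..n}}"
    then have "klin bar_diff (bar_diff L) = 0"
      by (intro bar_diff_bar_diff) (auto dest!: subsetD finite_ext_index)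
    then show "klin bar_diff (klin bar_diff (gen L)) = 0"
      by simp
  qed (intro klin_intros)+
  ultimately show ?thesis
    by simp
qed

lemma bar_cons_closed: "t \<in> tens_pow n m \<Longrightarrow> klin (\<lambda>L. gen ({} # L)) t \<in> tens_pow n (Suc m)"
  unfolding tens_pow_def by (rule klin_in_free_mod) auto

lemma bar_aug_bar_d:
  assumes "t \<in> tens_pow n 3"
  shows "bar_aug (bar_d (Suc 0) t) = 0"
proof (rule bar.bimod_map_eqI[of n "Suc 0" "ext_bimod n" "\<lambda>t. bar_aug (bar_d (Suc 0) t)" "\<lambda>t. 0"])
  show "bimod_map n (bar_bimod n (Suc 0)) (ext_bimod n) (\<lambda>t. bar_aug (bar_d (Suc 0) t))"
    by (rule bimod_map_comp[OF bar_d_map bar_aug_map])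
  show "bimod_map n (bar_bimod n (Suc 0)) (ext_bimod n) (\<lambda>t. 0)"
    by (rule exterior_bimodule.bimod_map_0[OF exterior_bimodule_ext])
next
  fix e assume "e \<in> bar_gens n (Suc 0)"
  then obtain \<sigma> where "e = [\<sigma>]"
    by (auto simp: length_Suc_conv)
  then show "bar_aug (bar_d (Suc 0) (gen (bar_index {} e {}))) = 0"
    by (simp add: bar_d_gen bar_aug_def klin_dist)
qed (use assms in \<open>simp add: numeral_3_eq_3 numeral_2_eq_2\<close>)

lemma free_resolution_bar:
  "free_resolution n (bar_bimod n) bar_index (bar_gens n) bar_d (bar_aug :: 'k::field tens \<Rightarrow> _)"
proof (rule free_resolution.intro)
  fix k and t :: "'k tens"
  assume t: "t \<in> bcarrier (bar_bimod n (Suc k))" and "bar_d (Suc k) t = 0"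
  then have "t = klin bar_diff (klin (\<lambda>L. gen ({} # L)) t)"
    using bar_contraction[of t n "Suc (Suc k)"] bar_d_eq[of t n "Suc k"] by (simp add: klin_dist)
  also have "\<dots> = bar_d (Suc (Suc k)) (klin (\<lambda>L. gen ({} # L)) t)"
    using t bar_cons_closed[of t n] by (simp add: bar_d_eq[of _ n])
  finally show "t \<in> bar_d (Suc (Suc k)) ` bcarrier (bar_bimod n (Suc (Suc k)))"
    using t bar_cons_closed[of t n] by auto
next
  fix t :: "'k tens"
  assume t: "t \<in> bcarrier (bar_bimod n 0)" and "bar_aug t = 0"
  then have "t = klin bar_diff (klin (\<lambda>L. gen ({} # L)) t)"
    using bar_contraction[of t n "Suc 0"] bar_aug_eq[of t n] by (simp add: klin_dist numeral_3_eq_3 numeral_2_eq_2)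
  also have "\<dots> = bar_d (Suc 0) (klin (\<lambda>L. gen ({} # L)) t)"
    using t bar_cons_closed[of t n] by (simp add: bar_d_eq[of _ n])
  finally show "t \<in> bar_d (Suc 0) ` bcarrier (bar_bimod n (Suc 0))"
    using t bar_cons_closed[of t n] by auto
next
  fix a :: "'k ext" assume "a \<in> ext_carrier n"
  then have "lact (bar_bimod n 0) a (gen [{}, {}]) \<in> bcarrier (bar_bimod n 0)"
    by (intro bar.lact_closed) (auto simp: tens_pow_def)
  moreover have "bar_aug (lact (bar_bimod n 0) a (gen [{}, {}])) = a"
    using bimod_map_lact[OF bar_aug_map, of "gen [{}, {}]" n a] \<open>a \<in> ext_carrier n\<close>
    by (simp add: tens_pow_def bar_aug_def ext_bimod_def)
  ultimately show "a \<in> bar_aug ` bcarrier (bar_bimod n 0)"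
    by force
qed (auto intro: free_bimodule_bar bar_d_map bar_aug_map bar_d_bar_d[of _ n] bar_aug_bar_d[of _ n] simp: numeral_3_eq_3 numeral_2_eq_2)

section \<open>The small resolution\<close>

abbreviation small_gens :: "nat \<Rightarrow> nat \<Rightarrow> nat multiset set"
  where "small_gens n k \<equiv> {\<tau>. set_mset \<tau> \<subseteq> {1..n} \<and> size \<tau> = k}"

abbreviation small_index :: "nat set \<Rightarrow> nat multiset \<Rightarrow> nat set \<Rightarrow> nat set \<times> nat multiset \<times> nat set"
  where "small_index \<alpha> \<tau> \<beta> \<equiv> (\<alpha>, \<tau>, \<beta>)"

lemma free_bimodule_small: "free_bimodule n (small_bimod n k :: (_, 'k::field) bimod) small_index (small_gens n k)"
proof (rule free_bimodule.intro)
  show "klinear (\<lambda>a. lact (small_bimod n k) a t)" for t :: "'k small"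
    by (auto simp: small_bimod_def split_beta intro!: klin_intros)
  show "klinear (ract (small_bimod n k) t)" for t :: "'k small"
    by (auto simp: small_bimod_def split_beta intro!: klin_intros)
  show "bcarrier (small_bimod n k :: (_, 'k) bimod) = free_mod
      {small_index \<alpha> \<tau> \<beta> | \<alpha> \<tau> \<beta>. \<alpha> \<subseteq> {1..n} \<and> \<tau> \<in> small_gens n k \<and> \<beta> \<subseteq> {1..n}}"
    unfolding small_bimod_def by (auto intro!: arg_cong[where f = free_mod])
qed (auto simp: small_bimod_def klin_dist intro!: klin_intros)

interpretation small: free_bimodule n "small_bimod n k" small_index "small_gens n k" for n k
  by (rule free_bimodule_small)

lemma klinear_small_extend: "klinear (small_extend v N)"
  unfolding small_extend_def by (rule klinear_klin)

lemma small_extend_gen: "small_extend v N (gen (\<alpha>, \<tau>, \<beta>)) = lact N (gen \<alpha>) (ract N (v \<tau>) (gen \<beta>))"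
  by (simp add: small_extend_def)

lemma small_extend_map:
  assumes "exterior_bimodule n N" "\<And>\<tau>. \<tau> \<in> small_gens n k \<Longrightarrow> v \<tau> \<in> bcarrier N"
  shows "bimod_map n (small_bimod n k) N (small_extend v N)"
  by (rule small.bimod_mapI[OF assms(1) klinear_small_extend assms(2)]) (auto simp: small_extend_gen)

lemma small_extend_unit:
  assumes "exterior_bimodule n N" "v \<tau> \<in> bcarrier N"
  shows "small_extend v N (gen ({}, \<tau>, {})) = v \<tau>"
  using exterior_bimodule.lact_unit[OF assms] exterior_bimodule.ract_unit[OF assms]
  by (simp add: small_extend_gen)

definition small_d_left :: "'k::field small \<Rightarrow> 'k small"
  where "small_d_left = klin (\<lambda>(\<alpha>, \<tau>, \<beta>). \<Sum>i\<in>set_mset \<tau>.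
     kscale (ext_sign \<alpha> {i}) (gen (\<alpha> \<union> {i}, \<tau> - {#i#}, \<beta>)))"

definition small_d_right :: "'k::field small \<Rightarrow> 'k small"
  where "small_d_right = klin (\<lambda>(\<alpha>, \<tau>, \<beta>). \<Sum>i\<in>set_mset \<tau>.
     kscale (ext_sign {i} \<beta>) (gen (\<alpha>, \<tau> - {#i#}, {i} \<union> \<beta>)))"

lemma klinear_small_d: "klinear (small_d n k)" "klinear small_d_left" "klinear small_d_right"
  unfolding small_d_def small_d_left_def small_d_right_def
  by (rule klinear_small_extend klinear_klin)+

lemma small_d_eq: "small_d n k t = small_d_left t + kscale ((- 1) ^ k) (small_d_right t)"
proof -
  have "small_d n k (gen s) = small_d_left (gen s) + kscale ((- 1) ^ k) (small_d_right (gen s :: 'a small))" for s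
    by (cases s) (simp add: small_d_def small_extend_gen small_d_left_def small_d_right_def
        small.act_dist' small.lact_gen small.ract_gen sum.distrib kmod.scale_sum_right)
  then show ?thesis
    by (intro klinear_eqI[of "small_d n k" "\<lambda>t. small_d_left t + kscale ((- 1) ^ k) (small_d_right t)" t UNIV]
        klin_intros klinear_small_d) (simp_all add: free_mod_iff)
qed

lemma small_d_gen:
  "small_d n k (gen ({}, \<tau>, {})) =
    (\<Sum>i\<in>set_mset \<tau>. gen ({i}, \<tau> - {#i#}, {}) + kscale ((- 1) ^ k) (gen ({}, \<tau> - {#i#}, {i})))"
  by (simp add: small_d_eq small_d_left_def small_d_right_def sum.distrib kmod.scale_sum_right)

lemma size_Diff1: "i \<in># \<tau> \<Longrightarrow> size (\<tau> - {#i#}) = size \<tau> - 1"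
  by (simp add: size_Diff_singleton)

lemma small_gens_Diff: "\<tau> \<in> small_gens n (Suc k) \<Longrightarrow> i \<in># \<tau> \<Longrightarrow> \<tau> - {#i#} \<in> small_gens n k"
  by (auto simp: size_Diff1 dest: in_diffD)

lemma small_gens_mem: "\<tau> \<in> small_gens n k \<Longrightarrow> i \<in># \<tau> \<Longrightarrow> {i} \<subseteq> {1..n}"
  by auto

lemma small_d_map: "bimod_map n (small_bimod n (Suc k)) (small_bimod n k :: (_, 'k::field) bimod) (small_d n (Suc k))"
proof -
  have "(\<Sum>i\<in>set_mset \<tau>. gen ({i}, \<tau> - {#i#}, {}) + kscale ((- 1) ^ Suc k) (gen ({}, \<tau> - {#i#}, {i})))
      \<in> bcarrier (small_bimod n k :: (_, 'k) bimod)"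
    if "\<tau> \<in> small_gens n (Suc k)" for \<tau>
    using small_gens_Diff[OF that] small_gens_mem[OF that]
    by (intro small.carrier_closed) (simp_all only: small.gen_in_carrier empty_subsetI simp_thms)
  then show ?thesis
    unfolding small_d_def diff_Suc_1 by (intro small_extend_map) (simp_all add: small.exterior_bimodule_axioms)
qed

subsection \<open>Sums over rearrangements\<close>

lemma finite_rearrangements [simp]: "finite {js. mset js = \<tau>}"
  by (metis ex_mset mset_eq_finite)

lemma sum_rearrangements_rec:
  assumes "\<tau> \<noteq> {#}"
  shows "(\<Sum>js | mset js = \<tau>. f js) = (\<Sum>i\<in>set_mset \<tau>. \<Sum>js | mset js = \<tau> - {#i#}. f (i # js))"
proof -
  have "{js. mset js = \<tau>} = (\<Union>i\<in>set_mset \<tau>. (#) i ` {js. mset js = \<tau> - {#i#}})" (is "?L = ?R")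
  proof
    show "?L \<subseteq> ?R"
    proof
      fix js assume "js \<in> ?L"
      then show "js \<in> ?R"
        using assms by (cases js) auto
    qed
  qed auto
  then have "(\<Sum>js | mset js = \<tau>. f js) = (\<Sum>i\<in>set_mset \<tau>. \<Sum>js\<in>(#) i ` {js. mset js = \<tau> - {#i#}}. f js)"
    by (simp only:) (rule sum.UNION_disjoint; auto)
  also have "\<dots> = (\<Sum>i\<in>set_mset \<tau>. \<Sum>js | mset js = \<tau> - {#i#}. f (i # js))"
    by (simp add: sum.reindex)
  finally show ?thesis .
qed

lemma mset_pair_commute:
  "i \<in># \<tau> \<and> j \<in># \<tau> - {#i#} \<longleftrightarrow> j \<in># \<tau> \<and> i \<in># \<tau> - {#j#}"
  by (cases "i = j") (auto simp: in_diff_count)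

lemma sum_mset_pairs_swap:
  fixes f :: "nat \<Rightarrow> nat \<Rightarrow> 'b::comm_monoid_add"
  shows "(\<Sum>i\<in>set_mset \<tau>. \<Sum>j\<in>set_mset (\<tau> - {#i#}). f i j) = (\<Sum>i\<in>set_mset \<tau>. \<Sum>j\<in>set_mset (\<tau> - {#i#}). f j i)"
proof -
  have eq: "set_mset (\<tau> - {#i#}) = {j. j \<in># \<tau> \<and> j \<in># \<tau> - {#i#}}" for i
    by (auto dest: in_diffD)
  have "(\<Sum>i\<in>set_mset \<tau>. \<Sum>j\<in>set_mset (\<tau> - {#i#}). f i j) =
      (\<Sum>i\<in>set_mset \<tau>. \<Sum>j | j \<in># \<tau> \<and> j \<in># \<tau> - {#i#}. f i j)"
    by (simp only: eq[symmetric])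
  also have "\<dots> = (\<Sum>j\<in>set_mset \<tau>. \<Sum>i | i \<in># \<tau> \<and> j \<in># \<tau> - {#i#}. f i j)"
    by (rule sum.swap_restrict) auto
  also have "\<dots> = (\<Sum>j\<in>set_mset \<tau>. \<Sum>i\<in>set_mset (\<tau> - {#j#}). f i j)"
  proof (intro sum.cong refl)
    fix j assume "j \<in># \<tau>"
    then show "{i. i \<in># \<tau> \<and> j \<in># \<tau> - {#i#}} = set_mset (\<tau> - {#j#})"
      using mset_pair_commute[of _ \<tau> j] by (auto dest: in_diffD)
  qed
  finally show ?thesis .
qed

lemma sum_mset_pairs_alternating:
  fixes f :: "nat \<Rightarrow> nat \<Rightarrow> 'b::ab_group_add"
  assumes "\<And>i. f i i = 0" "\<And>i j. i \<noteq> j \<Longrightarrow> f i j = - f j i"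
  shows "(\<Sum>i\<in>set_mset \<tau>. \<Sum>j\<in>set_mset (\<tau> - {#i#}). f i j) = 0"
proof -
  define g where "g i j = (if i < j then f i j else 0)" for i j
  have "f i j = g i j - g j i" for i j
    using assms(1)[of i] assms(2)[of i j] by (cases i j rule: linorder_cases) (simp_all add: g_def)
  then have "(\<Sum>i\<in>set_mset \<tau>. \<Sum>j\<in>set_mset (\<tau> - {#i#}). f i j) =
      (\<Sum>i\<in>set_mset \<tau>. \<Sum>j\<in>set_mset (\<tau> - {#i#}). g i j) - (\<Sum>i\<in>set_mset \<tau>. \<Sum>j\<in>set_mset (\<tau> - {#i#}). g j i)"
    by (simp add: sum_subtractf)
  then show ?thesis
    by (simp add: sum_mset_pairs_swap[of g])
qed

abbreviation word :: "nat list \<Rightarrow> nat set list"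
  where "word \<equiv> map (\<lambda>j. {j})"

lemma word_eq_iff: "word js = word js' \<longleftrightarrow> js = js'"
  by (auto simp: inj_on_def inj_map_eq_map[OF injI])

lemma bar_diff_rearrangements:
  assumes "size \<tau> = Suc k"
  shows "(\<Sum>js | mset js = \<tau>. bar_diff (\<sigma> # word js @ [\<beta>]) :: 'k::field tens) =
    (\<Sum>i\<in>set_mset \<tau>. \<Sum>js | mset js = \<tau> - {#i#}.
      kscale (ext_sign \<sigma> {i}) (gen ((\<sigma> \<union> {i}) # word js @ [\<beta>])) +
      kscale ((- 1) ^ Suc k * ext_sign {i} \<beta>) (gen (\<sigma> # word js @ [{i} \<union> \<beta>])))"
  using assms
proof (induction k arbitrary: \<tau> \<sigma>)
  case 0
  then obtain i where "\<tau> = {#i#}"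
    by (metis size_1_singleton_mset One_nat_def)
  moreover have "{js. mset js = {#i#}} = {[i]}"
    by auto
  ultimately show ?case
    by (simp add: klin_dist)
next
  case (Suc k)
  let ?cons = "klin (\<lambda>M. gen (\<sigma> # M)) :: 'k tens \<Rightarrow> _"
  have ne: "\<tau> \<noteq> {#}"
    using Suc.prems by auto
  have size: "size (\<tau> - {#i#}) = Suc k" if "i \<in># \<tau>" for i
    using that Suc.prems by (simp add: size_Diff1)
  have ne': "\<tau> - {#i#} \<noteq> {#}" if "i \<in># \<tau>" for i
    using size[OF that] by auto
  have comm: "\<tau> - {#i#} - {#j#} = \<tau> - {#j#} - {#i#}" for i j
    by (simp add: diff_diff_add_mset add_mset_commute)
  have alt: "(\<Sum>i\<in>set_mset \<tau>. \<Sum>j\<in>set_mset (\<tau> - {#i#}). \<Sum>js | mset js = \<tau> - {#i#} - {#j#}.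
      kscale (ext_sign {i} {j}) (gen (({i} \<union> {j}) # word js @ [\<beta>])) :: 'k tens) = 0"
  proof (rule sum_mset_pairs_alternating)
    fix i j :: nat assume "i \<noteq> j"
    then show "(\<Sum>js | mset js = \<tau> - {#i#} - {#j#}. kscale (ext_sign {i} {j}) (gen (({i} \<union> {j}) # word js @ [\<beta>])) :: 'k tens) =
       - (\<Sum>js | mset js = \<tau> - {#j#} - {#i#}. kscale (ext_sign {j} {i}) (gen (({j} \<union> {i}) # word js @ [\<beta>])))"
      using ext_sign_singletons[of i j, where 'k = 'k]
      by (simp add: add_mset_commute[of i j] insert_commute[of i j] sum_negf)
  qed (simp add: ext_sign_def)
  have "(\<Sum>i\<in>set_mset \<tau>. \<Sum>js | mset js = \<tau> - {#i#}. bar_diff ({i} # word js @ [\<beta>]) :: 'k tens) =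
    (\<Sum>i\<in>set_mset \<tau>. \<Sum>j\<in>set_mset (\<tau> - {#i#}). \<Sum>js | mset js = \<tau> - {#i#} - {#j#}.
      kscale (ext_sign {i} {j}) (gen (({i} \<union> {j}) # word js @ [\<beta>])) +
      kscale ((- 1) ^ Suc k * ext_sign {j} \<beta>) (gen ({i} # word js @ [{j} \<union> \<beta>])))"
    using size by (intro sum.cong refl Suc.IH) auto
  also have "\<dots> = (\<Sum>i\<in>set_mset \<tau>. \<Sum>j\<in>set_mset (\<tau> - {#i#}). \<Sum>js | mset js = \<tau> - {#i#} - {#j#}.
      kscale ((- 1) ^ Suc k * ext_sign {j} \<beta>) (gen ({i} # word js @ [{j} \<union> \<beta>])))"
    by (simp only: sum.distrib alt add_0_left)
  also have "\<dots> = (\<Sum>j\<in>set_mset \<tau>. \<Sum>i\<in>set_mset (\<tau> - {#j#}). \<Sum>js | mset js = \<tau> - {#j#} - {#i#}.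
      kscale ((- 1) ^ Suc k * ext_sign {j} \<beta>) (gen (word (i # js) @ [{j} \<union> \<beta>])))"
    by (subst sum_mset_pairs_swap, intro sum.cong refl) (simp_all add: comm add_mset_commute)
  also have "\<dots> = (\<Sum>j\<in>set_mset \<tau>. \<Sum>js | mset js = \<tau> - {#j#}.
      kscale ((- 1) ^ Suc k * ext_sign {j} \<beta>) (gen (word js @ [{j} \<union> \<beta>])))"
    using ne' by (intro sum.cong refl sum_rearrangements_rec[symmetric]) auto
  finally have *: "(\<Sum>i\<in>set_mset \<tau>. \<Sum>js | mset js = \<tau> - {#i#}. bar_diff ({i} # word js @ [\<beta>]) :: 'k tens) = \<dots>" .
  have "(\<Sum>js | mset js = \<tau>. bar_diff (\<sigma> # word js @ [\<beta>]) :: 'k tens) =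
      (\<Sum>i\<in>set_mset \<tau>. \<Sum>js | mset js = \<tau> - {#i#}. kscale (ext_sign \<sigma> {i}) (gen ((\<sigma> \<union> {i}) # word js @ [\<beta>])))
      - ?cons (\<Sum>i\<in>set_mset \<tau>. \<Sum>js | mset js = \<tau> - {#i#}. bar_diff ({i} # word js @ [\<beta>]))"
    by (simp add: sum_rearrangements_rec[OF ne] sum_subtractf klin_dist)
  then show ?case
    unfolding * by (simp add: klin_dist sum.distrib sum_negf)
qed

subsection \<open>The map to the bar resolution\<close>

lemma small_to_bar_gen:
  "small_to_bar n k (gen (\<alpha>, \<tau>, \<beta>)) = (\<Sum>js | mset js = \<tau>. gen (\<alpha> # word js @ [\<beta>]))"
proof -
  have "ract (bar_bimod n k) (gen ({} # word js @ [{}])) (gen \<beta>) = (gen ({} # word js @ [\<beta>]) :: 'a tens)" for js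
    using bar_ract_gen[of n k "{} # word js" "{}" \<beta>] by simp
  then show ?thesis
    by (simp add: small_to_bar_def small_extend_gen bar.act_dist' bar_lact_gen)
qed

lemma klinear_small_to_bar: "klinear (small_to_bar n k)"
  unfolding small_to_bar_def by (rule klinear_small_extend)

lemma small_to_bar_map: "bimod_map n (small_bimod n k) (bar_bimod n k :: (_, 'k::field) bimod) (small_to_bar n k)"
  unfolding small_to_bar_def
proof (rule small_extend_map[OF bar.exterior_bimodule_axioms])
  fix \<tau> assume "\<tau> \<in> small_gens n k"
  then have "gen ([{}] @ word js @ [{}]) \<in> bcarrier (bar_bimod n k :: (_, 'k) bimod)" if "mset js = \<tau>" for js
    using that by (auto simp: tens_pow_def)
  then show "(\<Sum>js | mset js = \<tau>. gen ([{}] @ word js @ [{}])) \<in> bcarrier (bar_bimod n k :: (_, 'k) bimod)"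
    by (intro bar.carrier_closed) auto
qed

lemma small_to_bar_chain:
  assumes "t \<in> bcarrier (small_bimod n (Suc k))"
  shows "bar_d (Suc k) (small_to_bar n (Suc k) t) = small_to_bar n k (small_d n (Suc k) t :: 'k::field small)"
proof (rule small.bimod_map_eqI[of n "Suc k" "bar_bimod n k" "\<lambda>t. bar_d (Suc k) (small_to_bar n (Suc k) t)"
      "\<lambda>t. small_to_bar n k (small_d n (Suc k) t)", OF _ _ assms])
  show "bimod_map n (small_bimod n (Suc k)) (bar_bimod n k) (\<lambda>t. bar_d (Suc k) (small_to_bar n (Suc k) t :: 'k tens))"
    by (rule bimod_map_comp[OF small_to_bar_map bar_d_map])
  show "bimod_map n (small_bimod n (Suc k)) (bar_bimod n k :: (_, 'k) bimod) (\<lambda>t. small_to_bar n k (small_d n (Suc k) t))"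
    by (rule bimod_map_comp[OF small_d_map small_to_bar_map])
next
  fix \<tau> assume \<tau>: "\<tau> \<in> small_gens n (Suc k)"
  then have "length js = Suc k" if "mset js = \<tau>" for js
    using that by auto
  then have "bar_d (Suc k) (small_to_bar n (Suc k) (gen ({}, \<tau>, {}))) =
      (\<Sum>js | mset js = \<tau>. bar_diff ({} # word js @ [{}]) :: 'k tens)"
    by (simp add: small_to_bar_gen klinear_dist[OF klinear_bar_d] bar_d_gen)
  also have "\<dots> = small_to_bar n k (small_d n (Suc k) (gen ({}, \<tau>, {})))"
    using \<tau> by (simp add: bar_diff_rearrangements small_d_gen klinear_dist[OF klinear_small_to_bar]
        small_to_bar_gen sum.distrib sum_subtractf kmod.scale_sum_right)
  finally show "bar_d (Suc k) (small_to_bar n (Suc k) (gen ({}, \<tau>, {}))) =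
      small_to_bar n k (small_d n (Suc k) (gen ({}, \<tau>, {})) :: 'k small)" .
qed

lemma lookup_small_to_bar:
  "Poly_Mapping.lookup (small_to_bar n k t) (\<alpha> # word js @ [\<beta>]) = Poly_Mapping.lookup t (\<alpha>, mset js, \<beta>)"
proof -
  have "Poly_Mapping.lookup (small_to_bar n k (gen s)) (\<alpha> # word js @ [\<beta>]) =
      (if s = (\<alpha>, mset js, \<beta>) then 1 else 0 :: 'a)" for s
  proof (cases s)
    case (fields \<alpha>' \<tau> \<beta>')
    have "Poly_Mapping.lookup (small_to_bar n k (gen s)) (\<alpha> # word js @ [\<beta>]) =
        (\<Sum>js' | mset js' = \<tau>. if js = js' then if \<alpha> = \<alpha>' \<and> \<beta> = \<beta>' then 1 else 0 else 0 :: 'a)"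
      unfolding fields small_to_bar_gen lookup_sum
      by (intro sum.cong refl) (auto simp: lookup_gen word_eq_iff)
    then show ?thesis
      by (auto simp: fields sum.delta')
  qed
  then have "Poly_Mapping.lookup (small_to_bar n k t) (\<alpha> # word js @ [\<beta>]) =
      (\<Sum>s\<in>Poly_Mapping.keys t. if s = (\<alpha>, mset js, \<beta>) then Poly_Mapping.lookup t s else 0)"
    unfolding klinear_eq_klin[OF klinear_small_to_bar, of n k t] klin_def lookup_sum
    by (intro sum.cong refl) auto
  then show ?thesis
    by (simp add: in_keys_iff)
qed

lemma small_to_bar_eq_0D: "small_to_bar n k t = 0 \<Longrightarrow> t = 0"
proof (rule poly_mapping_eqI)
  fix s :: "nat set \<times> nat multiset \<times> nat set"
  assume *: "small_to_bar n k t = 0"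
  obtain \<alpha> \<tau> \<beta> where s: "s = (\<alpha>, \<tau>, \<beta>)"
    by (cases s)
  obtain js where "mset js = \<tau>"
    using ex_mset by blast
  then show "Poly_Mapping.lookup t s = Poly_Mapping.lookup 0 s"
    using lookup_small_to_bar[of n k t \<alpha> js \<beta>] by (simp add: * s)
qed

lemma small_d_small_d:
  assumes "t \<in> bcarrier (small_bimod n (Suc (Suc k)))"
  shows "small_d n (Suc k) (small_d n (Suc (Suc k)) t) = 0"
proof (rule small_to_bar_eq_0D[of n k])
  have "small_to_bar n k (small_d n (Suc k) (small_d n (Suc (Suc k)) t)) =
      bar_d (Suc k) (bar_d (Suc (Suc k)) (small_to_bar n (Suc (Suc k)) t))"
    using assms bimod_map_closed[OF small_d_map assms] by (simp add: small_to_bar_chain)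
  also have "\<dots> = 0"
    using bimod_map_closed[OF small_to_bar_map assms] by (intro bar_d_bar_d) (simp add: numeral_3_eq_3 numeral_2_eq_2)
  finally show "small_to_bar n k (small_d n (Suc k) (small_d n (Suc (Suc k)) t)) = 0" .
qed

definition small_aug :: "'k::field small \<Rightarrow> 'k ext"
  where "small_aug = klin (\<lambda>(\<alpha>, \<tau>, \<beta>). ext_mult (gen \<alpha>) (gen \<beta>))"

lemma small_aug_map: "bimod_map n (small_bimod n 0) (ext_bimod n) (small_aug :: 'k::field small \<Rightarrow> _)"
  by (rule small.bimod_mapI[where v = "\<lambda>\<tau>. gen {}"])
    (auto intro: exterior_bimodule_ext klinear_klin simp: small_aug_def, auto simp: ext_bimod_def)

lemma bar_aug_small_to_bar:
  assumes "t \<in> bcarrier (small_bimod n 0)"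
  shows "bar_aug (small_to_bar n 0 t) = small_aug t"
proof (rule small.bimod_map_eqI[of n 0 "ext_bimod n" "\<lambda>t. bar_aug (small_to_bar n 0 t)", OF _ small_aug_map assms])
  show "bimod_map n (small_bimod n 0) (ext_bimod n) (\<lambda>t. bar_aug (small_to_bar n 0 t))"
    by (rule bimod_map_comp[OF small_to_bar_map bar_aug_map])
qed (simp add: small_to_bar_gen bar_aug_def small_aug_def)

lemma small_aug_small_d:
  assumes "t \<in> bcarrier (small_bimod n (Suc 0))"
  shows "small_aug (small_d n (Suc 0) t) = 0"
proof -
  have "small_aug (small_d n (Suc 0) t) = bar_aug (bar_d (Suc 0) (small_to_bar n (Suc 0) t))"
    using assms by (simp add: small_to_bar_chain bar_aug_small_to_bar bimod_map_closed[OF small_d_map])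
  also have "\<dots> = 0"
    using bimod_map_closed[OF small_to_bar_map assms] by (intro bar_aug_bar_d) (simp add: numeral_3_eq_3)
  finally show ?thesis .
qed

lemma ext_sign_less_all: "(\<And>b. b \<in> \<beta> \<Longrightarrow> i < b) \<Longrightarrow> ext_sign {i} \<beta> = 1"
proof -
  assume *: "\<And>b. b \<in> \<beta> \<Longrightarrow> i < b"
  then have "{(a, b). a \<in> {i} \<and> b \<in> \<beta> \<and> b < a} = {}" "{i} \<inter> \<beta> = {}"
    by fastforce+
  then show ?thesis
    by (simp only: ext_sign_def card.empty power_0 if_True refl)
qed

text \<open>A contracting homotopy of the Koszul part of the differential; it moves the least index that
  occurs from the exterior to the symmetric factor, so that no sign arises.\<close>

definition koszul_homotopy :: "'k::field small \<Rightarrow> 'k small"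
  where "koszul_homotopy = klin (\<lambda>(\<alpha>, \<tau>, \<beta>).
     if Min (set_mset \<tau> \<union> \<beta>) \<in> \<beta>
     then gen (\<alpha>, add_mset (Min (set_mset \<tau> \<union> \<beta>)) \<tau>, \<beta> - {Min (set_mset \<tau> \<union> \<beta>)})
     else 0)"

lemma koszul_homotopy_gen:
  assumes "finite \<beta>" "i \<in> set_mset \<tau> \<union> \<beta>" "\<And>j. j \<in> set_mset \<tau> \<union> \<beta> \<Longrightarrow> i \<le> j"
  shows "koszul_homotopy (gen (\<alpha>, \<tau>, \<beta>)) = (if i \<in> \<beta> then gen (\<alpha>, add_mset i \<tau>, \<beta> - {i}) else 0)"
proof -
  have "Min (set_mset \<tau> \<union> \<beta>) = i"
    using assms by (intro Min_eqI) auto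
  then show ?thesis
    by (simp add: koszul_homotopy_def)
qed

lemma klinear_koszul_homotopy: "klinear koszul_homotopy"
  unfolding koszul_homotopy_def by (rule klinear_klin)

lemma koszul_homotopy_small_d_right:
  assumes "finite \<beta>" "\<tau> \<noteq> {#}"
  shows "small_d_right (koszul_homotopy (gen (\<alpha>, \<tau>, \<beta>))) + koszul_homotopy (small_d_right (gen (\<alpha>, \<tau>, \<beta>))) =
    (gen (\<alpha>, \<tau>, \<beta>) :: 'k::field small)"
proof -
  define i where "i = Min (set_mset \<tau> \<union> \<beta>)"
  have i: "i \<in> set_mset \<tau> \<union> \<beta>" "\<And>j. j \<in> set_mset \<tau> \<union> \<beta> \<Longrightarrow> i \<le> j"
    unfolding i_def using assms Min_in[of "set_mset \<tau> \<union> \<beta>"] by auto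
  have hom: "koszul_homotopy (gen (\<alpha>, \<tau>, \<beta>)) =
      (if i \<in> \<beta> then gen (\<alpha>, add_mset i \<tau>, \<beta> - {i}) else 0 :: 'k small)"
    by (rule koszul_homotopy_gen) (use assms(1) i in auto)
  let ?summand = "\<lambda>j. kscale (ext_sign {j} \<beta>) (koszul_homotopy (gen (\<alpha>, \<tau> - {#j#}, {j} \<union> \<beta>))) :: 'k small"
  have hd: "koszul_homotopy (small_d_right (gen (\<alpha>, \<tau>, \<beta>))) = (\<Sum>j\<in>set_mset \<tau>. ?summand j)"
    by (simp add: small_d_right_def klinear_dist[OF klinear_koszul_homotopy])
  show ?thesis
  proof (cases "i \<in> \<beta>")
    case True
    define \<gamma> where "\<gamma> = \<beta> - {i}"
    have \<beta>: "\<beta> = {i} \<union> \<gamma>" "i \<notin> \<gamma>" "finite \<gamma>"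
      using True assms by (auto simp: \<gamma>_def)
    have less: "i < b" if "b \<in> \<gamma>" for b
      using that i(2)[of b] by (auto simp: \<gamma>_def order.strict_iff_order)
    let ?rest = "\<lambda>j. kscale (ext_sign {j} \<gamma>) (gen (\<alpha>, add_mset i (\<tau> - {#j#}), {j} \<union> \<gamma>)) :: 'k small"
    have summand: "?summand j = - ?rest j" if "j \<in># \<tau>" "j \<noteq> i" for j
    proof -
      have "i < j"
        using that i(2)[of j] by auto
      then have "ext_sign {j} {i} = (- 1 :: 'k)"
        using ext_sign_singletons[of j i, where 'k = 'k] ext_sign_less_all[of "{j}" i, where 'a = 'k] by simp
      then have "ext_sign {j} \<beta> = (- ext_sign {j} \<gamma> :: 'k)"
        using \<beta> ext_sign_Un_right[of "{j}" "{i}" \<gamma>, where 'k = 'k] by simp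
      moreover have "koszul_homotopy (gen (\<alpha>, \<tau> - {#j#}, {j} \<union> \<beta>)) =
          (gen (\<alpha>, add_mset i (\<tau> - {#j#}), {j} \<union> \<gamma>) :: 'k small)"
        using that True assms(1) i(2) \<open>i < j\<close>
        by (subst koszul_homotopy_gen[of _ i]) (auto simp: \<gamma>_def insert_Diff_if dest: in_diffD)
      ultimately show ?thesis
        by simp
    qed
    have "?summand i = 0"
      using True by (simp add: ext_sign_def)
    then have "(\<Sum>j\<in>set_mset \<tau>. ?summand j) = (\<Sum>j\<in>set_mset \<tau> - {i}. ?summand j)"
      by (cases "i \<in># \<tau>") (simp_all add: sum.remove[of _ i])
    also have "\<dots> = - (\<Sum>j\<in>set_mset \<tau> - {i}. ?rest j)"
      unfolding sum_negf[symmetric] by (intro sum.cong refl summand) auto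
    finally have 1: "(\<Sum>j\<in>set_mset \<tau>. ?summand j) = - (\<Sum>j\<in>set_mset \<tau> - {i}. ?rest j)" .
    have "small_d_right (gen (\<alpha>, add_mset i \<tau>, \<gamma>)) =
        (\<Sum>j\<in>insert i (set_mset \<tau> - {i}). kscale (ext_sign {j} \<gamma>) (gen (\<alpha>, add_mset i \<tau> - {#j#}, {j} \<union> \<gamma>)) :: 'k small)"
      by (simp add: small_d_right_def)
    also have "\<dots> = gen (\<alpha>, \<tau>, \<beta>) + (\<Sum>j\<in>set_mset \<tau> - {i}. ?rest j)"
      using \<beta>(1) by (subst sum.insert) (auto simp: ext_sign_less_all[OF less])
    finally have "small_d_right (gen (\<alpha>, add_mset i \<tau>, \<gamma>)) = gen (\<alpha>, \<tau>, \<beta>) + (\<Sum>j\<in>set_mset \<tau> - {i}. ?rest j)" .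
    moreover have "koszul_homotopy (gen (\<alpha>, \<tau>, \<beta>)) = (gen (\<alpha>, add_mset i \<tau>, \<gamma>) :: 'k small)"
      using True by (simp add: hom \<gamma>_def)
    ultimately show ?thesis
      by (simp only: hd 1) simp
  next
    case False
    then have i\<tau>: "i \<in># \<tau>"
      using i by auto
    have less: "i < b" if "b \<in> \<beta>" for b
      using that i(2)[of b] False by (auto simp: order.strict_iff_order)
    have "?summand i = gen (\<alpha>, \<tau>, \<beta>)"
      using False assms(1) i\<tau> i(2)
      by (subst koszul_homotopy_gen[of _ i]) (auto simp: ext_sign_less_all[OF less] dest: in_diffD)
    moreover have "?summand j = 0" if "j \<in># \<tau>" "j \<noteq> i" for j
    proof -
      have "i \<in># \<tau> - {#j#}"
        using that i\<tau> by (simp add: in_diff_count)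
      then show ?thesis
        using that False assms(1) i(2)
        by (subst koszul_homotopy_gen[of _ i]) (auto dest: in_diffD)
    qed
    then have "(\<Sum>j\<in>set_mset \<tau> - {i}. ?summand j) = 0"
      by (intro sum.neutral) auto
    ultimately have "(\<Sum>j\<in>set_mset \<tau>. ?summand j) = gen (\<alpha>, \<tau>, \<beta>)"
      using sum.remove[of "set_mset \<tau>" i ?summand] i\<tau> by simp
    then show ?thesis
      using False by (simp add: hom hd klinear_dist[OF klinear_small_d(3)])
  qed
qed

definition small_filtration :: "nat \<Rightarrow> nat \<Rightarrow> nat \<Rightarrow> 'k::field small set"
  where "small_filtration n k p = free_mod
     {(\<alpha>, \<tau>, \<beta>). \<alpha> \<subseteq> {1..n} \<and> \<tau> \<in> small_gens n k \<and> \<beta> \<subseteq> {1..n} \<and> p \<le> card \<alpha>}"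

lemma small_filtration_subset: "small_filtration n k p \<subseteq> bcarrier (small_bimod n k)"
  unfolding small_filtration_def small.carrier_eq by (rule free_mod_mono) auto

lemma small_filtration_0: "bcarrier (small_bimod n k) = small_filtration n k 0"
  unfolding small_filtration_def small.carrier_eq by (rule arg_cong[where f = free_mod]) auto

lemma small_d_left_filtration:
  assumes "t \<in> small_filtration n (Suc k) p"
  shows "small_d_left t \<in> small_filtration n k (Suc p)"
  unfolding small_filtration_def
proof (rule klinear_in_free_mod[OF klinear_small_d(2) assms[unfolded small_filtration_def]], clarify)
  fix \<alpha> \<tau> \<beta>
  assume *: "\<alpha> \<subseteq> {1..n}" "set_mset \<tau> \<subseteq> {1..n}" "size \<tau> = Suc k" "\<beta> \<subseteq> {1..n}" "p \<le> card \<alpha>"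
  have "kscale (ext_sign \<alpha> {i}) (gen (\<alpha> \<union> {i}, \<tau> - {#i#}, \<beta>)) \<in> free_mod
      {(\<alpha>, \<tau>, \<beta>). \<alpha> \<subseteq> {1..n} \<and> \<tau> \<in> small_gens n k \<and> \<beta> \<subseteq> {1..n} \<and> Suc p \<le> card \<alpha>}"
    if "i \<in># \<tau>" for i
  proof (cases "i \<in> \<alpha>")
    case False
    then show ?thesis
      using * that small_gens_Diff[of \<tau> n k i] finite_ext_index[OF *(1)]
      by (intro free_mod_closed) auto
  qed (simp add: ext_sign_def)
  then show "small_d_left (gen (\<alpha>, \<tau>, \<beta>)) \<in> free_mod
      {(\<alpha>, \<tau>, \<beta>). \<alpha> \<subseteq> {1..n} \<and> \<tau> \<in> small_gens n k \<and> \<beta> \<subseteq> {1..n} \<and> Suc p \<le> card \<alpha>}"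
    by (simp only: small_d_left_def klin_gen prod.case) (rule free_mod_closed(6))
qed

lemma koszul_homotopy_filtration:
  assumes "t \<in> small_filtration n k p"
  shows "koszul_homotopy t \<in> small_filtration n (Suc k) p"
  unfolding small_filtration_def
proof (rule klinear_in_free_mod[OF klinear_koszul_homotopy assms[unfolded small_filtration_def]])
  fix s
  assume s: "s \<in> {(\<alpha>, \<tau>, \<beta>). \<alpha> \<subseteq> {1..n} \<and> \<tau> \<in> small_gens n k \<and> \<beta> \<subseteq> {1..n} \<and> p \<le> card \<alpha>}"
  obtain \<alpha> \<tau> \<beta> where "s = (\<alpha>, \<tau>, \<beta>)"
    by (cases s)
  with s show "koszul_homotopy (gen s) \<in> free_mod
      {(\<alpha>, \<tau>, \<beta>). \<alpha> \<subseteq> {1..n} \<and> \<tau> \<in> small_gens n (Suc k) \<and> \<beta> \<subseteq> {1..n} \<and> p \<le> card \<alpha>}"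
    unfolding koszul_homotopy_def by auto
qed

lemma koszul_homotopy_small_d_right':
  assumes "t \<in> small_filtration n (Suc k) p"
  shows "small_d_right (koszul_homotopy t) + koszul_homotopy (small_d_right t) = t"
proof (rule klinear_eqI[of "\<lambda>t. small_d_right (koszul_homotopy t) + koszul_homotopy (small_d_right t)" "\<lambda>t. t",
      OF _ _ assms[unfolded small_filtration_def]])
  show "klinear (\<lambda>t. small_d_right (koszul_homotopy t) + koszul_homotopy (small_d_right t))"
    by (intro klin_intros klinear_comp[OF klinear_small_d(3)] klinear_comp[OF klinear_koszul_homotopy]
        klinear_small_d klinear_koszul_homotopy)
qed (auto intro!: klin_intros koszul_homotopy_small_d_right dest: finite_ext_index)

lemma small_exact_filtration:
  assumes "t \<in> small_filtration n (Suc k) p" "small_d n (Suc k) t = 0"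
  shows "t \<in> small_d n (Suc (Suc k)) ` bcarrier (small_bimod n (Suc (Suc k)) :: (_, 'k::field) bimod)"
  using assms
proof (induction "Suc n - p" arbitrary: t p)
  case 0
  have "\<not> p \<le> card \<alpha>" if "\<alpha> \<subseteq> {1..n}" for \<alpha>
    using card_mono[OF _ that] 0 by simp
  then have "{(\<alpha>, \<tau>, \<beta>). \<alpha> \<subseteq> {1..n} \<and> \<tau> \<in> small_gens n (Suc k) \<and> \<beta> \<subseteq> {1..n} \<and> p \<le> card \<alpha>} = {}"
    by blast
  then have "small_filtration n (Suc k) p = (free_mod {} :: 'k small set)"
    unfolding small_filtration_def by (rule arg_cong)
  then show ?case
    using 0 kmod.subspace_0[OF small.subspace_image[OF small_d_map[of n "Suc k"]]] by (simp add: free_mod_empty)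
next
  case (Suc m)
  define u where "u = kscale ((- 1) ^ k) (koszul_homotopy t)"
  have kt: "koszul_homotopy t \<in> small_filtration n (Suc (Suc k)) p"
    using Suc.prems(1) by (rule koszul_homotopy_filtration)
  then have u: "u \<in> bcarrier (small_bimod n (Suc (Suc k)))"
    unfolding u_def using small_filtration_subset by (blast intro: small.carrier_closed)
  have "small_d_right t = kscale ((- 1) ^ k) (small_d_left t)"
    using Suc.prems(2) by (cases "even k") (auto simp: small_d_eq eq_neg_iff_add_eq_0 add.commute)
  then have "t - small_d n (Suc (Suc k)) u =
      kscale ((- 1) ^ k) (koszul_homotopy (small_d_left t) - small_d_left (koszul_homotopy t))"
    using koszul_homotopy_small_d_right'[OF Suc.prems(1)]
    by (cases "even k") (auto simp: small_d_eq u_def klinear_dist[OF klinear_koszul_homotopy]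
        klinear_dist[OF klinear_small_d(2)] klinear_dist[OF klinear_small_d(3)] algebra_simps)
  moreover have "koszul_homotopy (small_d_left t) - small_d_left (koszul_homotopy t) \<in> small_filtration n (Suc k) (Suc p)"
    using koszul_homotopy_filtration[OF small_d_left_filtration[OF Suc.prems(1)]] small_d_left_filtration[OF kt]
    by (simp add: small_filtration_def)
  ultimately have "t - small_d n (Suc (Suc k)) u \<in> small_filtration n (Suc k) (Suc p)"
    by (simp add: small_filtration_def)
  moreover have "small_d n (Suc k) (t - small_d n (Suc (Suc k)) u) = 0"
    using Suc.prems(2) small_d_small_d[OF u] by (simp add: klinear_dist[OF klinear_small_d(1)])
  ultimately have "t - small_d n (Suc (Suc k)) u \<in> small_d n (Suc (Suc k)) ` bcarrier (small_bimod n (Suc (Suc k)))"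
    using Suc.hyps(2) by (intro Suc.hyps(1)[of "Suc p"]) auto
  then have "t - small_d n (Suc (Suc k)) u + small_d n (Suc (Suc k)) u \<in>
      small_d n (Suc (Suc k)) ` bcarrier (small_bimod n (Suc (Suc k)))"
    using u by (intro kmod.subspace_add[OF small.subspace_image[OF small_d_map]]) auto
  then show ?case
    by simp
qed

lemma small_aug_exact:
  assumes "t \<in> bcarrier (small_bimod n 0)" "small_aug t = 0"
  shows "t \<in> small_d n (Suc 0) ` bcarrier (small_bimod n (Suc 0) :: (_, 'k::field) bimod)"
proof -
  let ?W = "small_d n (Suc 0) ` bcarrier (small_bimod n (Suc 0)) :: 'k small set"
  have W: "kmod.subspace ?W"
    by (rule small.subspace_image[OF small_d_map])
  have gens: "gen (\<alpha>, {#}, \<beta>) - kscale (ext_sign \<alpha> \<beta>) (gen (\<alpha> \<union> \<beta>, {#}, {})) \<in> ?W"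
    if "\<alpha> \<subseteq> {1..n}" "\<beta> \<subseteq> {1..n}" for \<alpha> \<beta>
    using finite_ext_index[OF that(2)] that
  proof (induction \<beta> arbitrary: \<alpha> rule: finite_linorder_min_induct)
    case empty
    then show ?case
      using kmod.subspace_0[OF W] by simp
  next
    case (insert b \<beta>)
    have fin: "finite \<alpha>" "finite \<beta>"
      using insert finite_ext_index by auto
    have "small_d n (Suc 0) (gen (\<alpha>, {#b#}, \<beta>)) =
        kscale (ext_sign \<alpha> {b}) (gen (\<alpha> \<union> {b}, {#}, \<beta>)) - (gen (\<alpha>, {#}, insert b \<beta>) :: 'k small)"
      using insert.hyps by (simp add: small_d_eq small_d_left_def small_d_right_def ext_sign_less_all)
    moreover have "small_d n (Suc 0) (gen (\<alpha>, {#b#}, \<beta>)) \<in> ?W"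
      using insert.prems by (intro imageI) simp
    ultimately have 1: "kscale (ext_sign \<alpha> {b}) (gen (\<alpha> \<union> {b}, {#}, \<beta>)) - gen (\<alpha>, {#}, insert b \<beta>) \<in> ?W"
      by (simp only:)
    have 2: "gen (\<alpha> \<union> {b}, {#}, \<beta>) - kscale (ext_sign (\<alpha> \<union> {b}) \<beta>) (gen ((\<alpha> \<union> {b}) \<union> \<beta>, {#}, {})) \<in> ?W"
      using insert by (intro insert.IH) auto
    have "ext_sign \<alpha> {b} * ext_sign (\<alpha> \<union> {b}) \<beta> = (ext_sign \<alpha> (insert b \<beta>) :: 'k)"
      using ext_sign_assoc[of \<alpha> "{b}" \<beta>, where 'k = 'k] fin insert.hyps by (simp add: ext_sign_less_all)
    then have "gen (\<alpha>, {#}, insert b \<beta>) - kscale (ext_sign \<alpha> (insert b \<beta>)) (gen (\<alpha> \<union> insert b \<beta>, {#}, {})) =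
        kscale (ext_sign \<alpha> {b}) (gen (\<alpha> \<union> {b}, {#}, \<beta>) - kscale (ext_sign (\<alpha> \<union> {b}) \<beta>) (gen ((\<alpha> \<union> {b}) \<union> \<beta>, {#}, {})))
        - (kscale (ext_sign \<alpha> {b}) (gen (\<alpha> \<union> {b}, {#}, \<beta>)) - (gen (\<alpha>, {#}, insert b \<beta>) :: 'k small))"
      by (simp add: kmod.scale_right_diff_distrib)
    then show ?case
      using kmod.subspace_diff[OF W kmod.subspace_scale[OF W 2] 1] by metis
  qed
  have "t - klin (\<lambda>\<sigma>. gen (\<sigma>, {#}, {})) (small_aug t) \<in> ?W"
  proof (rule klinear_in_subspace[OF _ W assms(1)[unfolded small.carrier_eq]])
    show "klinear (\<lambda>t. t - klin (\<lambda>\<sigma>. gen (\<sigma>, {#}, {})) (small_aug t))"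
      unfolding small_aug_def by (intro klin_intros)
  qed (use gens in \<open>auto simp: small_aug_def klin_dist\<close>)
  then show ?thesis
    using assms(2) by (simp add: klin_dist)
qed

lemma free_resolution_small:
  "free_resolution n (small_bimod n) small_index (small_gens n) (small_d n) (small_aug :: 'k::field small \<Rightarrow> _)"
proof (rule free_resolution.intro)
  fix k and t :: "'k small"
  assume "t \<in> bcarrier (small_bimod n (Suc k))" "small_d n (Suc k) t = 0"
  then show "t \<in> small_d n (Suc (Suc k)) ` bcarrier (small_bimod n (Suc (Suc k)))"
    unfolding small_filtration_0 by (intro small_exact_filtration[unfolded small_filtration_0])
next
  fix a :: "'k ext" assume "a \<in> ext_carrier n"
  then have "lact (small_bimod n 0) a (gen ({}, {#}, {})) \<in> bcarrier (small_bimod n 0)"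
    by (intro small.lact_closed) auto
  moreover have "small_aug (lact (small_bimod n 0) a (gen ({}, {#}, {}))) = a"
    using bimod_map_lact[OF small_aug_map, of "gen ({}, {#}, {})" n a] \<open>a \<in> ext_carrier n\<close>
    by (simp add: small_aug_def ext_bimod_def)
  ultimately show "a \<in> small_aug ` bcarrier (small_bimod n 0)"
    by force
qed (auto intro: free_bimodule_small small_d_map small_aug_map small_d_small_d small_aug_small_d small_aug_exact)

lemma homotopy_inverse_exists:
  obtains g where "homotopy_inverse n (g :: nat \<Rightarrow> 'k::field tens \<Rightarrow> 'k small)"
proof -
  interpret bar_res: free_resolution n "bar_bimod n" bar_index "bar_gens n" bar_d "bar_aug :: 'k tens \<Rightarrow> _"
    by (rule free_resolution_bar)
  interpret small_res: free_resolution n "small_bimod n" small_index "small_gens n" "small_d n" "small_aug :: 'k small \<Rightarrow> _"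
    by (rule free_resolution_small)
  interpret resolution_comparison n "bar_bimod n" bar_index "bar_gens n" bar_d "bar_aug :: 'k tens \<Rightarrow> _"
    "small_bimod n" small_index "small_gens n" "small_d n" "small_aug :: 'k small \<Rightarrow> _" ..
  obtain g :: "nat \<Rightarrow> 'k tens \<Rightarrow> 'k small" where g: "\<And>k. g k \<in> bimod_hom n (bar_bimod n k) (small_bimod n k)"
    "\<And>k t. t \<in> bcarrier (bar_bimod n (Suc k)) \<Longrightarrow> small_d n (Suc k) (g (Suc k) t) = g k (bar_d (Suc k) t)"
    "\<And>t. t \<in> bcarrier (bar_bimod n 0) \<Longrightarrow> small_aug (g 0 t) = bar_aug t"
    using chain_map_exists by blast
  have g_map: "bimod_map n (bar_bimod n k) (small_bimod n k) (g k)" for k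
    using g(1) by (simp add: bimod_hom_iff)
  note closed = bimod_map_closed[OF g_map] bimod_map_closed[OF small_to_bar_map]
  have "homotopic_to_id n (bar_bimod n) bar_d (\<lambda>k t. small_to_bar n k (g k t))"
    by (rule bar_res.homotopic_to_idI[OF bimod_map_comp[OF g_map small_to_bar_map]])
      (simp_all add: small_to_bar_chain bar_aug_small_to_bar closed g(2,3) del: bcarrier_bar)
  moreover have "homotopic_to_id n (small_bimod n) (small_d n) (\<lambda>k t. g k (small_to_bar n k t))"
    by (rule small_res.homotopic_to_idI[OF bimod_map_comp[OF small_to_bar_map g_map]])
      (simp_all add: small_to_bar_chain[symmetric] bar_aug_small_to_bar closed g(2,3) del: bcarrier_bar)
  ultimately show ?thesis
    using that[of g] g unfolding homotopy_inverse_def by (simp del: bcarrier_bar add: Suc_eq_plus1[symmetric])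
qed

section \<open>The differential on the exterior-polynomial algebra\<close>

abbreviation ext_poly_carrier :: "nat \<Rightarrow> 'k::field ext_poly set"
  where "ext_poly_carrier n \<equiv> free_mod (ext_poly_index n)"

lemma tensor_gen [simp]: "tensor (gen \<sigma>) (gen \<tau>) = gen (\<sigma>, \<tau>)"
  by (simp add: tensor_def)

lemma klinear_tensor [klin_intros]: "klinear f \<Longrightarrow> klinear (\<lambda>t. tensor (f t) p)"
  unfolding tensor_def by (intro klin_intros)

lemmas tensor_dist = klinear_dist[OF klinear_tensor[OF klinear_id]]

lemma ext_poly_mult_gen [simp]:
  "ext_poly_mult (gen (\<sigma>, \<tau>)) (gen (\<sigma>', \<tau>')) = kscale (ext_sign \<sigma> \<sigma>') (gen (\<sigma> \<union> \<sigma>', \<tau> + \<tau>'))"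
proof -
  have "(gen \<tau> * gen \<tau>' :: nat multiset \<Rightarrow>\<^sub>0 'a) = gen (\<tau> + \<tau>')"
    by (simp add: gen_def mult_single)
  then show ?thesis
    by (simp add: ext_poly_mult_def tensor_dist)
qed

lemma klinear_ext_poly_mult_left [klin_intros]: "klinear f \<Longrightarrow> klinear (\<lambda>t. ext_poly_mult (f t) v)"
  unfolding ext_poly_mult_def by (intro klin_intros)

lemma klinear_ext_poly_mult_right [klin_intros]: "klinear f \<Longrightarrow> klinear (\<lambda>t. ext_poly_mult u (f t))"
  unfolding ext_poly_mult_def split_beta by (intro klin_intros)

lemmas ext_poly_mult_dist =
  klinear_dist[OF klinear_ext_poly_mult_left[OF klinear_id]]
  klinear_dist[OF klinear_ext_poly_mult_right[OF klinear_id]]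

lemma gen_in_ext_poly_index: "(\<sigma>, \<tau>) \<in> ext_poly_index n \<longleftrightarrow> \<sigma> \<subseteq> {1..n} \<and> set_mset \<tau> \<subseteq> {1..n}"
  by (simp add: ext_poly_index_def)

lemma ext_poly_mult_closed:
  assumes "u \<in> ext_poly_carrier n" "v \<in> ext_poly_carrier n"
  shows "ext_poly_mult u v \<in> ext_poly_carrier n"
proof (rule klinear_in_free_mod[OF klinear_ext_poly_mult_left[OF klinear_id] assms(1)])
  fix s assume s: "s \<in> ext_poly_index n"
  show "ext_poly_mult (gen s) v \<in> ext_poly_carrier n"
  proof (rule klinear_in_free_mod[OF klinear_ext_poly_mult_right[OF klinear_id] assms(2)])
    fix s' assume "s' \<in> ext_poly_index n"
    with s show "ext_poly_mult (gen s) (gen s') \<in> ext_poly_carrier n"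
      by (cases s; cases s') (simp add: gen_in_ext_poly_index free_mod_closed)
  qed
qed

lemma ext_poly_mult_assoc:
  assumes "u \<in> ext_poly_carrier n" "v \<in> ext_poly_carrier n" "w \<in> ext_poly_carrier n"
  shows "ext_poly_mult (ext_poly_mult u v) w = ext_poly_mult u (ext_poly_mult v w)"
proof (rule trilinear_eqI[of "\<lambda>a b c. ext_poly_mult (ext_poly_mult a b) c"
      "\<lambda>a b c. ext_poly_mult a (ext_poly_mult b c)", OF _ _ _ _ _ _ assms])
  fix s s' s'' assume *: "s \<in> ext_poly_index n" "s' \<in> ext_poly_index n" "s'' \<in> ext_poly_index n"
  obtain \<sigma> \<tau> \<sigma>' \<tau>' \<sigma>'' \<tau>'' where s: "s = (\<sigma>, \<tau>)" "s' = (\<sigma>', \<tau>')" "s'' = (\<sigma>'', \<tau>'')"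
    by (cases s; cases s'; cases s'')
  then have "finite \<sigma>" "finite \<sigma>'" "finite \<sigma>''"
    using * finite_ext_index by (auto simp: gen_in_ext_poly_index)
  then show "ext_poly_mult (ext_poly_mult (gen s) (gen s')) (gen s'') =
      ext_poly_mult (gen s) (ext_poly_mult (gen s') (gen s''))"
    unfolding s by (simp add: ext_poly_mult_dist ext_sign_assoc Un_assoc add.assoc)
qed (intro klin_intros)+

definition emb :: "nat multiset \<Rightarrow> 'k::field ext \<Rightarrow> 'k ext_poly"
  where "emb \<tau> a = tensor a (gen \<tau>)"

definition part :: "nat multiset \<Rightarrow> 'k::field ext_poly \<Rightarrow> 'k ext"
  where "part \<tau> = klin (\<lambda>(\<sigma>, \<tau>'). if \<tau>' = \<tau> then gen \<sigma> else 0)"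

lemma emb_gen [simp]: "emb \<tau> (gen \<sigma>) = gen (\<sigma>, \<tau>)"
  by (simp add: emb_def)

lemma klinear_emb: "klinear (emb \<tau>)"
  unfolding emb_def by (intro klin_intros)

lemma klinear_part: "klinear (part \<tau>)"
  unfolding part_def by (rule klinear_klin)

lemma part_gen [simp]: "part \<tau> (gen (\<sigma>, \<tau>')) = (if \<tau>' = \<tau> then gen \<sigma> else 0)"
  by (simp add: part_def)

lemmas emb_dist = klinear_dist[OF klinear_emb]
lemmas part_dist = klinear_dist[OF klinear_part]

lemmas emb_part_intros =
  klin_intros klinear_comp[OF klinear_emb] klinear_comp[OF klinear_part] klinear_emb klinear_part

lemma part_emb: "part \<tau> (emb \<tau>' a) = (if \<tau>' = \<tau> then a else 0)"
  by (rule klinear_eqI[of "\<lambda>a. part \<tau> (emb \<tau>' a)" _ _ UNIV]) (auto intro!: emb_part_intros)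

lemma ext_poly_mult_emb: "ext_poly_mult (emb \<tau> a) (emb \<tau>' b) = emb (\<tau> + \<tau>') (ext_mult a b)"
  by (rule bilinear_eqI[of "\<lambda>a b. ext_poly_mult (emb \<tau> a) (emb \<tau>' b)"
        "\<lambda>a b. emb (\<tau> + \<tau>') (ext_mult a b)" _ UNIV _ UNIV])
    (auto intro!: emb_part_intros simp: emb_dist)

lemma emb_closed: "a \<in> ext_carrier n \<Longrightarrow> set_mset \<tau> \<subseteq> {1..n} \<Longrightarrow> emb \<tau> a \<in> ext_poly_carrier n"
  unfolding ext_carrier_def
  by (rule klinear_in_free_mod[OF klinear_emb]) (auto simp: gen_in_ext_poly_index)

lemma part_closed: "z \<in> ext_poly_carrier n \<Longrightarrow> part \<tau> z \<in> ext_carrier n"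
  unfolding ext_carrier_def
  by (rule klinear_in_free_mod[OF klinear_part]) (auto simp: gen_in_ext_poly_index)

definition degree_sign :: "'k::field ext_poly \<Rightarrow> 'k ext_poly"
  where "degree_sign = klin (\<lambda>(\<sigma>, \<tau>). kscale ((- 1) ^ size \<tau>) (gen (\<sigma>, \<tau>)))"

lemma klinear_degree_sign: "klinear degree_sign"
  unfolding degree_sign_def by (rule klinear_klin)

lemmas degree_sign_dist = klinear_dist[OF klinear_degree_sign]

lemma degree_sign_gen [simp]: "degree_sign (gen (\<sigma>, \<tau>)) = kscale ((- 1) ^ size \<tau>) (gen (\<sigma>, \<tau>))"
  by (simp add: degree_sign_def)

lemma degree_sign_emb: "degree_sign (emb \<tau> a) = kscale ((- 1) ^ size \<tau>) (emb \<tau> a)"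
  by (rule klinear_eqI[of "\<lambda>a. degree_sign (emb \<tau> a)" _ _ UNIV])
    (auto intro!: emb_part_intros klinear_comp[OF klinear_degree_sign])

lemma degree_sign_degree_sign: "degree_sign (degree_sign z) = z"
  by (rule klinear_eqI[of "\<lambda>z. degree_sign (degree_sign z)" _ _ UNIV])
    (auto intro!: klin_intros klinear_comp[OF klinear_degree_sign] klinear_degree_sign
      simp: degree_sign_dist simp flip: power_add mult_2)

lemma degree_sign_closed: "z \<in> ext_poly_carrier n \<Longrightarrow> degree_sign z \<in> ext_poly_carrier n"
  by (rule klinear_in_free_mod[OF klinear_degree_sign]) auto

lemma degree_sign_mult: "degree_sign (ext_poly_mult u v) = ext_poly_mult (degree_sign u) (degree_sign v)"
  by (rule bilinear_eqI[of "\<lambda>u v. degree_sign (ext_poly_mult u v)"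
        "\<lambda>u v. ext_poly_mult (degree_sign u) (degree_sign v)" _ UNIV _ UNIV])
    (auto intro!: klin_intros klinear_comp[OF klinear_degree_sign] klinear_degree_sign
      simp: degree_sign_dist ext_poly_mult_dist power_add mult_ac)

text \<open>The differential induced on \<open>Hom(\<B>, A)\<close>, \<open>\<B>\<close> the small resolution: up to signs,
  the commutator with the sum of all \<open>x\<^sub>i \<otimes> x\<^sub>i\<close>.\<close>

definition theta :: "nat \<Rightarrow> 'k::field ext_poly"
  where "theta n = (\<Sum>i\<in>{1..n}. emb {#i#} (gen {i}))"

definition ext_poly_d :: "nat \<Rightarrow> 'k::field ext_poly \<Rightarrow> 'k ext_poly"
  where "ext_poly_d n z = ext_poly_mult (theta n) z - ext_poly_mult (degree_sign z) (theta n)"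

lemma theta_closed: "theta n \<in> ext_poly_carrier n"
  unfolding theta_def by (intro free_mod_closed emb_closed) auto

lemma degree_sign_theta: "degree_sign (theta n) = - theta n"
  by (simp add: theta_def degree_sign_dist degree_sign_emb sum_negf del: emb_gen)

lemma klinear_ext_poly_d: "klinear (ext_poly_d n)"
  unfolding ext_poly_d_def
  by (intro klin_intros klinear_comp[OF klinear_degree_sign] klinear_degree_sign)

lemmas ext_poly_d_dist = klinear_dist[OF klinear_ext_poly_d]

lemma ext_poly_d_closed: "z \<in> ext_poly_carrier n \<Longrightarrow> ext_poly_d n z \<in> ext_poly_carrier n"
  unfolding ext_poly_d_def
  by (intro free_mod_closed ext_poly_mult_closed theta_closed degree_sign_closed)

lemma ext_poly_d_mult:
  assumes "u \<in> ext_poly_carrier n" "v \<in> ext_poly_carrier n"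
  shows "ext_poly_d n (ext_poly_mult u v) =
    ext_poly_mult (ext_poly_d n u) v + ext_poly_mult (degree_sign u) (ext_poly_d n v)"
  using assms
  by (simp add: ext_poly_d_def degree_sign_mult ext_poly_mult_dist
      ext_poly_mult_assoc[of _ n] theta_closed degree_sign_closed ext_poly_mult_closed)

lemma ext_poly_d_degree_sign: "ext_poly_d n (degree_sign z) = - degree_sign (ext_poly_d n z)"
  by (simp add: ext_poly_d_def degree_sign_dist degree_sign_mult degree_sign_theta ext_poly_mult_dist
      degree_sign_degree_sign)

lemma ext_poly_d_emb:
  "ext_poly_d n (emb \<tau> a) = (\<Sum>i\<in>{1..n}. emb (add_mset i \<tau>)
    (ext_mult (gen {i}) a + kscale ((- 1) ^ Suc (size \<tau>)) (ext_mult a (gen {i}))))"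
  by (simp add: ext_poly_d_def theta_def degree_sign_emb ext_poly_mult_dist ext_poly_mult_emb emb_dist
      sum.distrib sum_subtractf kmod.scale_sum_right del: emb_gen)

definition ext_poly_boundaries :: "nat \<Rightarrow> 'k::field ext_poly set"
  where "ext_poly_boundaries n = ext_poly_d n ` ext_poly_carrier n"

lemma subspace_ext_poly_boundaries: "kmod.subspace (ext_poly_boundaries n)"
  unfolding kmod.subspace_def
proof (intro conjI ballI allI)
  show "0 \<in> ext_poly_boundaries n"
    unfolding ext_poly_boundaries_def by (rule image_eqI[of _ _ 0]) (simp_all add: ext_poly_d_dist)
next
  fix x y :: "'a ext_poly" assume "x \<in> ext_poly_boundaries n" "y \<in> ext_poly_boundaries n"
  then show "x + y \<in> ext_poly_boundaries n"
    by (auto simp: ext_poly_boundaries_def ext_poly_d_dist(1)[symmetric])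
next
  fix c and x :: "'a ext_poly" assume "x \<in> ext_poly_boundaries n"
  then show "kscale c x \<in> ext_poly_boundaries n"
    by (auto simp: ext_poly_boundaries_def ext_poly_d_dist(2)[symmetric])
qed

lemmas ext_poly_boundaries_closed =
  kmod.subspace_0[OF subspace_ext_poly_boundaries] kmod.subspace_add[OF subspace_ext_poly_boundaries]
  kmod.subspace_scale[OF subspace_ext_poly_boundaries] kmod.subspace_neg[OF subspace_ext_poly_boundaries]
  kmod.subspace_diff[OF subspace_ext_poly_boundaries] kmod.subspace_sum[OF subspace_ext_poly_boundaries]

lemma ext_poly_boundaries_mult_right:
  assumes "x \<in> ext_poly_boundaries n" "v \<in> ext_poly_carrier n" "ext_poly_d n v = 0"
  shows "ext_poly_mult x v \<in> ext_poly_boundaries n"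
proof -
  obtain w where w: "w \<in> ext_poly_carrier n" "x = ext_poly_d n w"
    using assms(1) by (auto simp: ext_poly_boundaries_def)
  then have "ext_poly_mult x v = ext_poly_d n (ext_poly_mult w v)"
    using assms by (simp add: ext_poly_d_mult ext_poly_mult_dist)
  then show ?thesis
    using w assms(2) by (simp add: ext_poly_boundaries_def ext_poly_mult_closed)
qed

lemma ext_poly_boundaries_mult_left:
  assumes "x \<in> ext_poly_boundaries n" "u \<in> ext_poly_carrier n" "ext_poly_d n u = 0"
  shows "ext_poly_mult u x \<in> ext_poly_boundaries n"
proof -
  obtain w where w: "w \<in> ext_poly_carrier n" "x = ext_poly_d n w"
    using assms(1) by (auto simp: ext_poly_boundaries_def)
  then have "ext_poly_mult u x = ext_poly_d n (ext_poly_mult (degree_sign u) w)"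
    using assms by (simp add: ext_poly_d_mult ext_poly_mult_dist degree_sign_closed
        ext_poly_d_degree_sign degree_sign_degree_sign degree_sign_dist)
  then show ?thesis
    using w assms(2) by (simp add: ext_poly_boundaries_def ext_poly_mult_closed degree_sign_closed)
qed

section \<open>Homogeneous components\<close>

abbreviation index_words :: "nat \<Rightarrow> nat \<Rightarrow> nat list set"
  where "index_words n k \<equiv> {js. set js \<subseteq> {1..n} \<and> length js = k}"

lemma finite_index_words: "finite (index_words n k)"
  by (rule finite_lists_length_eq) simp

lemma small_gens_eq: "small_gens n k = mset ` index_words n k"
proof
  show "small_gens n k \<subseteq> mset ` index_words n k"
  proof
    fix \<tau> assume "\<tau> \<in> small_gens n k"
    moreover obtain js where "mset js = \<tau>"
      using ex_mset by blast
    ultimately show "\<tau> \<in> mset ` index_words n k"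
      by (intro image_eqI[of _ _ js]) auto
  qed
qed auto

lemma finite_small_gens: "finite (small_gens n k)"
  unfolding small_gens_eq by (rule finite_imageI[OF finite_index_words])

definition component :: "nat \<Rightarrow> nat \<Rightarrow> 'k::field ext_poly \<Rightarrow> 'k ext_poly"
  where "component n k z = (\<Sum>\<tau>\<in>small_gens n k. emb \<tau> (part \<tau> z))"

lemma klinear_component: "klinear (component n k)"
  unfolding component_def by (intro emb_part_intros)

lemmas component_dist = klinear_dist[OF klinear_component]

lemma component_gen:
  assumes "(\<sigma>, \<tau>) \<in> ext_poly_index n"
  shows "component n k (gen (\<sigma>, \<tau>)) = (if size \<tau> = k then gen (\<sigma>, \<tau>) else 0)"
proof -
  have "component n k (gen (\<sigma>, \<tau>)) = (\<Sum>\<tau>'\<in>small_gens n k. if \<tau> = \<tau>' then gen (\<sigma>, \<tau>) else 0)"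
    unfolding component_def by (intro sum.cong refl) (simp add: emb_dist)
  then show ?thesis
    using assms finite_small_gens by (simp add: gen_in_ext_poly_index sum.delta')
qed

lemma component_emb:
  assumes "a \<in> ext_carrier n" "set_mset \<tau> \<subseteq> {1..n}"
  shows "component n k (emb \<tau> a) = (if size \<tau> = k then emb \<tau> a else 0)"
  by (rule klinear_eqI[of "\<lambda>a. component n k (emb \<tau> a)" "\<lambda>a. if size \<tau> = k then emb \<tau> a else 0" a "Pow {1..n}"])
    (use assms in \<open>auto intro!: emb_part_intros klinear_comp[OF klinear_component]
      simp: ext_carrier_def component_gen gen_in_ext_poly_index\<close>)

definition degrees :: "'k::field ext_poly \<Rightarrow> nat set"
  where "degrees z = (\<lambda>(\<sigma>, \<tau>). size \<tau>) ` Poly_Mapping.keys z"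

lemma finite_degrees: "finite (degrees z)"
  by (simp add: degrees_def)

lemma part_outside_degrees: "size \<tau> \<notin> degrees z \<Longrightarrow> part \<tau> z = 0"
proof -
  assume "size \<tau> \<notin> degrees z"
  then have "part \<tau> z = klin (\<lambda>s. 0) z"
    unfolding part_def by (intro klin_cong) (force simp: degrees_def)
  then show ?thesis
    by (simp add: klin_fun_dist)
qed

lemma sum_components:
  assumes "z \<in> ext_poly_carrier n" "finite K" "degrees z \<subseteq> K"
  shows "(\<Sum>k\<in>K. component n k z) = z"
proof (rule klinear_eqI[of "\<lambda>z. \<Sum>k\<in>K. component n k z" "\<lambda>z. z" z "Poly_Mapping.keys z"])
  fix s assume s: "s \<in> Poly_Mapping.keys z"
  obtain \<sigma> \<tau> where st: "s = (\<sigma>, \<tau>)"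
    by (cases s)
  have "(\<sigma>, \<tau>) \<in> ext_poly_index n" "size \<tau> \<in> K"
    using s st assms by (auto simp: free_mod_def degrees_def)
  then show "(\<Sum>k\<in>K. component n k (gen s)) = gen s"
    using assms(2) by (simp add: st component_gen sum.delta)
qed (auto intro!: klin_intros klinear_component simp: free_mod_def)

lemma component_ext_poly_d:
  assumes "z \<in> ext_poly_carrier n"
  shows "component n (Suc k) (ext_poly_d n z) = ext_poly_d n (component n k z)"
    and "component n 0 (ext_poly_d n z) = 0"
proof -
  have eq: "component n k (ext_poly_d n (gen s)) =
      (case k of 0 \<Rightarrow> 0 | Suc j \<Rightarrow> ext_poly_d n (component n j (gen s :: 'a ext_poly)))"
    if "s \<in> ext_poly_index n" for s k
  proof -
    obtain \<sigma> \<tau> where "s = (\<sigma>, \<tau>)"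
      by (cases s)
    then have s: "s = (\<sigma>, \<tau>)" "\<sigma> \<subseteq> {1..n}" "set_mset \<tau> \<subseteq> {1..n}"
      using that by (auto simp only: gen_in_ext_poly_index)
    have d: "ext_poly_d n (gen s :: 'a ext_poly) = (\<Sum>i\<in>{1..n}. emb (add_mset i \<tau>)
        (ext_mult (gen {i}) (gen \<sigma>) + kscale ((- 1) ^ Suc (size \<tau>)) (ext_mult (gen \<sigma>) (gen {i}))))"
      using ext_poly_d_emb[of n \<tau> "gen \<sigma>"] unfolding s(1) by (simp only: emb_gen)
    have "component n k (emb (add_mset i \<tau>)
        (ext_mult (gen {i}) (gen \<sigma>) + kscale ((- 1) ^ Suc (size \<tau>)) (ext_mult (gen \<sigma>) (gen {i})))) =
      (if Suc (size \<tau>) = k then emb (add_mset i \<tau>)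
        (ext_mult (gen {i}) (gen \<sigma>) + kscale ((- 1) ^ Suc (size \<tau>)) (ext_mult (gen \<sigma>) (gen {i} :: 'a ext))) else 0)"
      if "i \<in> {1..n}" for i
      using that s
      by (subst component_emb) (auto intro!: ext_carrier_closed ext_mult_closed simp del: ext_mult_gen)
    then have "component n k (ext_poly_d n (gen s :: 'a ext_poly)) = (if Suc (size \<tau>) = k then ext_poly_d n (gen s) else 0)"
      unfolding d component_dist by (cases "Suc (size \<tau>) = k") simp_all
    then show ?thesis
      using that by (cases k) (simp_all add: s(1) component_gen ext_poly_d_dist)
  qed
  have lin: "klinear (\<lambda>z. component n k (ext_poly_d n z :: 'a ext_poly))"
    "klinear (\<lambda>z. ext_poly_d n (component n k z :: 'a ext_poly))" for k
    by (rule klinear_comp[OF klinear_component klinear_ext_poly_d]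
        klinear_comp[OF klinear_ext_poly_d klinear_component])+
  show "component n (Suc k) (ext_poly_d n z) = ext_poly_d n (component n k z)"
    by (rule klinear_eqI[OF lin assms]) (simp add: eq)
  show "component n 0 (ext_poly_d n z) = 0"
    by (rule klinear_eqI[OF lin(1) klinear_const_0 assms]) (simp add: eq)
qed

section \<open>Cochains on the small resolution\<close>

definition small_cochain_poly :: "nat \<Rightarrow> nat \<Rightarrow> ('k::field small \<Rightarrow> 'k ext) \<Rightarrow> 'k ext_poly"
  where "small_cochain_poly n k P = (\<Sum>\<tau>\<in>small_gens n k. emb \<tau> (P (gen ({}, \<tau>, {}))))"

lemma small_map_gen_closed:
  assumes "bimod_map n (small_bimod n k) (ext_bimod n) P" "\<tau> \<in> small_gens n k"
  shows "P (gen ({}, \<tau>, {})) \<in> ext_carrier n"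
  using bimod_map_closed[OF assms(1), of "gen ({}, \<tau>, {})"] assms(2) by (simp add: ext_bimod_def)

lemma small_cochain_poly_closed:
  assumes "bimod_map n (small_bimod n k) (ext_bimod n) P"
  shows "small_cochain_poly n k P \<in> ext_poly_carrier n"
  unfolding small_cochain_poly_def
  by (intro free_mod_closed emb_closed small_map_gen_closed[OF assms]) auto

lemma part_small_cochain_poly:
  assumes "\<tau> \<in> small_gens n k"
  shows "part \<tau> (small_cochain_poly n k P) = P (gen ({}, \<tau>, {}))"
proof -
  have "part \<tau> (small_cochain_poly n k P) =
      (\<Sum>\<tau>'\<in>small_gens n k. if \<tau>' = \<tau> then P (gen ({}, \<tau>', {})) else 0)"
    unfolding small_cochain_poly_def part_dist by (intro sum.cong refl) (simp add: part_emb)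
  then show ?thesis
    using assms finite_small_gens by (simp add: sum.delta)
qed

lemma small_cochain_poly_inject:
  assumes "bimod_map n (small_bimod n k) (ext_bimod n) P" "bimod_map n (small_bimod n k) (ext_bimod n) Q"
    and "small_cochain_poly n k P = small_cochain_poly n k Q" "t \<in> bcarrier (small_bimod n k)"
  shows "P t = Q t"
  using part_small_cochain_poly[of _ n k P] part_small_cochain_poly[of _ n k Q] assms(3)
  by (intro small.bimod_map_eqI[OF assms(1,2,4)]) auto

lemma small_cochain_poly_cong:
  assumes "\<And>t. t \<in> bcarrier (small_bimod n k) \<Longrightarrow> P t = Q t"
  shows "small_cochain_poly n k P = small_cochain_poly n k Q"
  unfolding small_cochain_poly_def by (intro sum.cong refl) (simp add: assms)

lemma small_cochain_poly_add:
  "small_cochain_poly n k (\<lambda>t. P t + Q t) = small_cochain_poly n k P + small_cochain_poly n k Q"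
  by (simp add: small_cochain_poly_def emb_dist sum.distrib)

lemma component_small_cochain_poly:
  assumes "bimod_map n (small_bimod n k) (ext_bimod n) P"
  shows "component n j (small_cochain_poly n k P) = (if j = k then small_cochain_poly n k P else 0)"
proof -
  have "component n j (small_cochain_poly n k P) =
      (\<Sum>\<tau>\<in>small_gens n k. if j = k then emb \<tau> (P (gen ({}, \<tau>, {}))) else 0)"
    unfolding small_cochain_poly_def component_dist
    by (intro sum.cong refl, subst component_emb) (auto intro: small_map_gen_closed[OF assms])
  then show ?thesis
    by (simp add: small_cochain_poly_def)
qed

lemma sum_small_gens_Suc:
  "(\<Sum>\<tau>\<in>small_gens n (Suc k). \<Sum>i\<in>set_mset \<tau>. f \<tau> i) =
    (\<Sum>\<tau>\<in>small_gens n k. \<Sum>i\<in>{1..n}. f (add_mset i \<tau>) i)"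
proof -
  have "(\<Sum>\<tau>\<in>small_gens n (Suc k). \<Sum>i\<in>set_mset \<tau>. f \<tau> i) =
      (\<Sum>(\<tau>, i)\<in>Sigma (small_gens n (Suc k)) set_mset. f \<tau> i)"
    by (rule sum.Sigma) (auto intro: finite_small_gens)
  also have "\<dots> = (\<Sum>(\<tau>, i)\<in>small_gens n k \<times> {1..n}. f (add_mset i \<tau>) i)"
    by (rule sum.reindex_bij_witness[of _ "\<lambda>(\<tau>, i). (add_mset i \<tau>, i)" "\<lambda>(\<tau>, i). (\<tau> - {#i#}, i)"])
      (auto simp: size_Diff1 dest: in_diffD)
  also have "\<dots> = (\<Sum>\<tau>\<in>small_gens n k. \<Sum>i\<in>{1..n}. f (add_mset i \<tau>) i)"
    by (rule sum.cartesian_product[symmetric])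
  finally show ?thesis .
qed

lemma small_cochain_poly_d:
  assumes P: "bimod_map n (small_bimod n k) (ext_bimod n) P"
  shows "small_cochain_poly n (Suc k) (\<lambda>t. P (small_d n (Suc k) t)) = ext_poly_d n (small_cochain_poly n k P)"
proof -
  have gen: "P (small_d n (Suc k) (gen ({}, \<tau>, {}))) = (\<Sum>i\<in>set_mset \<tau>.
      ext_mult (gen {i}) (P (gen ({}, \<tau> - {#i#}, {}))) +
      kscale ((- 1) ^ Suc k) (ext_mult (P (gen ({}, \<tau> - {#i#}, {}))) (gen {i})))"
    if \<tau>: "\<tau> \<in> small_gens n (Suc k)" for \<tau>
  proof -
    have "P (gen ({i}, \<tau> - {#i#}, {}) + kscale ((- 1) ^ Suc k) (gen ({}, \<tau> - {#i#}, {i}))) =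
      ext_mult (gen {i}) (P (gen ({}, \<tau> - {#i#}, {}))) +
      kscale ((- 1) ^ Suc k) (ext_mult (P (gen ({}, \<tau> - {#i#}, {}))) (gen {i}))" (is ?P)
      and "gen ({i}, \<tau> - {#i#}, {}) + kscale ((- 1) ^ Suc k) (gen ({}, \<tau> - {#i#}, {i}))
        \<in> bcarrier (small_bimod n k :: (_, 'a) bimod)" (is ?Q)
      if i: "i \<in># \<tau>" for i
    proof -
      have mem: "gen ({}, \<tau> - {#i#}, {}) \<in> bcarrier (small_bimod n k :: (_, 'a) bimod)"
        "gen ({i}, \<tau> - {#i#}, {}) \<in> bcarrier (small_bimod n k :: (_, 'a) bimod)"
        "gen ({}, \<tau> - {#i#}, {i}) \<in> bcarrier (small_bimod n k :: (_, 'a) bimod)"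
        "(gen {i} :: 'a ext) \<in> ext_carrier n"
        using small_gens_Diff[OF \<tau> i] small_gens_mem[OF \<tau> i]
        by (simp_all only: small.gen_in_carrier gen_in_ext_carrier empty_subsetI simp_thms)
      show ?Q
        by (intro small.carrier_closed mem)
      have "P (gen ({i}, \<tau> - {#i#}, {})) = ext_mult (gen {i}) (P (gen ({}, \<tau> - {#i#}, {})))"
        using bimod_map_lact[OF P mem(1,4)] by (simp add: small.lact_gen ext_bimod_def)
      moreover have "P (gen ({}, \<tau> - {#i#}, {i})) = ext_mult (P (gen ({}, \<tau> - {#i#}, {}))) (gen {i})"
        using bimod_map_ract[OF P mem(1,4)] by (simp add: small.ract_gen ext_bimod_def)
      ultimately show ?P
        using mem by (simp add: bimod_map_add[OF P] bimod_map_scale[OF P] small.carrier_closed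
            del: small.gen_in_carrier power_Suc)
    qed
    then show ?thesis
      by (simp only: small_d_gen) (subst small.map_sum[OF P]; simp)
  qed
  have "small_cochain_poly n (Suc k) (\<lambda>t. P (small_d n (Suc k) t)) =
      (\<Sum>\<tau>\<in>small_gens n (Suc k). \<Sum>i\<in>set_mset \<tau>. emb \<tau> (ext_mult (gen {i}) (P (gen ({}, \<tau> - {#i#}, {}))) +
        kscale ((- 1) ^ Suc k) (ext_mult (P (gen ({}, \<tau> - {#i#}, {}))) (gen {i}))))"
    unfolding small_cochain_poly_def by (intro sum.cong refl) (simp only: gen emb_dist(6))
  also have "\<dots> = ext_poly_d n (small_cochain_poly n k P)"
    unfolding sum_small_gens_Suc small_cochain_poly_def ext_poly_d_dist
    by (intro sum.cong refl) (simp add: ext_poly_d_emb)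
  finally show ?thesis .
qed

definition poly_cochain :: "nat \<Rightarrow> 'k::field ext_poly \<Rightarrow> 'k small \<Rightarrow> 'k ext"
  where "poly_cochain n z = small_extend (\<lambda>\<tau>. part \<tau> z) (ext_bimod n)"

lemma poly_cochain_map:
  "z \<in> ext_poly_carrier n \<Longrightarrow> bimod_map n (small_bimod n k) (ext_bimod n) (poly_cochain n z)"
  unfolding poly_cochain_def
  by (rule small_extend_map[OF exterior_bimodule_ext]) (simp add: ext_bimod_def part_closed)

lemma small_cochain_poly_poly_cochain:
  assumes "z \<in> ext_poly_carrier n"
  shows "small_cochain_poly n k (poly_cochain n z) = component n k z"
  unfolding small_cochain_poly_def component_def poly_cochain_def
  using part_closed[OF assms]
  by (intro sum.cong refl arg_cong[where f = "emb _"] small_extend_unit[OF exterior_bimodule_ext])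
    (simp add: ext_bimod_def)

lemma poly_cochain_d:
  assumes "z \<in> ext_poly_carrier n" "t \<in> bcarrier (small_bimod n (Suc k))"
    and "w = ext_poly_d n z"
  shows "poly_cochain n z (small_d n (Suc k) t) = poly_cochain n w t"
proof (rule small_cochain_poly_inject[OF _ _ _ assms(2)])
  show "bimod_map n (small_bimod n (Suc k)) (ext_bimod n) (\<lambda>t. poly_cochain n z (small_d n (Suc k) t))"
    by (rule bimod_map_comp[OF small_d_map poly_cochain_map[OF assms(1)]])
  show "bimod_map n (small_bimod n (Suc k)) (ext_bimod n) (poly_cochain n w)"
    unfolding assms(3) by (rule poly_cochain_map[OF ext_poly_d_closed[OF assms(1)]])
  show "small_cochain_poly n (Suc k) (\<lambda>t. poly_cochain n z (small_d n (Suc k) t)) =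
      small_cochain_poly n (Suc k) (poly_cochain n w)"
    using assms(1) by (simp add: assms(3) small_cochain_poly_d poly_cochain_map small_cochain_poly_poly_cochain
        ext_poly_d_closed component_ext_poly_d)
qed

lemma poly_cochain_zero: "poly_cochain n 0 t = 0"
proof -
  interpret exterior_bimodule n "ext_bimod n" by (rule exterior_bimodule_ext)
  show ?thesis
    by (simp add: poly_cochain_def small_extend_def part_dist act_dist case_prod_unfold klin_fun_dist)
qed

section \<open>Hochschild cochains\<close>

lemma bcarrier_ext [simp]: "bcarrier (ext_bimod n) = ext_carrier n"
  and lact_ext [simp]: "lact (ext_bimod n) = ext_mult"
  and ract_ext [simp]: "ract (ext_bimod n) = ext_mult"
  by (simp_all add: ext_bimod_def)

lemma hoch_cochains_iff:
  "F \<in> hoch_cochains n k \<longleftrightarrow>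
    bimod_map n (bar_bimod n k) (ext_bimod n) F \<and> (\<forall>t. t \<notin> tens_pow n (Suc (Suc k)) \<longrightarrow> F t = 0)"
  by (simp add: hoch_cochains_def bimod_hom_iff)

lemma hoch_cochains_map: "F \<in> hoch_cochains n k \<Longrightarrow> bimod_map n (bar_bimod n k) (ext_bimod n) F"
  by (simp add: hoch_cochains_iff)

lemma hoch_cochains_0: "(\<lambda>t. 0) \<in> hoch_cochains n k"
  and hoch_cochains_add: "F \<in> hoch_cochains n k \<Longrightarrow> G \<in> hoch_cochains n k \<Longrightarrow> (\<lambda>t. F t + G t) \<in> hoch_cochains n k"
  and hoch_cochains_diff: "F \<in> hoch_cochains n k \<Longrightarrow> G \<in> hoch_cochains n k \<Longrightarrow> (\<lambda>t. F t - G t) \<in> hoch_cochains n k"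
  and hoch_cochains_scale: "F \<in> hoch_cochains n k \<Longrightarrow> (\<lambda>t. kscale c (F t)) \<in> hoch_cochains n k"
  and hoch_cochains_sum: "(\<And>i. i \<in> I \<Longrightarrow> H i \<in> hoch_cochains n k) \<Longrightarrow> (\<lambda>t. \<Sum>i\<in>I. H i t) \<in> hoch_cochains n k"
proof -
  interpret E: exterior_bimodule n "ext_bimod n" by (rule exterior_bimodule_ext)
  show "(\<lambda>t. 0) \<in> hoch_cochains n k"
    "F \<in> hoch_cochains n k \<Longrightarrow> G \<in> hoch_cochains n k \<Longrightarrow> (\<lambda>t. F t + G t) \<in> hoch_cochains n k"
    "F \<in> hoch_cochains n k \<Longrightarrow> G \<in> hoch_cochains n k \<Longrightarrow> (\<lambda>t. F t - G t) \<in> hoch_cochains n k"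
    "F \<in> hoch_cochains n k \<Longrightarrow> (\<lambda>t. kscale c (F t)) \<in> hoch_cochains n k"
    unfolding hoch_cochains_iff
    using E.bimod_map_0 E.bimod_map_plus E.bimod_map_minus E.bimod_map_kscale by auto
  show "(\<lambda>t. \<Sum>i\<in>I. H i t) \<in> hoch_cochains n k" if "\<And>i. i \<in> I \<Longrightarrow> H i \<in> hoch_cochains n k"
    using that unfolding hoch_cochains_iff by (intro conjI E.bimod_map_sums) simp_all
qed

lemma hoch_d_eq: "hoch_d n k F t = (if t \<in> tens_pow n (k + 3) then F (bar_d (Suc k) t) else 0)"
  by (simp add: hoch_d_def zero_outside_def flip: Suc_eq_plus1)

lemma hoch_d_zero_iff:
  "hoch_d n k F = (\<lambda>_. 0) \<longleftrightarrow> (\<forall>t\<in>bcarrier (bar_bimod n (Suc k)). F (bar_d (Suc k) t) = 0)"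
  by (auto simp: hoch_d_eq fun_eq_iff numeral_3_eq_3)

definition restrict_poly :: "nat \<Rightarrow> nat \<Rightarrow> 'k::field cochain \<Rightarrow> 'k ext_poly"
  where "restrict_poly n k F = small_cochain_poly n k (\<lambda>t. F (small_to_bar n k t))"

lemma hoch_restrict_map:
  assumes "F \<in> hoch_cochains n k"
  shows "bimod_map n (small_bimod n k) (ext_bimod n) (\<lambda>t. F (small_to_bar n k t))"
  by (rule bimod_map_comp[OF small_to_bar_map hoch_cochains_map[OF assms]])

lemma restrict_poly_closed: "F \<in> hoch_cochains n k \<Longrightarrow> restrict_poly n k F \<in> ext_poly_carrier n"
  unfolding restrict_poly_def by (rule small_cochain_poly_closed[OF hoch_restrict_map])

lemma component_restrict_poly:
  "F \<in> hoch_cochains n k \<Longrightarrow> component n j (restrict_poly n k F) = (if j = k then restrict_poly n k F else 0)"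
  unfolding restrict_poly_def by (rule component_small_cochain_poly[OF hoch_restrict_map])

lemma restrict_poly_dist:
  "restrict_poly n k (\<lambda>t. 0) = 0"
  "restrict_poly n k (\<lambda>t. F t + G t) = restrict_poly n k F + restrict_poly n k G"
  "restrict_poly n k (\<lambda>t. F t - G t) = restrict_poly n k F - restrict_poly n k G"
  "restrict_poly n k (\<lambda>t. kscale c (F t)) = kscale c (restrict_poly n k F)"
  "restrict_poly n k (\<lambda>t. \<Sum>i\<in>I. H i t) = (\<Sum>i\<in>I. restrict_poly n k (H i))"
  by (simp_all add: restrict_poly_def small_cochain_poly_def emb_dist sum.distrib sum_subtractf
      kmod.scale_sum_right sum.swap[of _ I])

lemma restrict_poly_hoch_d:
  assumes "F \<in> hoch_cochains n k"
  shows "restrict_poly n (Suc k) (hoch_d n k F) = ext_poly_d n (restrict_poly n k F)"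
proof -
  have "restrict_poly n (Suc k) (hoch_d n k F) =
      small_cochain_poly n (Suc k) (\<lambda>t. F (small_to_bar n k (small_d n (Suc k) t)))"
    unfolding restrict_poly_def
  proof (rule small_cochain_poly_cong)
    fix t :: "'a small" assume t: "t \<in> bcarrier (small_bimod n (Suc k))"
    then show "hoch_d n k F (small_to_bar n (Suc k) t) = F (small_to_bar n k (small_d n (Suc k) t))"
      using bimod_map_closed[OF small_to_bar_map t] by (simp add: hoch_d_eq small_to_bar_chain numeral_3_eq_3)
  qed
  then show ?thesis
    using small_cochain_poly_d[OF hoch_restrict_map[OF assms]] by (simp add: restrict_poly_def)
qed

lemma word_in_bar_gens: "js \<in> index_words n k \<Longrightarrow> word js \<in> bar_gens n k"
  by auto

lemma bar_gen_in_tens_pow: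
  "gen (\<alpha> # L @ [\<beta>]) \<in> tens_pow n (Suc (Suc k)) \<longleftrightarrow> \<alpha> \<subseteq> {1..n} \<and> L \<in> bar_gens n k \<and> \<beta> \<subseteq> {1..n}"
  using bar.gen_in_carrier[of \<alpha> L \<beta> n k] by simp

lemma restrict_poly_words:
  assumes "F \<in> hoch_cochains n k"
  shows "restrict_poly n k F = (\<Sum>js\<in>index_words n k. emb (mset js) (F (gen ({} # word js @ [{}]))))"
proof -
  have "restrict_poly n k F =
      (\<Sum>\<tau>\<in>small_gens n k. \<Sum>js | js \<in> index_words n k \<and> mset js = \<tau>. emb (mset js) (F (gen ({} # word js @ [{}]))))"
    unfolding restrict_poly_def small_cochain_poly_def
  proof (rule sum.cong[OF refl])
    fix \<tau> assume "\<tau> \<in> small_gens n k"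
    then have eq: "{js. mset js = \<tau>} = {js. js \<in> index_words n k \<and> mset js = \<tau>}"
      by auto
    have "F (small_to_bar n k (gen ({}, \<tau>, {}))) =
        (\<Sum>js | js \<in> index_words n k \<and> mset js = \<tau>. F (gen ({} # word js @ [{}])))"
      unfolding small_to_bar_gen eq
    proof (rule bar.map_sum[OF hoch_cochains_map[OF assms]])
      fix js assume "js \<in> {js. js \<in> index_words n k \<and> mset js = \<tau>}"
      then have "word js \<in> bar_gens n k"
        using word_in_bar_gens by blast
      then show "gen ({} # word js @ [{}]) \<in> bcarrier (bar_bimod n k :: (_, 'a) bimod)"
        by (simp only: bar.gen_in_carrier empty_subsetI simp_thms)
    qed
    then show "emb \<tau> (F (small_to_bar n k (gen ({}, \<tau>, {})))) =
        (\<Sum>js | js \<in> index_words n k \<and> mset js = \<tau>. emb (mset js) (F (gen ({} # word js @ [{}]))))"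
      by (simp add: emb_dist)
  qed
  also have "\<dots> = (\<Sum>js\<in>index_words n k. emb (mset js) (F (gen ({} # word js @ [{}]))))"
    by (rule sum.group) (auto intro: finite_index_words finite_small_gens)
  finally show ?thesis .
qed

section \<open>The cup product\<close>

lemma of_klin_gen:
  assumes "\<alpha> \<subseteq> {1..n}" "L \<in> bar_gens n k" "\<beta> \<subseteq> {1..n}"
  shows "of_klin n k f (gen (\<alpha> # L @ [\<beta>])) = ext_mult (gen \<alpha>) (ext_mult (f (gen L)) (gen \<beta>))"
  using assms by (simp add: of_klin_def zero_outside_def bar_gen_in_tens_pow butlast_append)

lemma of_klin_cochain:
  assumes "\<And>L. L \<in> bar_gens n k \<Longrightarrow> f (gen L) \<in> ext_carrier n"
  shows "of_klin n k f \<in> hoch_cochains n k"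
proof -
  have "bimod_map n (bar_bimod n k) (ext_bimod n)
      (klin (\<lambda>L. ext_mult (gen (hd L)) (ext_mult (f (gen (butlast (tl L)))) (gen (last L)))))"
    by (rule bar.bimod_mapI[OF exterior_bimodule_ext klinear_klin, where v = "\<lambda>L. f (gen L)"])
      (use assms in \<open>auto simp: butlast_append\<close>)
  then show ?thesis
    using bimod_map_zero_outside[OF bar.exterior_bimodule_axioms] by (simp add: of_klin_def hoch_cochains_def)
qed

lemma to_klin_gen:
  assumes "L \<in> bar_gens n k"
  shows "to_klin n k F (gen L) = F (gen ({} # L @ [{}]))"
  using assms by (simp add: to_klin_def zero_outside_def tens_pow_def)

lemma hoch_cochain_gen_closed:
  assumes "F \<in> hoch_cochains n k" "\<alpha> \<subseteq> {1..n}" "L \<in> bar_gens n k" "\<beta> \<subseteq> {1..n}"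
  shows "F (gen (\<alpha> # L @ [\<beta>])) \<in> ext_carrier n"
  using bimod_map_closed[OF hoch_cochains_map[OF assms(1)], of "gen (\<alpha> # L @ [\<beta>])"] assms
  by (simp add: bar_gen_in_tens_pow)

lemma cup_klin_gen:
  assumes "L \<in> bar_gens n (k + l)"
  shows "cup_klin n k l (to_klin n k F) (to_klin n l G) (gen L) =
    ext_mult (F (gen ({} # take k L @ [{}]))) (G (gen ({} # drop k L @ [{}])))"
proof -
  have "take k L \<in> bar_gens n k" "drop k L \<in> bar_gens n l"
    using assms set_take_subset[of k L] set_drop_subset[of k L] by auto
  then show ?thesis
    using assms by (simp add: cup_klin_def zero_outside_def tens_pow_def to_klin_gen del: mem_Collect_eq)
qed

lemma cup_gen:
  assumes "\<alpha> \<subseteq> {1..n}" "L \<in> bar_gens n k" "L' \<in> bar_gens n l" "\<beta> \<subseteq> {1..n}"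
  shows "cup n k l F G (gen (\<alpha> # L @ L' @ [\<beta>])) =
    ext_mult (gen \<alpha>) (ext_mult (ext_mult (F (gen ({} # L @ [{}]))) (G (gen ({} # L' @ [{}])))) (gen \<beta>))"
proof -
  have "L @ L' \<in> bar_gens n (k + l)"
    using assms by auto
  then show ?thesis
    using of_klin_gen[where \<alpha> = \<alpha> and n = n and L = "L @ L'" and k = "k + l" and \<beta> = \<beta>
        and f = "cup_klin n k l (to_klin n k F) (to_klin n l G)"] cup_klin_gen[where L = "L @ L'" and n = n and k = k and l = l and F = F and G = G] assms
    by (simp add: cup_def)
qed

lemma cup_cochain:
  assumes "F \<in> hoch_cochains n k" "G \<in> hoch_cochains n l"
  shows "cup n k l F G \<in> hoch_cochains n (k + l)"
  unfolding cup_def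
proof (rule of_klin_cochain)
  fix L assume L: "L \<in> bar_gens n (k + l)"
  then have "take k L \<in> bar_gens n k" "drop k L \<in> bar_gens n l"
    using set_take_subset[of k L] set_drop_subset[of k L] by auto
  then show "cup_klin n k l (to_klin n k F) (to_klin n l G) (gen L) \<in> ext_carrier n"
    unfolding cup_klin_gen[OF L]
    by (intro ext_mult_closed hoch_cochain_gen_closed[OF assms(1)] hoch_cochain_gen_closed[OF assms(2)]) auto
qed

lemma restrict_poly_cup:
  assumes "F \<in> hoch_cochains n k" "G \<in> hoch_cochains n l"
  shows "restrict_poly n (k + l) (cup n k l F G) = ext_poly_mult (restrict_poly n k F) (restrict_poly n l G)"
proof -
  let ?f = "\<lambda>js. F (gen ({} # word js @ [{}]))" and ?g = "\<lambda>js. G (gen ({} # word js @ [{}]))"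
  have "ext_poly_mult (restrict_poly n k F) (restrict_poly n l G) =
      (\<Sum>js\<in>index_words n k. \<Sum>js'\<in>index_words n l. emb (mset (js @ js')) (ext_mult (?f js) (?g js')))"
    unfolding restrict_poly_words[OF assms(1)] restrict_poly_words[OF assms(2)]
    by (simp add: ext_poly_mult_dist ext_poly_mult_emb) (rule sum.swap)
  also have "\<dots> = (\<Sum>(js, js')\<in>index_words n k \<times> index_words n l. emb (mset (js @ js')) (ext_mult (?f js) (?g js')))"
    by (rule sum.cartesian_product)
  also have "\<dots> = (\<Sum>js\<in>index_words n (k + l). emb (mset js) (cup n k l F G (gen ({} # word js @ [{}]))))"
  proof (rule sum.reindex_bij_witness[of _ "\<lambda>js. (take k js, drop k js)" "\<lambda>(js, js'). js @ js'"])
    fix p assume "p \<in> index_words n k \<times> index_words n l"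
    then obtain js js' where p: "p = (js, js')" "js \<in> index_words n k" "js' \<in> index_words n l"
      by blast
    have "cup n k l F G (gen ({} # word js @ word js' @ [{}])) = ext_mult (?f js) (?g js')"
      using cup_gen[OF _ word_in_bar_gens[OF p(2)] word_in_bar_gens[OF p(3)], of "{}" "{}" F G] by simp
    then show "emb (mset (case p of (js, js') \<Rightarrow> js @ js'))
        (cup n k l F G (gen ({} # word (case p of (js, js') \<Rightarrow> js @ js') @ [{}]))) =
        (case p of (js, js') \<Rightarrow> emb (mset (js @ js')) (ext_mult (?f js) (?g js')))"
      by (simp add: p(1))
  qed (auto dest: in_set_takeD in_set_dropD)
  also have "\<dots> = restrict_poly n (k + l) (cup n k l F G)"
    by (rule restrict_poly_words[OF cup_cochain[OF assms], symmetric])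
  finally show ?thesis by simp
qed

text \<open>The faces of \<open>x\<^sub>P \<otimes> \<rho> \<otimes> x\<^sub>Q\<close> split into those inside \<open>P \<rho>\<close> and those inside \<open>\<rho> Q\<close>;
  as \<open>F\<close> and \<open>G\<close> are cocycles, the two groups contribute \<open>\<plusminus> F(P) \<rho> G(Q)\<close> with opposite signs.\<close>

lemma cup_cocycle_gen:
  assumes F: "F \<in> hoch_cochains n k" "\<And>t. t \<in> bcarrier (bar_bimod n (Suc k)) \<Longrightarrow> F (bar_d (Suc k) t) = 0"
    and G: "G \<in> hoch_cochains n l" "\<And>t. t \<in> bcarrier (bar_bimod n (Suc l)) \<Longrightarrow> G (bar_d (Suc l) t) = 0"
    and P: "P \<in> bar_gens n k" and \<rho>: "\<rho> \<subseteq> {1..n}" and Q: "Q \<in> bar_gens n l"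
  shows "cup n k l F G (bar_diff ({} # P @ \<rho> # Q @ [{}])) = (0 :: 'k::field ext)"
proof -
  note Fm = hoch_cochains_map[OF F(1)] and Gm = hoch_cochains_map[OF G(1)]
  define f where "f = F (gen ({} # P @ [{}]))"
  define g where "g = G (gen ({} # Q @ [{}]))"
  have fg: "f \<in> ext_carrier n" "g \<in> ext_carrier n"
    unfolding f_def g_def using hoch_cochain_gen_closed[OF F(1)] hoch_cochain_gen_closed[OF G(1)] P Q by auto
  have lens: "length P = k" "length Q = l"
    using P Q by auto
  define X where "X = (bar_diff ({} # P @ [\<rho>]) :: 'k tens)"
  define Y where "Y = (bar_diff (\<rho> # Q @ [{}]) :: 'k tens)"
  have X: "X \<in> tens_pow n (Suc k)" and Y: "Y \<in> tens_pow n (Suc l)"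
    unfolding X_def Y_def
    using bar_diff_closed[of "{} # P @ [\<rho>]" n] bar_diff_closed[of "\<rho> # Q @ [{}]" n] P Q \<rho> by auto
  have keysX: "\<exists>\<alpha> M. L = \<alpha> # M \<and> \<alpha> \<subseteq> {1..n} \<and> M \<in> bar_gens n k" if "L \<in> Poly_Mapping.keys X" for L
  proof -
    have "L \<in> {L. length L = Suc k \<and> set L \<subseteq> Pow {1..n}}"
      using X that unfolding tens_pow_def free_mod_def by blast
    then show ?thesis
      by (cases L) auto
  qed
  have keysY: "\<exists>M \<beta>. L = M @ [\<beta>] \<and> M \<in> bar_gens n l \<and> \<beta> \<subseteq> {1..n}" if "L \<in> Poly_Mapping.keys Y" for L
  proof -
    have "L \<in> {L. length L = Suc l \<and> set L \<subseteq> Pow {1..n}}"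
      using Y that unfolding tens_pow_def free_mod_def by blast
    then show ?thesis
      by (cases L rule: rev_cases) auto
  qed
  have X1: "klin (\<lambda>L. gen (L @ [{}])) X \<in> tens_pow n (Suc (Suc k))"
    using X unfolding tens_pow_def by (rule klin_in_free_mod) auto
  have Y1: "klin (\<lambda>L. gen ({} # L)) Y \<in> tens_pow n (Suc (Suc l))"
    by (rule bar_cons_closed[OF Y])
  have gens: "gen ({} # P @ [\<rho>]) \<in> bcarrier (bar_bimod n k :: (_, 'k) bimod)"
    "gen (\<rho> # Q @ [{}]) \<in> bcarrier (bar_bimod n l :: (_, 'k) bimod)"
    "gen ({} # P @ [{}]) \<in> bcarrier (bar_bimod n k :: (_, 'k) bimod)"
    "gen ({} # Q @ [{}]) \<in> bcarrier (bar_bimod n l :: (_, 'k) bimod)"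
    using P Q \<rho> by (simp_all only: bar.gen_in_carrier empty_subsetI simp_thms)
  have "0 = F (bar_d (Suc k) (gen ({} # (P @ [\<rho>]) @ [{}])))"
    using F(2)[of "gen ({} # (P @ [\<rho>]) @ [{}])"] P \<rho> by (simp add: tens_pow_def)
  also have "bar_d (Suc k) (gen ({} # (P @ [\<rho>]) @ [{}])) = (bar_diff ({} # P @ [\<rho>, {}]) :: 'k tens)"
    using P by (subst bar_d_gen) auto
  also have "\<dots> = klin (\<lambda>L. gen (L @ [{}])) X + kscale ((- 1) ^ Suc k) (gen ({} # P @ [\<rho>]))"
    using bar_diff_split[of "{} # P" \<rho> "[{}]", where 'a = 'k] lens by (simp add: X_def klin_dist)
  also have "F \<dots> = F (klin (\<lambda>L. gen (L @ [{}])) X) + kscale ((- 1) ^ Suc k) (ext_mult f (gen \<rho>))"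
    using X1 gens bimod_map_ract[OF Fm gens(3), of "gen \<rho>"] \<rho>
    by (simp add: bimod_map_add[OF Fm] bimod_map_scale[OF Fm] bar.carrier_closed bar.ract_gen f_def
        del: power_Suc bcarrier_bar add: bcarrier_bar[symmetric])
  finally have FX: "F (klin (\<lambda>L. gen (L @ [{}])) X) = kscale ((- 1) ^ k) (ext_mult f (gen \<rho>))"
    by simp
  have "0 = G (bar_d (Suc l) (gen ({} # (\<rho> # Q) @ [{}])))"
    using G(2)[of "gen ({} # (\<rho> # Q) @ [{}])"] Q \<rho> by (simp add: tens_pow_def)
  also have "bar_d (Suc l) (gen ({} # (\<rho> # Q) @ [{}])) = (bar_diff ({} # \<rho> # Q @ [{}]) :: 'k tens)"
    using Q by (subst bar_d_gen) auto
  also have "\<dots> = gen (\<rho> # Q @ [{}]) - klin (\<lambda>L. gen ({} # L)) Y"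
    by (simp add: Y_def)
  also have "G \<dots> = ext_mult (gen \<rho>) g - G (klin (\<lambda>L. gen ({} # L)) Y)"
    using Y1 gens bimod_map_lact[OF Gm gens(4), of "gen \<rho>"] \<rho>
    by (simp add: bar.map_diff[OF Gm] bar.lact_gen g_def del: bcarrier_bar add: bcarrier_bar[symmetric])
  finally have GY: "G (klin (\<lambda>L. gen ({} # L)) Y) = ext_mult (gen \<rho>) g"
    by simp
  let ?C = "cup n k l F G"
  note Cm = hoch_cochains_map[OF cup_cochain[OF F(1) G(1)]]
  have "klin (\<lambda>L. ?C (gen (L @ Q @ [{}]))) X = klin (\<lambda>L. ext_mult (F (gen (L @ [{}]))) g) X"
  proof (rule klin_cong)
    fix L assume "L \<in> Poly_Mapping.keys X"
    then obtain \<alpha> M where L: "L = \<alpha> # M" "\<alpha> \<subseteq> {1..n}" "M \<in> bar_gens n k"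
      using keysX by blast
    have mem: "gen ({} # M @ [{}]) \<in> bcarrier (bar_bimod n k :: (_, 'k) bimod)"
      using L by (simp only: bar.gen_in_carrier empty_subsetI simp_thms)
    have "F (gen (\<alpha> # M @ [{}])) = ext_mult (gen \<alpha>) (F (gen ({} # M @ [{}])))"
      using bimod_map_lact[OF Fm mem, of "gen \<alpha>"] L(2) by (simp add: bar.lact_gen)
    then show "?C (gen (L @ Q @ [{}])) = ext_mult (F (gen (L @ [{}]))) g"
      using cup_gen[OF L(2,3) Q, of "{}" F G] bimod_map_closed[OF Fm mem] L(2) fg
      by (simp add: L(1) g_def ext_mult_assoc[of _ n])
  qed
  also have "\<dots> = ext_mult (F (klin (\<lambda>L. gen (L @ [{}])) X)) g"
    using bar.map_eq_klin[OF Fm, of "klin (\<lambda>L. gen (L @ [{}])) X"] X1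
    by (simp add: klin_klinear[OF klinear_ext_mult_left[OF klinear_id]])
  finally have 1: "klin (\<lambda>L. ?C (gen (L @ Q @ [{}]))) X = kscale ((- 1) ^ k) (ext_mult (ext_mult f (gen \<rho>)) g)"
    by (simp add: FX ext_mult_dist)
  have "klin (\<lambda>L. ?C (gen ({} # P @ L))) Y = klin (\<lambda>L. ext_mult f (G (gen ({} # L)))) Y"
  proof (rule klin_cong)
    fix L assume "L \<in> Poly_Mapping.keys Y"
    then obtain M \<beta> where L: "L = M @ [\<beta>]" "M \<in> bar_gens n l" "\<beta> \<subseteq> {1..n}"
      using keysY by blast
    have mem: "gen ({} # M @ [{}]) \<in> bcarrier (bar_bimod n l :: (_, 'k) bimod)"
      using L by (simp only: bar.gen_in_carrier empty_subsetI simp_thms)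
    have "G (gen ({} # M @ [\<beta>])) = ext_mult (G (gen ({} # M @ [{}]))) (gen \<beta>)"
      using bimod_map_ract[OF Gm mem, of "gen \<beta>"] L(3) by (simp add: bar.ract_gen)
    then show "?C (gen ({} # P @ L)) = ext_mult f (G (gen ({} # L)))"
      using cup_gen[OF _ P L(2,3), of "{}" F G] bimod_map_closed[OF Gm mem] L(3) fg
      by (simp add: L(1) f_def ext_mult_assoc[of _ n])
  qed
  also have "\<dots> = ext_mult f (G (klin (\<lambda>L. gen ({} # L)) Y))"
    using bar.map_eq_klin[OF Gm, of "klin (\<lambda>L. gen ({} # L)) Y"] Y1
    by (simp add: klin_klinear[OF klinear_ext_mult_right[OF klinear_id]])
  finally have 2: "klin (\<lambda>L. ?C (gen ({} # P @ L))) Y = ext_mult f (ext_mult (gen \<rho>) g)"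
    by (simp add: GY)
  have D: "bar_diff ({} # P @ \<rho> # Q @ [{}]) =
      klin (\<lambda>L. gen (L @ Q @ [{}])) X + kscale ((- 1) ^ Suc k) (klin (\<lambda>L. gen ({} # P @ L)) Y)"
    using bar_diff_split[of "{} # P" \<rho> "Q @ [{}]", where 'a = 'k] lens
    by (simp add: X_def Y_def del: bar_diff.simps)
  have "bar_diff ({} # P @ \<rho> # Q @ [{}]) \<in> (tens_pow n (Suc (Suc (k + l))) :: 'k tens set)"
    using bar_diff_closed[of "{} # P @ \<rho> # Q @ [{}]" n, where 'k = 'k] P Q \<rho> by simp
  then have "?C (bar_diff ({} # P @ \<rho> # Q @ [{}])) = klin (\<lambda>L. ?C (gen L)) (bar_diff ({} # P @ \<rho> # Q @ [{}]))"
    using bar.map_eq_klin[OF Cm] by simp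
  also have "\<dots> = 0"
    using fg \<rho> unfolding D by (simp add: klin_dist 1 2 ext_mult_assoc[of _ n])
  finally show ?thesis .
qed

lemma hoch_d_cup:
  assumes "F \<in> hoch_cochains n k" "hoch_d n k F = (\<lambda>_. 0)" "G \<in> hoch_cochains n l" "hoch_d n l G = (\<lambda>_. 0)"
  shows "hoch_d n (k + l) (cup n k l F G) = (\<lambda>_. 0)"
  unfolding hoch_d_zero_iff
proof
  fix t assume t: "t \<in> bcarrier (bar_bimod n (Suc (k + l)) :: (_, 'a) bimod)"
  show "cup n k l F G (bar_d (Suc (k + l)) t) = 0"
  proof (rule bar.bimod_map_eqI[OF _ _ t])
    show "bimod_map n (bar_bimod n (Suc (k + l))) (ext_bimod n) (\<lambda>t. cup n k l F G (bar_d (Suc (k + l)) t))"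
      by (rule bimod_map_comp[OF bar_d_map hoch_cochains_map[OF cup_cochain]]) (use assms in auto)
    show "bimod_map n (bar_bimod n (Suc (k + l))) (ext_bimod n) (\<lambda>t. 0)"
      by (rule exterior_bimodule.bimod_map_0[OF exterior_bimodule_ext])
    fix L assume L: "L \<in> bar_gens n (Suc (k + l))"
    define P where "P = take k L"
    define Q where "Q = drop (Suc k) L"
    have "L = P @ L ! k # Q"
      using L unfolding P_def Q_def by (intro id_take_nth_drop) simp
    then have "{} # L @ [{}] = {} # P @ L ! k # Q @ [{}]"
      by (metis append.assoc append_Cons)
    moreover have "bar_d (Suc (k + l)) (gen ({} # L @ [{}])) = (bar_diff ({} # L @ [{}]) :: 'a tens)"
      using L by (intro bar_d_gen) simp
    moreover have "P \<in> bar_gens n k" "Q \<in> bar_gens n l"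
      using L set_take_subset[of k L] set_drop_subset[of "Suc k" L] by (auto simp: P_def Q_def)
    moreover have "L ! k \<subseteq> {1..n}"
      using L nth_mem[of k L] by (simp only: mem_Collect_eq) (use L in fastforce)
    ultimately show "cup n k l F G (bar_d (Suc (k + l)) (gen ({} # L @ [{}]))) = 0"
      using cup_cocycle_gen[OF assms(1) _ assms(3), of P "L ! k" Q] assms(2,4)
      by (simp only: hoch_d_zero_iff)
  qed
qed

lemma cup_zero: "cup n k l (\<lambda>_. 0) G = (\<lambda>_. 0)" "cup n k l F (\<lambda>_. 0) = (\<lambda>_. 0)"
  by (simp_all add: fun_eq_iff cup_def of_klin_def cup_klin_def to_klin_def zero_outside_def
      ext_mult_dist klin_fun_dist cong: if_cong)

section \<open>Cocycles and their polynomials\<close>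

lemma homotopic_to_idE:
  assumes "homotopic_to_id n M d f"
  obtains s where "\<And>k. bimod_map n (M k) (M (Suc k)) (s k)"
    and "\<And>t. t \<in> bcarrier (M 0) \<Longrightarrow> f 0 t = t + d (Suc 0) (s 0 t)"
    and "\<And>k t. t \<in> bcarrier (M (Suc k)) \<Longrightarrow> f (Suc k) t = t + (d (Suc (Suc k)) (s (Suc k) t) + s k (d (Suc k) t))"
proof -
  obtain s where s: "\<forall>k. s k \<in> bimod_hom n (M k) (M (k + 1))"
    "\<forall>k. \<forall>t\<in>bcarrier (M k). f k t - t = d (k + 1) (s k t) + (if k = 0 then 0 else s (k - 1) (d k t))"
    using assms unfolding homotopic_to_id_def by blast
  show ?thesis
  proof (rule that[of s])
    show "bimod_map n (M k) (M (Suc k)) (s k)" for k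
      using spec[OF s(1), of k] by (simp add: bimod_hom_iff flip: Suc_eq_plus1)
    show "f 0 t = t + d (Suc 0) (s 0 t)" if "t \<in> bcarrier (M 0)" for t
      using bspec[OF spec[OF s(2), of 0] that] by (simp add: diff_eq_eq add.commute One_nat_def)
    show "f (Suc k) t = t + (d (Suc (Suc k)) (s (Suc k) t) + s k (d (Suc k) t))" if "t \<in> bcarrier (M (Suc k))" for k t
      using bspec[OF spec[OF s(2), of "Suc k"] that]
      by (simp add: diff_eq_eq add.commute[of t] flip: Suc_eq_plus1)
  qed
qed

lemma in_hoch_cocycles:
  "F \<in> carrier (hoch_cocycles n) \<longleftrightarrow> (\<forall>k. F k \<in> hoch_cochains n k) \<and> finite {k. F k \<noteq> (\<lambda>_. 0)} \<and>
    (\<forall>k. hoch_d n k (F k) = (\<lambda>_. 0))"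
  by (simp add: hoch_cocycles_def)

lemma hoch_cocycles_add: "F \<oplus>\<^bsub>hoch_cocycles n\<^esub> G = (\<lambda>k t. F k t + G k t)"
  and hoch_cocycles_mult: "F \<otimes>\<^bsub>hoch_cocycles n\<^esub> G = (\<lambda>m t. \<Sum>k\<le>m. cup n k (m - k) (F k) (G (m - k)) t)"
  and hoch_cocycles_one: "\<one>\<^bsub>hoch_cocycles n\<^esub> = in_degree 0 (of_klin n 0 (klin (\<lambda>_. gen {})))"
  by (simp_all add: hoch_cocycles_def)

definition hoch_poly :: "nat \<Rightarrow> (nat \<Rightarrow> 'k::field cochain) \<Rightarrow> 'k ext_poly"
  where "hoch_poly n F = (\<Sum>k | F k \<noteq> (\<lambda>_. 0). restrict_poly n k (F k))"

lemma hoch_poly_superset: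
  assumes "finite K" "{k. F k \<noteq> (\<lambda>_. 0)} \<subseteq> K"
  shows "hoch_poly n F = (\<Sum>k\<in>K. restrict_poly n k (F k))"
  unfolding hoch_poly_def using assms
  by (intro sum.mono_neutral_left) (auto simp: restrict_poly_dist)

lemma hoch_poly_closed: "F \<in> carrier (hoch_cocycles n) \<Longrightarrow> hoch_poly n F \<in> ext_poly_carrier n"
  unfolding hoch_poly_def by (intro free_mod_closed restrict_poly_closed) (simp add: in_hoch_cocycles)

lemma hoch_poly_cycle:
  assumes "F \<in> carrier (hoch_cocycles n)"
  shows "ext_poly_d n (hoch_poly n F) = 0"
  unfolding hoch_poly_def ext_poly_d_dist
proof (rule sum.neutral, rule ballI)
  fix k
  have F: "F k \<in> hoch_cochains n k" "hoch_d n k (F k) = (\<lambda>_. 0)"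
    using assms by (auto simp: in_hoch_cocycles)
  show "ext_poly_d n (restrict_poly n k (F k)) = 0"
    using restrict_poly_hoch_d[OF F(1)] by (simp add: F(2) restrict_poly_dist)
qed

lemma component_hoch_poly:
  assumes "F \<in> carrier (hoch_cocycles n)"
  shows "component n k (hoch_poly n F) = restrict_poly n k (F k)"
proof -
  have fin: "finite (insert k {k. F k \<noteq> (\<lambda>_. 0)})"
    using assms by (simp add: in_hoch_cocycles)
  have "component n k (hoch_poly n F) =
      (\<Sum>j\<in>insert k {k. F k \<noteq> (\<lambda>_. 0)}. if k = j then restrict_poly n j (F j) else 0)"
    unfolding hoch_poly_superset[OF fin subset_insertI] component_dist
    using assms by (intro sum.cong refl) (simp add: in_hoch_cocycles component_restrict_poly)
  then show ?thesis
    using fin by (simp add: sum.delta')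
qed

lemma hoch_poly_add:
  assumes "F \<in> carrier (hoch_cocycles n)" "G \<in> carrier (hoch_cocycles n)"
  shows "hoch_poly n (\<lambda>k t. F k t + G k t) = hoch_poly n F + hoch_poly n G"
    and "hoch_poly n (\<lambda>k t. F k t - G k t) = hoch_poly n F - hoch_poly n G"
proof -
  define K where "K = {k. F k \<noteq> (\<lambda>_. 0)} \<union> {k. G k \<noteq> (\<lambda>_. 0)}"
  have zero: "F k = (\<lambda>_. 0)" "G k = (\<lambda>_. 0)" if "k \<notin> K" for k
    using that by (simp_all add: K_def)
  have K: "finite K"
    using assms by (simp add: K_def in_hoch_cocycles)
  have supp: "{k. F k \<noteq> (\<lambda>_. 0)} \<subseteq> K" "{k. G k \<noteq> (\<lambda>_. 0)} \<subseteq> K"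
    "{k. (\<lambda>t. F k t + G k t) \<noteq> (\<lambda>_. 0)} \<subseteq> K" "{k. (\<lambda>t. F k t - G k t) \<noteq> (\<lambda>_. 0)} \<subseteq> K"
    by (rule subsetI, rule ccontr, simp add: zero)+
  show "hoch_poly n (\<lambda>k t. F k t + G k t) = hoch_poly n F + hoch_poly n G"
    and "hoch_poly n (\<lambda>k t. F k t - G k t) = hoch_poly n F - hoch_poly n G"
    by (simp_all add: supp[THEN hoch_poly_superset[OF K]] restrict_poly_dist sum.distrib sum_subtractf)
qed

lemma hoch_poly_scale:
  assumes "F \<in> carrier (hoch_cocycles n)"
  shows "hoch_poly n (\<lambda>k t. kscale c (F k t)) = kscale c (hoch_poly n F)"
proof -
  have K: "finite {k. F k \<noteq> (\<lambda>_. 0)}" "{k. (\<lambda>t. kscale c (F k t)) \<noteq> (\<lambda>_. 0)} \<subseteq> {k. F k \<noteq> (\<lambda>_. 0)}"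
    using assms by (auto simp: in_hoch_cocycles)
  show ?thesis
    by (simp add: hoch_poly_superset[OF K] hoch_poly_def restrict_poly_dist kmod.scale_sum_right)
qed

lemma hoch_cocycles_closed:
  assumes "F \<in> carrier (hoch_cocycles n)" "G \<in> carrier (hoch_cocycles n)"
  shows "(\<lambda>k t. F k t + G k t) \<in> carrier (hoch_cocycles n)"
    and "(\<lambda>k t. F k t - G k t) \<in> carrier (hoch_cocycles n)"
    and "(\<lambda>k t. kscale c (F k t)) \<in> carrier (hoch_cocycles n)"
proof -
  define K where "K = {k. F k \<noteq> (\<lambda>_. 0)} \<union> {k. G k \<noteq> (\<lambda>_. 0)}"
  have zero: "F k = (\<lambda>_. 0)" "G k = (\<lambda>_. 0)" if "k \<notin> K" for k
    using that by (simp_all add: K_def)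
  have K: "finite K"
    using assms by (simp add: K_def in_hoch_cocycles)
  have fin: "finite {k. (\<lambda>t. F k t + G k t) \<noteq> (\<lambda>_. 0)}" "finite {k. (\<lambda>t. F k t - G k t) \<noteq> (\<lambda>_. 0)}"
    "finite {k. (\<lambda>t. kscale c (F k t)) \<noteq> (\<lambda>_. 0)}"
    by (rule finite_subset[OF _ K], rule subsetI, rule ccontr, simp add: zero)+
  have d: "hoch_d n k (F k) = (\<lambda>_. 0)" "hoch_d n k (G k) = (\<lambda>_. 0)" for k
    using assms by (auto simp: in_hoch_cocycles)
  then have d: "t \<in> bcarrier (bar_bimod n (Suc k)) \<Longrightarrow> F k (bar_d (Suc k) t) = 0 \<and> G k (bar_d (Suc k) t) = 0" for k t
    unfolding hoch_d_zero_iff by blast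
  show "(\<lambda>k t. F k t + G k t) \<in> carrier (hoch_cocycles n)"
    "(\<lambda>k t. F k t - G k t) \<in> carrier (hoch_cocycles n)"
    "(\<lambda>k t. kscale c (F k t)) \<in> carrier (hoch_cocycles n)"
    using assms fin d
    by (simp_all add: in_hoch_cocycles hoch_cochains_add hoch_cochains_diff hoch_cochains_scale hoch_d_zero_iff)
qed

lemma hoch_cocycles_mult_closed:
  assumes "F \<in> carrier (hoch_cocycles n)" "G \<in> carrier (hoch_cocycles n)"
  shows "F \<otimes>\<^bsub>hoch_cocycles n\<^esub> G \<in> carrier (hoch_cocycles n)"
    and "hoch_poly n (F \<otimes>\<^bsub>hoch_cocycles n\<^esub> G) = ext_poly_mult (hoch_poly n F) (hoch_poly n G)"
proof -
  have F: "F k \<in> hoch_cochains n k" "hoch_d n k (F k) = (\<lambda>_. 0)"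
    and G: "G k \<in> hoch_cochains n k" "hoch_d n k (G k) = (\<lambda>_. 0)" for k
    using assms by (auto simp: in_hoch_cocycles)
  have "finite ({k. F k \<noteq> (\<lambda>_. 0)} \<union> {k. G k \<noteq> (\<lambda>_. 0)})"
    using assms by (simp add: in_hoch_cocycles)
  then obtain N where "\<forall>k\<in>{k. F k \<noteq> (\<lambda>_. 0)} \<union> {k. G k \<noteq> (\<lambda>_. 0)}. k \<le> N"
    unfolding finite_nat_set_iff_bounded_le by blast
  then have N: "\<And>k. k > N \<Longrightarrow> F k = (\<lambda>_. 0)" "\<And>k. k > N \<Longrightarrow> G k = (\<lambda>_. 0)"
    using not_le by blast+
  let ?H = "\<lambda>m k. cup n k (m - k) (F k) (G (m - k))"
  define H where "H m = (\<lambda>t. \<Sum>k\<le>m. ?H m k t)" for m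
  have FG: "F \<otimes>\<^bsub>hoch_cocycles n\<^esub> G = H"
    by (simp add: H_def hoch_cocycles_mult fun_eq_iff)
  have cup: "?H m k \<in> hoch_cochains n m" "hoch_d n m (?H m k) = (\<lambda>_. 0)"
    "restrict_poly n m (?H m k) = ext_poly_mult (restrict_poly n k (F k)) (restrict_poly n (m - k) (G (m - k)))"
    if "k \<le> m" for k m
    using cup_cochain[OF F(1) G(1), of k "m - k"] hoch_d_cup[OF F G, of k "m - k"]
      restrict_poly_cup[OF F(1) G(1), of k "m - k"] that by simp_all
  have coch: "H m \<in> hoch_cochains n m" for m
    unfolding H_def using cup(1) by (intro hoch_cochains_sum) auto
  have d: "hoch_d n m (H m) = (\<lambda>_. 0)" for m
    using cup(2)[of _ m] by (simp add: H_def hoch_d_zero_iff)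
  have supp: "{m. H m \<noteq> (\<lambda>_. 0)} \<subseteq> {..2 * N}"
  proof -
    have "H m = (\<lambda>_. 0)" if m: "\<not> m \<le> 2 * N" for m
    proof -
      have "?H m k = (\<lambda>_. 0)" if "k \<le> m" for k
        using m that N(1)[of k] N(2)[of "m - k"] by (cases "k \<le> N") (auto simp: cup_zero)
      then show ?thesis
        by (simp add: H_def)
    qed
    then show ?thesis
      by auto
  qed
  then show "F \<otimes>\<^bsub>hoch_cocycles n\<^esub> G \<in> carrier (hoch_cocycles n)"
    unfolding FG in_hoch_cocycles using coch d finite_subset[OF supp] by blast
  let ?f = "\<lambda>k. restrict_poly n k (F k)" and ?g = "\<lambda>k. restrict_poly n k (G k)"
  have "hoch_poly n H = (\<Sum>m\<le>2 * N. \<Sum>k\<le>m. ext_poly_mult (?f k) (?g (m - k)))"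
    unfolding hoch_poly_superset[OF finite_atMost supp]
    by (intro sum.cong refl) (simp add: H_def restrict_poly_dist cup(3))
  also have "\<dots> = (\<Sum>(k, l)\<in>{(k, l). k + l \<le> 2 * N}. ext_poly_mult (?f k) (?g l))"
    by (rule sum.triangle_reindex_eq[symmetric])
  also have "\<dots> = (\<Sum>(k, l)\<in>{..N} \<times> {..N}. ext_poly_mult (?f k) (?g l))"
  proof (rule sum.mono_neutral_right)
    show "finite {(k, l). k + l \<le> 2 * N}"
      by (rule finite_subset[of _ "{..2 * N} \<times> {..2 * N}"]) auto
    show "\<forall>p\<in>{(k, l). k + l \<le> 2 * N} - {..N} \<times> {..N}. (case p of (k, l) \<Rightarrow> ext_poly_mult (?f k) (?g l)) = 0"
    proof
      fix p assume p: "p \<in> {(k, l). k + l \<le> 2 * N} - {..N} \<times> {..N}"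
      obtain k l where "p = (k, l)"
        by (cases p)
      with p have "N < k \<or> N < l"
        by auto
      then show "(case p of (k, l) \<Rightarrow> ext_poly_mult (?f k) (?g l)) = 0"
        using N \<open>p = (k, l)\<close> by (auto simp: restrict_poly_dist ext_poly_mult_dist)
    qed
  qed auto
  also have "\<dots> = (\<Sum>k\<le>N. \<Sum>l\<le>N. ext_poly_mult (?f k) (?g l))"
    by (rule sum.cartesian_product[symmetric])
  also have "\<dots> = ext_poly_mult (\<Sum>k\<le>N. ?f k) (\<Sum>l\<le>N. ?g l)"
    by (simp add: ext_poly_mult_dist) (rule sum.swap)
  also have "(\<Sum>k\<le>N. ?f k) = hoch_poly n F"
    using N(1) not_le by (intro hoch_poly_superset[symmetric]) blast+
  also have "(\<Sum>l\<le>N. ?g l) = hoch_poly n G"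
    using N(2) not_le by (intro hoch_poly_superset[symmetric]) blast+
  finally show "hoch_poly n (F \<otimes>\<^bsub>hoch_cocycles n\<^esub> G) = ext_poly_mult (hoch_poly n F) (hoch_poly n G)"
    by (simp add: FG)
qed

lemma hoch_cocycles_one_closed:
  "\<one>\<^bsub>hoch_cocycles n\<^esub> \<in> carrier (hoch_cocycles n :: (nat \<Rightarrow> 'k::field cochain) ring)"
  "hoch_poly n (\<one>\<^bsub>hoch_cocycles n\<^esub>) = (gen ({}, {#}) :: 'k::field ext_poly)"
proof -
  let ?u = "of_klin n 0 (klin (\<lambda>_. gen {})) :: 'k cochain"
  have u: "?u \<in> hoch_cochains n 0"
    by (rule of_klin_cochain) simp
  have "?u (bar_d (Suc 0) t) = 0" if t: "t \<in> bcarrier (bar_bimod n (Suc 0))" for t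
  proof (rule bar.bimod_map_eqI[OF _ _ t])
    show "bimod_map n (bar_bimod n (Suc 0)) (ext_bimod n) (\<lambda>t. ?u (bar_d (Suc 0) t))"
      by (rule bimod_map_comp[OF bar_d_map hoch_cochains_map[OF u]])
    show "bimod_map n (bar_bimod n (Suc 0) :: (_, 'k) bimod) (ext_bimod n) (\<lambda>t. 0)"
      by (rule exterior_bimodule.bimod_map_0[OF exterior_bimodule_ext])
    fix L assume "L \<in> bar_gens n (Suc 0)"
    then obtain \<sigma> where \<sigma>: "L = [\<sigma>]" "\<sigma> \<subseteq> {1..n}"
      by (auto simp: length_Suc_conv)
    have mem: "gen [\<sigma>, {}] \<in> bcarrier (bar_bimod n 0 :: (_, 'k) bimod)" "gen [{}, \<sigma>] \<in> bcarrier (bar_bimod n 0 :: (_, 'k) bimod)"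
      using \<sigma>(2) by (simp_all add: tens_pow_def)
    have "?u (gen [\<sigma>, {}]) = gen \<sigma>" "?u (gen [{}, \<sigma>]) = gen \<sigma>"
      using of_klin_gen[of \<sigma> n "[]" 0 "{}" "klin (\<lambda>_. gen {}) :: 'k cochain"]
        of_klin_gen[of "{}" n "[]" 0 \<sigma> "klin (\<lambda>_. gen {}) :: 'k cochain"] \<sigma>(2) by simp_all
    then show "?u (bar_d (Suc 0) (gen ({} # L @ [{}]))) = 0"
      using bar.map_diff[OF hoch_cochains_map[OF u] mem] by (simp add: \<sigma>(1) bar_d_gen klin_dist)
  qed
  then have "hoch_d n 0 ?u = (\<lambda>_. 0)"
    unfolding hoch_d_zero_iff by simp
  moreover have "hoch_d n k (\<lambda>_. 0) = (\<lambda>_. 0 :: 'k ext)" for k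
    by (simp add: hoch_d_zero_iff)
  moreover have supp: "{k. in_degree 0 ?u k \<noteq> (\<lambda>_. 0)} \<subseteq> {0}"
    by (auto simp: in_degree_def)
  ultimately show "\<one>\<^bsub>hoch_cocycles n\<^esub> \<in> carrier (hoch_cocycles n :: (nat \<Rightarrow> 'k cochain) ring)"
    using u hoch_cochains_0 finite_subset[OF supp] unfolding in_hoch_cocycles hoch_cocycles_one
    by (auto simp: in_degree_def)
  have "index_words n 0 = {[]}"
    by auto
  then have "restrict_poly n 0 ?u = gen ({}, {#})"
    using of_klin_gen[of "{}" n "[]" 0 "{}" "klin (\<lambda>_. gen {}) :: 'k cochain"]
    by (simp add: restrict_poly_words[OF u])
  then show "hoch_poly n (\<one>\<^bsub>hoch_cocycles n\<^esub>) = (gen ({}, {#}) :: 'k ext_poly)"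
    using hoch_poly_superset[OF _ supp] by (simp add: hoch_cocycles_one in_degree_def)
qed

section \<open>Restriction to the small resolution is a quasi-isomorphism\<close>

definition lift_poly :: "nat \<Rightarrow> (nat \<Rightarrow> 'k::field tens \<Rightarrow> 'k small) \<Rightarrow> 'k ext_poly \<Rightarrow> nat \<Rightarrow> 'k cochain"
  where "lift_poly n g z k = zero_outside (tens_pow n (k + 2)) (\<lambda>t. poly_cochain n z (g k t))"

lemma homotopy_inverse_map: "homotopy_inverse n g \<Longrightarrow> bimod_map n (bar_bimod n k) (small_bimod n k) (g k)"
  by (simp add: homotopy_inverse_def bimod_hom_iff)

lemma homotopy_inverse_chain:
  "homotopy_inverse n g \<Longrightarrow> t \<in> bcarrier (bar_bimod n (Suc k)) \<Longrightarrow> small_d n (Suc k) (g (Suc k) t) = g k (bar_d (Suc k) t)"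
  unfolding homotopy_inverse_def by (metis Suc_eq_plus1)

lemma poly_cochain_outside_degrees:
  assumes "k \<notin> degrees z" "t \<in> bcarrier (small_bimod n k)"
  shows "poly_cochain n z t = 0"
proof -
  have "poly_cochain n z t = klin (\<lambda>s. 0) t"
    unfolding poly_cochain_def small_extend_def
  proof (rule klin_cong)
    fix s assume "s \<in> Poly_Mapping.keys t"
    then have "s \<in> {small_index \<alpha> \<tau> \<beta> | \<alpha> \<tau> \<beta>. \<alpha> \<subseteq> {1..n} \<and> \<tau> \<in> small_gens n k \<and> \<beta> \<subseteq> {1..n}}"
      using assms(2) unfolding small.carrier_eq free_mod_def by blast
    then have "part (fst (snd s)) z = 0"
      using assms(1) by (intro part_outside_degrees) auto
    then show "(case s of (\<alpha>, \<tau>, \<beta>) \<Rightarrow> lact (ext_bimod n) (gen \<alpha>) (ract (ext_bimod n) (part \<tau> z) (gen \<beta>))) = 0"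
      by (simp add: case_prod_unfold ext_mult_dist)
  qed
  then show ?thesis
    by (simp add: klin_fun_dist)
qed

lemma lift_poly_cochain:
  assumes "homotopy_inverse n g" "z \<in> ext_poly_carrier n"
  shows "lift_poly n g z k \<in> hoch_cochains n k"
  using bimod_map_zero_outside[OF bar.exterior_bimodule_axioms
      bimod_map_comp[OF homotopy_inverse_map[OF assms(1)] poly_cochain_map[OF assms(2)]], of k]
  by (simp add: lift_poly_def hoch_cochains_def)

lemma lift_poly_support:
  assumes "homotopy_inverse n g"
  shows "{k. lift_poly n g z k \<noteq> (\<lambda>_. 0)} \<subseteq> degrees z"
  using poly_cochain_outside_degrees[of _ z _ n] bimod_map_closed[OF homotopy_inverse_map[OF assms]]
  by (fastforce simp: lift_poly_def zero_outside_def)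

lemma lift_poly_cocycle:
  assumes g: "homotopy_inverse n g" and z: "z \<in> ext_poly_carrier n" "ext_poly_d n z = 0"
  shows "lift_poly n g z \<in> carrier (hoch_cocycles n)"
proof -
  have "lift_poly n g z k (bar_d (Suc k) t) = 0" if t: "t \<in> bcarrier (bar_bimod n (Suc k))" for k t
    using bimod_map_closed[OF bar_d_map t] bimod_map_closed[OF homotopy_inverse_map[OF g] t]
      homotopy_inverse_chain[OF g t] poly_cochain_d[OF z(1), of "g (Suc k) t" k 0] z(2)
    by (simp add: lift_poly_def zero_outside_def poly_cochain_zero)
  then show ?thesis
    using lift_poly_cochain[OF g z(1)] finite_subset[OF lift_poly_support[OF g] finite_degrees]
    by (simp add: in_hoch_cocycles hoch_d_zero_iff)
qed

lemma hoch_poly_lift_poly: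
  assumes g: "homotopy_inverse n g" and z: "z \<in> ext_poly_carrier n" "ext_poly_d n z = 0"
  shows "hoch_poly n (lift_poly n g z) - z \<in> ext_poly_boundaries n"
proof -
  have "homotopic_to_id n (small_bimod n) (small_d n) (\<lambda>k t. g k (small_to_bar n k t))"
    using g by (simp add: homotopy_inverse_def)
  then obtain s where s: "\<And>k. bimod_map n (small_bimod n k) (small_bimod n (Suc k)) (s k)"
    "\<And>t. t \<in> bcarrier (small_bimod n 0) \<Longrightarrow> g 0 (small_to_bar n 0 t) = t + small_d n (Suc 0) (s 0 t)"
    "\<And>k t. t \<in> bcarrier (small_bimod n (Suc k)) \<Longrightarrow> g (Suc k) (small_to_bar n (Suc k) t) =
      t + (small_d n (Suc (Suc k)) (s (Suc k) t) + s k (small_d n (Suc k) t))"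
    by (rule homotopic_to_idE) blast
  note P = poly_cochain_map[OF z(1)]
  have Pd: "poly_cochain n z (small_d n (Suc k) t) = 0" if "t \<in> bcarrier (small_bimod n (Suc k))" for k t
    using poly_cochain_d[OF z(1) that refl] z(2) by (simp add: poly_cochain_zero)
  have lift: "restrict_poly n k (lift_poly n g z k) =
      small_cochain_poly n k (\<lambda>t. poly_cochain n z (g k (small_to_bar n k t)))" for k
    unfolding restrict_poly_def
  proof (rule small_cochain_poly_cong)
    fix t :: "'a small" assume t: "t \<in> bcarrier (small_bimod n k)"
    show "lift_poly n g z k (small_to_bar n k t) = poly_cochain n z (g k (small_to_bar n k t))"
      using bimod_map_closed[OF small_to_bar_map t] by (simp add: lift_poly_def zero_outside_def)
  qed
  have "restrict_poly n k (lift_poly n g z k) - component n k z \<in> ext_poly_boundaries n" for k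
  proof (cases k)
    case 0
    have "restrict_poly n k (lift_poly n g z k) = small_cochain_poly n k (poly_cochain n z)"
      unfolding lift unfolding 0
    proof (rule small_cochain_poly_cong)
      fix t :: "'a small" assume t: "t \<in> bcarrier (small_bimod n 0)"
      show "poly_cochain n z (g 0 (small_to_bar n 0 t)) = poly_cochain n z t"
        using t bimod_map_closed[OF s(1) t] bimod_map_closed[OF small_d_map bimod_map_closed[OF s(1) t]]
        by (simp add: s(2) bimod_map_add[OF P] Pd)
    qed
    then show ?thesis
      by (simp add: small_cochain_poly_poly_cochain z(1) ext_poly_boundaries_closed)
  next
    case (Suc j)
    have "restrict_poly n k (lift_poly n g z k) =
        small_cochain_poly n k (\<lambda>t. poly_cochain n z t + poly_cochain n z (s j (small_d n (Suc j) t)))"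
      unfolding lift unfolding Suc
    proof (rule small_cochain_poly_cong)
      fix t :: "'a small" assume t: "t \<in> bcarrier (small_bimod n (Suc j))"
      show "poly_cochain n z (g (Suc j) (small_to_bar n (Suc j) t)) =
          poly_cochain n z t + poly_cochain n z (s j (small_d n (Suc j) t))"
        using t bimod_map_closed[OF s(1) t] bimod_map_closed[OF small_d_map bimod_map_closed[OF s(1) t]]
          bimod_map_closed[OF s(1) bimod_map_closed[OF small_d_map t]]
        by (simp add: s(3) bimod_map_add[OF P] Pd small.carrier_closed)
    qed
    also have "\<dots> = component n k z + ext_poly_d n (small_cochain_poly n j (\<lambda>t. poly_cochain n z (s j t)))"
      unfolding small_cochain_poly_add Suc
      using small_cochain_poly_d[OF bimod_map_comp[OF s(1) P]]
      by (simp add: small_cochain_poly_poly_cochain z(1))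
    finally show ?thesis
      using small_cochain_poly_closed[OF bimod_map_comp[OF s(1) P]]
      by (simp add: ext_poly_boundaries_def)
  qed
  then have "(\<Sum>k\<in>degrees z. restrict_poly n k (lift_poly n g z k) - component n k z) \<in> ext_poly_boundaries n"
    by (rule ext_poly_boundaries_closed(6))
  then show ?thesis
    using hoch_poly_superset[OF finite_degrees lift_poly_support[OF g]] sum_components[OF z(1) finite_degrees order_refl]
    by (simp add: sum_subtractf)
qed

lemma hoch_poly_coboundary:
  assumes "F \<in> hoch_coboundaries n"
  shows "hoch_poly n F \<in> ext_poly_boundaries n"
  unfolding hoch_poly_def
proof (rule ext_poly_boundaries_closed(6))
  fix k
  have F: "F 0 = (\<lambda>_. 0)" "\<forall>k. \<exists>G\<in>hoch_cochains n k. F (Suc k) = hoch_d n k G"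
    using assms by (simp_all add: hoch_coboundaries_def flip: Suc_eq_plus1)
  show "restrict_poly n k (F k) \<in> ext_poly_boundaries n"
  proof (cases k)
    case 0
    then show ?thesis
      by (simp add: F(1) restrict_poly_dist ext_poly_boundaries_closed)
  next
    case (Suc j)
    obtain G where "G \<in> hoch_cochains n j" "F (Suc j) = hoch_d n j G"
      using F(2) by blast
    then show ?thesis
      by (simp add: Suc restrict_poly_hoch_d ext_poly_boundaries_def restrict_poly_closed)
  qed
qed

lemma hoch_coboundaryI:
  assumes F: "F \<in> carrier (hoch_cocycles n)" and "hoch_poly n F \<in> ext_poly_boundaries n"
  shows "F \<in> hoch_coboundaries n"
proof -
  obtain g where g: "homotopy_inverse n (g :: nat \<Rightarrow> 'a tens \<Rightarrow> 'a small)"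
    by (rule homotopy_inverse_exists)
  obtain w where w: "w \<in> ext_poly_carrier n" "hoch_poly n F = ext_poly_d n w"
    using assms(2) by (auto simp: ext_poly_boundaries_def)
  have "homotopic_to_id n (bar_bimod n) bar_d (\<lambda>k t. small_to_bar n k (g k t))"
    using g by (simp add: homotopy_inverse_def)
  then obtain s where s: "\<And>k. bimod_map n (bar_bimod n k) (bar_bimod n (Suc k)) (s k)"
    "\<And>t. t \<in> bcarrier (bar_bimod n 0) \<Longrightarrow> small_to_bar n 0 (g 0 t) = t + bar_d (Suc 0) (s 0 t)"
    "\<And>k t. t \<in> bcarrier (bar_bimod n (Suc k)) \<Longrightarrow> small_to_bar n (Suc k) (g (Suc k) t) =
      t + (bar_d (Suc (Suc k)) (s (Suc k) t) + s k (bar_d (Suc k) t))"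
    by (rule homotopic_to_idE) blast
  have coch: "F k \<in> hoch_cochains n k" and "hoch_d n k (F k) = (\<lambda>_. 0)" for k
    using F by (auto simp: in_hoch_cocycles)
  then have Fd: "F k (bar_d (Suc k) t) = 0" if "t \<in> bcarrier (bar_bimod n (Suc k))" for k t
    using that unfolding hoch_d_zero_iff by blast
  note Fm = hoch_cochains_map[OF coch]
  have Fh: "restrict_poly n k (F k) = (case k of 0 \<Rightarrow> 0 | Suc j \<Rightarrow> ext_poly_d n (component n j w))" for k
    using component_hoch_poly[OF F, of k] component_ext_poly_d[OF w(1)] by (cases k) (simp_all add: w(2))
  have "F 0 t = 0" for t
  proof (cases "t \<in> bcarrier (bar_bimod n 0)")
    case True
    have "F 0 (small_to_bar n 0 u) = 0" if "u \<in> bcarrier (small_bimod n 0)" for u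
      using Fh[of 0] that
      by (intro small_cochain_poly_inject[OF hoch_restrict_map[OF coch]
            exterior_bimodule.bimod_map_0[OF exterior_bimodule_ext]])
        (simp_all add: restrict_poly_def small_cochain_poly_def emb_dist)
    then have "F 0 (t + bar_d (Suc 0) (s 0 t)) = 0"
      using bimod_map_closed[OF homotopy_inverse_map[OF g] True] by (simp add: s(2)[OF True, symmetric])
    then show ?thesis
      using True bimod_map_closed[OF s(1) True] bimod_map_closed[OF bar_d_map bimod_map_closed[OF s(1) True]]
      by (simp add: bimod_map_add[OF Fm] Fd del: bcarrier_bar)
  qed (use coch[of 0] in \<open>simp add: hoch_cochains_iff\<close>)
  moreover have "\<exists>G\<in>hoch_cochains n j. F (Suc j) = hoch_d n j G" for j
  proof -
    let ?G = "\<lambda>t. poly_cochain n w (g j t) - F (Suc j) (s j t)"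
    have Gm: "bimod_map n (bar_bimod n j) (ext_bimod n) ?G"
      by (rule exterior_bimodule.bimod_map_minus[OF exterior_bimodule_ext
            bimod_map_comp[OF homotopy_inverse_map[OF g] poly_cochain_map[OF w(1)]] bimod_map_comp[OF s(1) Fm]])
    define G where "G = zero_outside (bcarrier (bar_bimod n j)) ?G"
    have G: "G \<in> hoch_cochains n j"
      unfolding G_def hoch_cochains_def by (rule bimod_map_zero_outside[OF bar.exterior_bimodule_axioms Gm])
    have Fh': "F (Suc j) (small_to_bar n (Suc j) u) = poly_cochain n w (small_d n (Suc j) u)"
      if "u \<in> bcarrier (small_bimod n (Suc j))" for u
    proof (rule small_cochain_poly_inject[OF hoch_restrict_map[OF coch]
          bimod_map_comp[OF small_d_map poly_cochain_map[OF w(1)]] _ that])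
      show "small_cochain_poly n (Suc j) (\<lambda>t. F (Suc j) (small_to_bar n (Suc j) t)) =
          small_cochain_poly n (Suc j) (\<lambda>t. poly_cochain n w (small_d n (Suc j) t))"
        using Fh[of "Suc j"] small_cochain_poly_d[OF poly_cochain_map[OF w(1)], of j]
        by (simp add: restrict_poly_def small_cochain_poly_poly_cochain[OF w(1)])
    qed
    have "F (Suc j) t = hoch_d n j G t" for t
    proof (cases "t \<in> bcarrier (bar_bimod n (Suc j))")
      case True
      note closed = bimod_map_closed[OF s(1) True] bimod_map_closed[OF bar_d_map bimod_map_closed[OF s(1) True]]
        bimod_map_closed[OF bar_d_map True] bimod_map_closed[OF s(1) bimod_map_closed[OF bar_d_map True]]
      have "F (Suc j) (small_to_bar n (Suc j) (g (Suc j) t)) = F (Suc j) t + F (Suc j) (s j (bar_d (Suc j) t))"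
        using True closed
        by (simp add: s(3) bimod_map_add[OF Fm] Fd bar.carrier_closed del: bcarrier_bar)
      moreover have "F (Suc j) (small_to_bar n (Suc j) (g (Suc j) t)) = poly_cochain n w (g j (bar_d (Suc j) t))"
        using Fh'[OF bimod_map_closed[OF homotopy_inverse_map[OF g] True]] homotopy_inverse_chain[OF g True] by simp
      ultimately show ?thesis
        using True closed(3) by (simp add: hoch_d_eq G_def zero_outside_def numeral_3_eq_3 eq_diff_eq)
    qed (use coch[of "Suc j"] in \<open>simp add: hoch_cochains_iff hoch_d_eq numeral_3_eq_3\<close>)
    then show ?thesis
      using G by blast
  qed
  ultimately show ?thesis
    using F by (simp add: hoch_coboundaries_def fun_eq_iff flip: Suc_eq_plus1)
qed

section \<open>The Hochschild cohomology algebra\<close>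

definition hoch_fiber :: "nat \<Rightarrow> 'k::field ext_poly \<Rightarrow> (nat \<Rightarrow> 'k cochain) set"
  where "hoch_fiber n u = {F \<in> carrier (hoch_cocycles n). hoch_poly n F - u \<in> ext_poly_boundaries n}"

lemma hoch_coboundaries_iff:
  "F \<in> hoch_coboundaries n \<longleftrightarrow> F \<in> carrier (hoch_cocycles n) \<and> hoch_poly n F \<in> ext_poly_boundaries n"
proof
  assume F: "F \<in> hoch_coboundaries n"
  then show "F \<in> carrier (hoch_cocycles n) \<and> hoch_poly n F \<in> ext_poly_boundaries n"
    using hoch_poly_coboundary[OF F] by (simp add: hoch_coboundaries_def)
qed (use hoch_coboundaryI in blast)

lemma in_hoch_class: "X \<in> hoch_class n F \<longleftrightarrow> (\<exists>I\<in>hoch_coboundaries n. X = (\<lambda>k t. I k t + F k t))"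
  by (simp add: hoch_class_def a_r_coset_def' hoch_cocycles_add)

lemma hoch_class_eq_fiber:
  assumes F: "F \<in> hoch_fiber n u"
  shows "hoch_class n F = hoch_fiber n u"
proof (intro Set.set_eqI iffI)
  fix X assume "X \<in> hoch_class n F"
  then obtain I where I: "I \<in> hoch_coboundaries n" "X = (\<lambda>k t. I k t + F k t)"
    by (auto simp: in_hoch_class)
  moreover have "hoch_poly n I + (hoch_poly n F - u) \<in> ext_poly_boundaries n"
    using I(1) F by (intro ext_poly_boundaries_closed(2)) (auto simp: hoch_fiber_def hoch_coboundaries_iff)
  ultimately show "X \<in> hoch_fiber n u"
    using F by (simp add: hoch_fiber_def hoch_coboundaries_iff hoch_poly_add hoch_cocycles_closed add_diff_eq)
next
  fix X assume X: "X \<in> hoch_fiber n u"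
  have "(hoch_poly n X - u) - (hoch_poly n F - u) \<in> ext_poly_boundaries n"
    by (rule ext_poly_boundaries_closed(5)) (use X F in \<open>auto simp: hoch_fiber_def\<close>)
  then have "(\<lambda>k t. X k t - F k t) \<in> hoch_coboundaries n"
    using X F by (simp add: hoch_fiber_def hoch_coboundaries_iff hoch_poly_add hoch_cocycles_closed)
  then show "X \<in> hoch_class n F"
    unfolding in_hoch_class by (intro bexI[of _ "\<lambda>k t. X k t - F k t"]) simp_all
qed

lemma lift_poly_in_fiber:
  assumes "homotopy_inverse n g" "z \<in> ext_poly_carrier n" "ext_poly_d n z = 0"
  shows "lift_poly n g z \<in> hoch_fiber n z"
  using assms by (simp add: hoch_fiber_def lift_poly_cocycle hoch_poly_lift_poly)

lemma HH_simps:
  "carrier (HH n) = hoch_class n ` carrier (hoch_cocycles n)"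
  "X \<otimes>\<^bsub>HH n\<^esub> Y = (\<Union>F\<in>X. \<Union>G\<in>Y. hoch_class n (F \<otimes>\<^bsub>hoch_cocycles n\<^esub> G))"
  "X \<oplus>\<^bsub>HH n\<^esub> Y = (\<Union>F\<in>X. \<Union>G\<in>Y. {\<lambda>k t. F k t + G k t})"
  "\<one>\<^bsub>HH n\<^esub> = hoch_class n \<one>\<^bsub>hoch_cocycles n\<^esub>"
  "c \<odot>\<^bsub>HH n\<^esub> X = (\<Union>F\<in>X. hoch_class n (\<lambda>k t. kscale c (F k t)))"
  by (auto simp: HH_def ring.defs module.defs FactRing_def A_RCOSETS_def' rcoset_mult_def
      set_add_def' hoch_class_def hoch_cocycles_add)

lemma hoch_fiber_alg_iso:
  fixes A :: "('k::field, 'k ext_poly) module"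
  assumes subspace: "kmod.subspace (carrier A)" and sub: "carrier A \<subseteq> ext_poly_carrier n"
    and cycle: "\<And>v. v \<in> carrier A \<Longrightarrow> ext_poly_d n v = 0"
    and inj: "\<And>v. v \<in> carrier A \<Longrightarrow> v \<in> ext_poly_boundaries n \<Longrightarrow> v = 0"
    and surj: "\<And>z. z \<in> ext_poly_carrier n \<Longrightarrow> ext_poly_d n z = 0 \<Longrightarrow>
      \<exists>v\<in>carrier A. z - v \<in> ext_poly_boundaries n"
    and mult: "\<And>u v. u \<in> carrier A \<Longrightarrow> v \<in> carrier A \<Longrightarrow>
      u \<otimes>\<^bsub>A\<^esub> v \<in> carrier A \<and> ext_poly_mult u v - u \<otimes>\<^bsub>A\<^esub> v \<in> ext_poly_boundaries n"
    and one: "\<one>\<^bsub>A\<^esub> = gen ({}, {#})"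
    and add: "\<And>u v. u \<oplus>\<^bsub>A\<^esub> v = u + v" and smult: "\<And>c v. c \<odot>\<^bsub>A\<^esub> v = kscale c v"
  shows "hoch_fiber n \<in> alg_iso A (HH n)"
proof -
  have ex: "\<exists>F. F \<in> hoch_fiber n v" if "v \<in> carrier A" for v
  proof -
    obtain g where "homotopy_inverse n (g :: nat \<Rightarrow> 'k tens \<Rightarrow> 'k small)"
      by (rule homotopy_inverse_exists)
    then show ?thesis
      using lift_poly_in_fiber cycle[OF that] sub that by blast
  qed
  have mem: "F \<in> carrier (hoch_cocycles n) \<and> hoch_poly n F \<in> ext_poly_carrier n \<and>
      ext_poly_d n (hoch_poly n F) = 0 \<and> hoch_poly n F - v \<in> ext_poly_boundaries n"
    if "F \<in> hoch_fiber n v" for F v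
    using that hoch_poly_closed[of F n] hoch_poly_cycle[of F n] by (simp add: hoch_fiber_def)
  have prod: "F \<otimes>\<^bsub>hoch_cocycles n\<^esub> G \<in> hoch_fiber n (u \<otimes>\<^bsub>A\<^esub> v)"
    if u: "u \<in> carrier A" and v: "v \<in> carrier A" and F: "F \<in> hoch_fiber n u" and G: "G \<in> hoch_fiber n v" for u v F G
  proof -
    note mF = mem[OF F] and mG = mem[OF G]
    have "ext_poly_mult (hoch_poly n F - u) (hoch_poly n G) + ext_poly_mult u (hoch_poly n G - v)
        + (ext_poly_mult u v - u \<otimes>\<^bsub>A\<^esub> v) \<in> ext_poly_boundaries n"
      using mF mG mult[OF u v] sub u cycle[OF u]
      by (intro ext_poly_boundaries_closed(2) ext_poly_boundaries_mult_right ext_poly_boundaries_mult_left) auto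
    then show ?thesis
      using mF mG by (simp add: hoch_fiber_def hoch_cocycles_mult_closed ext_poly_mult_dist)
  qed
  have sum: "(\<lambda>k t. F k t + G k t) \<in> hoch_fiber n (u + v)"
    if F: "F \<in> hoch_fiber n u" and G: "G \<in> hoch_fiber n v" for u v F G
  proof -
    have "(hoch_poly n F - u) + (hoch_poly n G - v) \<in> ext_poly_boundaries n"
      using mem[OF F] mem[OF G] by (intro ext_poly_boundaries_closed(2)) auto
    then show ?thesis
      using mem[OF F] mem[OF G] by (simp add: hoch_fiber_def hoch_cocycles_closed hoch_poly_add algebra_simps)
  qed
  have scale: "(\<lambda>k t. kscale c (F k t)) \<in> hoch_fiber n (kscale c u)" if F: "F \<in> hoch_fiber n u" for u F c
  proof -
    have "kscale c (hoch_poly n F - u) \<in> ext_poly_boundaries n"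
      using mem[OF F] by (intro ext_poly_boundaries_closed(3)) auto
    then show ?thesis
      using mem[OF F] hoch_cocycles_closed(3)[of F n F c]
      by (simp add: hoch_fiber_def hoch_poly_scale kmod.scale_right_diff_distrib)
  qed
  have fiber_carrier: "hoch_fiber n v \<in> carrier (HH n)" if v: "v \<in> carrier A" for v
  proof -
    obtain F where F: "F \<in> hoch_fiber n v"
      using ex[OF v] by blast
    then have "hoch_fiber n v = hoch_class n F"
      by (rule hoch_class_eq_fiber[symmetric])
    then show ?thesis
      using mem[OF F] by (auto simp: HH_simps)
  qed
  have hom: "hoch_fiber n \<in> ring_hom A (HH n)"
  proof (rule ring_hom_memI)
    fix u v assume u: "u \<in> carrier A" and v: "v \<in> carrier A"
    obtain F G where FG: "F \<in> hoch_fiber n u" "G \<in> hoch_fiber n v"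
      using ex u v by blast
    show "hoch_fiber n (u \<otimes>\<^bsub>A\<^esub> v) = hoch_fiber n u \<otimes>\<^bsub>HH n\<^esub> hoch_fiber n v"
      using hoch_class_eq_fiber[OF prod[OF u v]] FG unfolding HH_simps by blast
    show "hoch_fiber n (u \<oplus>\<^bsub>A\<^esub> v) = hoch_fiber n u \<oplus>\<^bsub>HH n\<^esub> hoch_fiber n v"
    proof
      show "hoch_fiber n (u \<oplus>\<^bsub>A\<^esub> v) \<subseteq> hoch_fiber n u \<oplus>\<^bsub>HH n\<^esub> hoch_fiber n v"
      proof
        fix X assume X: "X \<in> hoch_fiber n (u \<oplus>\<^bsub>A\<^esub> v)"
        have "(hoch_poly n X - (u + v)) - (hoch_poly n F - u) \<in> ext_poly_boundaries n"
          by (rule ext_poly_boundaries_closed(5)) (use mem[OF X] mem[OF FG(1)] in \<open>auto simp: add\<close>)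
        then have "(\<lambda>k t. X k t - F k t) \<in> hoch_fiber n v"
          using mem[OF X] mem[OF FG(1)]
          by (simp add: hoch_fiber_def hoch_cocycles_closed hoch_poly_add algebra_simps)
        then show "X \<in> hoch_fiber n u \<oplus>\<^bsub>HH n\<^esub> hoch_fiber n v"
          unfolding HH_simps using FG(1) by (intro UN_I) auto
      qed
      show "hoch_fiber n u \<oplus>\<^bsub>HH n\<^esub> hoch_fiber n v \<subseteq> hoch_fiber n (u \<oplus>\<^bsub>A\<^esub> v)"
        unfolding HH_simps add using sum by blast
    qed
  next
    have "\<one>\<^bsub>hoch_cocycles n\<^esub> \<in> hoch_fiber n (\<one>\<^bsub>A\<^esub>)"
      using hoch_cocycles_one_closed[of n, where 'k = 'k]
      by (simp add: hoch_fiber_def one ext_poly_boundaries_closed)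
    then show "hoch_fiber n \<one>\<^bsub>A\<^esub> = \<one>\<^bsub>HH n\<^esub>"
      unfolding HH_simps by (rule hoch_class_eq_fiber[symmetric])
  qed (rule fiber_carrier)
  have "inj_on (hoch_fiber n) (carrier A)"
  proof (rule inj_onI)
    fix u v assume u: "u \<in> carrier A" and v: "v \<in> carrier A" and eq: "hoch_fiber n u = hoch_fiber n v"
    obtain F where F: "F \<in> hoch_fiber n u"
      using ex[OF u] by blast
    have "(hoch_poly n F - v) - (hoch_poly n F - u) \<in> ext_poly_boundaries n"
      by (rule ext_poly_boundaries_closed(5)) (use mem[of F u] mem[of F v] eq F in auto)
    then have "u - v \<in> ext_poly_boundaries n"
      by simp
    then show "u = v"
      using inj[of "u - v"] kmod.subspace_diff[OF subspace u v] by simp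
  qed
  moreover have "carrier (HH n) \<subseteq> hoch_fiber n ` carrier A"
  proof
    fix X assume "X \<in> carrier (HH n :: ('k, (nat \<Rightarrow> 'k cochain) set) module)"
    then obtain F where F: "F \<in> carrier (hoch_cocycles n)" "X = hoch_class n F"
      by (auto simp: HH_simps)
    then obtain v where v: "v \<in> carrier A" "hoch_poly n F - v \<in> ext_poly_boundaries n"
      using surj[OF hoch_poly_closed hoch_poly_cycle] by blast
    then have "X = hoch_fiber n v"
      using F hoch_class_eq_fiber[of F n v] by (simp add: hoch_fiber_def)
    then show "X \<in> hoch_fiber n ` carrier A"
      using v(1) by blast
  qed
  ultimately have "bij_betw (hoch_fiber n) (carrier A) (carrier (HH n))"
    using fiber_carrier by (auto simp: bij_betw_def)
  moreover have "hoch_fiber n (c \<odot>\<^bsub>A\<^esub> v) = c \<odot>\<^bsub>HH n\<^esub> hoch_fiber n v" if v: "v \<in> carrier A" for c v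
    using ex[OF v] hoch_class_eq_fiber[OF scale] unfolding HH_simps smult by blast
  ultimately show ?thesis
    using hom by (simp add: alg_iso_def ring_iso_def)
qed

lemma phi_class_eq_fiber:
  assumes g: "homotopy_inverse n (g :: nat \<Rightarrow> 'k::field tens \<Rightarrow> 'k small)"
    and "\<sigma> \<subseteq> {1..n}" "set_mset \<tau> \<subseteq> {1..n}" "ext_poly_d n (gen (\<sigma>, \<tau>) :: 'k ext_poly) = 0"
  shows "phi_class n g \<tau> \<sigma> = hoch_fiber n (gen (\<sigma>, \<tau>))"
proof -
  have "small_phi n \<tau> \<sigma> = poly_cochain n (gen (\<sigma>, \<tau>) :: 'k ext_poly)"
    unfolding small_phi_def poly_cochain_def by (intro arg_cong2[where f = small_extend]) auto
  moreover have "degrees (gen (\<sigma>, \<tau>) :: 'k ext_poly) = {size \<tau>}"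
    by (simp add: degrees_def)
  moreover have "lift_poly n g (gen (\<sigma>, \<tau>)) k = (\<lambda>_. 0)" if "k \<noteq> size \<tau>" for k
    using lift_poly_support[OF g, of "gen (\<sigma>, \<tau>)"] that calculation(2) by blast
  ultimately have "in_degree (size \<tau>) (zero_outside (tens_pow n (size \<tau> + 2)) (\<lambda>t. small_phi n \<tau> \<sigma> (g (size \<tau>) t)))
      = lift_poly n g (gen (\<sigma>, \<tau>))"
    by (intro ext[of "in_degree _ _"]) (simp add: in_degree_def, simp add: lift_poly_def)
  then show ?thesis
    using assms hoch_class_eq_fiber[OF lift_poly_in_fiber[OF g]]
    by (simp add: phi_class_def gen_in_ext_poly_index)
qed

section \<open>The cohomology of the exterior-polynomial algebra\<close>

definition koszul_d :: "nat \<Rightarrow> 'k::field ext_poly \<Rightarrow> 'k ext_poly"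
  where "koszul_d n = klin (\<lambda>(\<sigma>, \<tau>). \<Sum>i\<in>{1..n}. kscale (ext_sign {i} \<sigma>) (gen (insert i \<sigma>, add_mset i \<tau>)))"

lemma koszul_d_gen:
  "koszul_d n (gen (\<sigma>, \<tau>)) = (\<Sum>i\<in>{1..n}. kscale (ext_sign {i} \<sigma>) (gen (insert i \<sigma>, add_mset i \<tau>)))"
  by (simp add: koszul_d_def)

lemma klinear_koszul_d: "klinear (koszul_d n)"
  unfolding koszul_d_def by (rule klinear_klin)

lemma ext_poly_d_gen:
  assumes "finite \<sigma>"
  shows "ext_poly_d n (gen (\<sigma>, \<tau>)) = (if even (card \<sigma> + size \<tau>) then 0 else kscale 2 (koszul_d n (gen (\<sigma>, \<tau>)) :: 'k::field ext_poly))"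
proof -
  have "ext_poly_d n (gen (\<sigma>, \<tau>)) = (\<Sum>i\<in>{1..n}. kscale (ext_sign {i} \<sigma>) (gen (insert i \<sigma>, add_mset i \<tau>))
      - kscale ((- 1) ^ (card \<sigma> + size \<tau>) * ext_sign {i} \<sigma>) (gen (insert i \<sigma>, add_mset i \<tau>)) :: 'k ext_poly)"
    using ext_poly_d_emb[of n \<tau> "gen \<sigma> :: 'k ext"]
    by (simp add: emb_dist ext_sign_commute[OF assms] power_add mult_ac)
  also have "\<dots> = (if even (card \<sigma> + size \<tau>) then 0 else kscale 2 (koszul_d n (gen (\<sigma>, \<tau>))))"
  proof (cases "even (card \<sigma> + size \<tau>)")
    case False
    have "kscale a x + kscale a x = kscale 2 (kscale a x)" for a and x :: "'k ext_poly"
      by (simp flip: kmod.scale_left_distrib)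
    then show ?thesis
      using False by (simp add: koszul_d_gen kmod.scale_sum_right del: kmod.scale_scale)
  qed simp
  finally show ?thesis .
qed

lemma ext_poly_d_char_2:
  assumes "CHAR('k::field) = 2" "z \<in> (ext_poly_carrier n :: 'k ext_poly set)"
  shows "ext_poly_d n z = 0"
proof (rule klinear_eqI[OF klinear_ext_poly_d klinear_const_0 assms(2)])
  fix s assume s: "s \<in> ext_poly_index n"
  have "(2 :: 'k) = 0"
    using of_nat_CHAR[where 'a = 'k] assms(1) by simp
  then show "ext_poly_d n (gen s :: 'k ext_poly) = 0"
    using s finite_ext_index by (cases s) (auto simp: gen_in_ext_poly_index ext_poly_d_gen)
qed

text \<open>The least index \<open>i\<close> at which \<open>(\<sigma>, \<tau>)\<close> differs from the surviving basis element
  \<open>([n], {#})\<close> determines the cell with which \<open>(\<sigma>, \<tau>)\<close> is matched.\<close>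

definition defect_set :: "nat \<Rightarrow> nat set \<Rightarrow> nat multiset \<Rightarrow> nat set"
  where "defect_set n \<sigma> \<tau> = {i \<in> {1..n}. i \<notin> \<sigma> \<or> i \<in># \<tau>}"

definition matching_homotopy :: "nat \<Rightarrow> 'k::field ext_poly \<Rightarrow> 'k ext_poly"
  where "matching_homotopy n = klin (\<lambda>(\<sigma>, \<tau>).
     if defect_set n \<sigma> \<tau> \<noteq> {} \<and> Min (defect_set n \<sigma> \<tau>) \<in> \<sigma>
     then kscale (ext_sign {Min (defect_set n \<sigma> \<tau>)} (\<sigma> - {Min (defect_set n \<sigma> \<tau>)}))
       (gen (\<sigma> - {Min (defect_set n \<sigma> \<tau>)}, \<tau> - {#Min (defect_set n \<sigma> \<tau>)#}))
     else 0)"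

lemma klinear_matching_homotopy: "klinear (matching_homotopy n)"
  unfolding matching_homotopy_def by (rule klinear_klin)

lemmas koszul_dist = klinear_dist[OF klinear_koszul_d] klinear_dist[OF klinear_matching_homotopy]

lemma matching_homotopy_gen:
  assumes "i \<in> defect_set n \<sigma> \<tau>" "\<And>j. j \<in> defect_set n \<sigma> \<tau> \<Longrightarrow> i \<le> j"
  shows "matching_homotopy n (gen (\<sigma>, \<tau>)) =
    (if i \<in> \<sigma> then kscale (ext_sign {i} (\<sigma> - {i})) (gen (\<sigma> - {i}, \<tau> - {#i#})) else 0)"
proof -
  have "finite (defect_set n \<sigma> \<tau>)"
    by (simp add: defect_set_def)
  then have "Min (defect_set n \<sigma> \<tau>) = i"
    using assms by (intro Min_eqI) auto
  then show ?thesis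
    using assms(1) by (auto simp: matching_homotopy_def)
qed

lemma matching_homotopy_top: "matching_homotopy n (gen ({1..n}, {#})) = 0"
proof -
  have "defect_set n {1..n} {#} = {}"
    unfolding defect_set_def by auto
  then show ?thesis
    by (simp add: matching_homotopy_def)
qed

lemma koszul_d_top: "koszul_d n (gen ({1..n}, {#})) = 0"
  by (simp add: koszul_d_gen ext_sign_def)

lemma koszul_matching:
  assumes \<sigma>: "\<sigma> \<subseteq> {1..n}" and \<tau>: "set_mset \<tau> \<subseteq> {1..n}" and ne: "(\<sigma>, \<tau>) \<noteq> ({1..n}, {#})"
  shows "koszul_d n (matching_homotopy n (gen (\<sigma>, \<tau>))) + matching_homotopy n (koszul_d n (gen (\<sigma>, \<tau>))) =
    (gen (\<sigma>, \<tau>) :: 'k::field ext_poly)"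
proof -
  have "defect_set n \<sigma> \<tau> \<noteq> {}"
  proof
    assume "defect_set n \<sigma> \<tau> = {}"
    then have *: "i \<in> \<sigma> \<and> i \<notin># \<tau>" if "i \<in> {1..n}" for i
      using that unfolding defect_set_def by blast
    then have "\<sigma> = {1..n}" "set_mset \<tau> = {}"
      using \<sigma> \<tau> by blast+
    then show False
      using ne by simp
  qed
  moreover have fin: "finite (defect_set n \<sigma> \<tau>)"
    by (simp add: defect_set_def)
  moreover define i where "i = Min (defect_set n \<sigma> \<tau>)"
  ultimately have i: "i \<in> defect_set n \<sigma> \<tau>" "\<And>j. j \<in> defect_set n \<sigma> \<tau> \<Longrightarrow> i \<le> j"
    using Min_in by auto
  then have in1: "i \<in> {1..n}"
    by (simp add: defect_set_def)
  have below: "i \<le> j" if "j \<in> {1..n}" "j \<notin> \<sigma>" for j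
    using that i(2) by (simp add: defect_set_def)
  have hom: "matching_homotopy n (gen (insert j \<sigma>, add_mset j \<tau>)) =
      (if i \<in> insert j \<sigma> then kscale (ext_sign {i} (insert j \<sigma> - {i})) (gen (insert j \<sigma> - {i}, add_mset j \<tau> - {#i#})) else 0 :: 'k ext_poly)"
    if j: "j \<in> {1..n}" "j \<notin> \<sigma>" for j
  proof (rule matching_homotopy_gen)
    show "i \<in> defect_set n (insert j \<sigma>) (add_mset j \<tau>)"
      using i(1) by (auto simp: defect_set_def)
    fix l assume "l \<in> defect_set n (insert j \<sigma>) (add_mset j \<tau>)"
    then show "i \<le> l"
      using i(2)[of l] below[OF j] by (cases "l = j") (auto simp: defect_set_def)
  qed
  let ?summand = "\<lambda>j. kscale (ext_sign {j} \<sigma>) (matching_homotopy n (gen (insert j \<sigma>, add_mset j \<tau>))) :: 'k ext_poly"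
  have hd: "matching_homotopy n (koszul_d n (gen (\<sigma>, \<tau>))) = (\<Sum>j\<in>{1..n}. ?summand j)"
    by (simp add: koszul_d_gen koszul_dist)
  have split: "sum f {1..n} = f i + sum f ({1..n} - {i})" for f :: "nat \<Rightarrow> 'k ext_poly"
    using in1 by (intro sum.remove) auto
  have mem0: "?summand j = 0" if "j \<in> \<sigma>" for j
    using that by (simp add: ext_sign_def)
  show ?thesis
  proof (cases "i \<in> \<sigma>")
    case False
    have "?summand i = gen (\<sigma>, \<tau>)"
      using False hom[OF in1] by (simp add: ext_sign_square)
    moreover have "(\<Sum>j\<in>{1..n} - {i}. ?summand j) = 0"
    proof (rule sum.neutral, rule ballI)
      fix j assume "j \<in> {1..n} - {i}"
      then show "?summand j = 0"
        using False hom[of j] mem0[of j] by (cases "j \<in> \<sigma>") auto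
    qed
    moreover have "matching_homotopy n (gen (\<sigma>, \<tau>)) = (0 :: 'k ext_poly)"
      using False matching_homotopy_gen[of i n \<sigma> \<tau>] i by auto
    ultimately show ?thesis
      by (simp only: hd split koszul_dist) simp
  next
    case True
    define \<rho> where "\<rho> = \<sigma> - {i}"
    have \<rho>: "\<sigma> = insert i \<rho>" "i \<notin> \<rho>" "finite \<rho>"
      using True finite_ext_index[OF \<sigma>] by (auto simp: \<rho>_def)
    have i\<tau>: "i \<in># \<tau>"
      using True i(1) by (simp add: defect_set_def)
    have "matching_homotopy n (gen (\<sigma>, \<tau>)) = (kscale (ext_sign {i} \<rho>) (gen (\<rho>, \<tau> - {#i#})) :: 'k ext_poly)"
      using True matching_homotopy_gen[of i n \<sigma> \<tau>] i by (auto simp: \<rho>_def)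
    then have "koszul_d n (matching_homotopy n (gen (\<sigma>, \<tau>))) = (\<Sum>j\<in>{1..n}.
        kscale (ext_sign {i} \<rho> * ext_sign {j} \<rho>) (gen (insert j \<rho>, add_mset j (\<tau> - {#i#}))) :: 'k ext_poly)"
      by (simp add: koszul_dist koszul_d_gen kmod.scale_sum_right)
    also have "\<dots> = gen (\<sigma>, \<tau>) + (\<Sum>j\<in>{1..n} - {i}.
        kscale (ext_sign {i} \<rho> * ext_sign {j} \<rho>) (gen (insert j \<rho>, add_mset j (\<tau> - {#i#}))))"
      unfolding split using \<rho> i\<tau> by (simp add: ext_sign_square)
    also have "(\<Sum>j\<in>{1..n} - {i}. kscale (ext_sign {i} \<rho> * ext_sign {j} \<rho>) (gen (insert j \<rho>, add_mset j (\<tau> - {#i#})))) =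
        - (\<Sum>j\<in>{1..n} - {i}. ?summand j)"
      unfolding sum_negf[symmetric]
    proof (rule sum.cong[OF refl])
      fix j assume j: "j \<in> {1..n} - {i}"
      show "kscale (ext_sign {i} \<rho> * ext_sign {j} \<rho>) (gen (insert j \<rho>, add_mset j (\<tau> - {#i#}))) = - ?summand j"
      proof (cases "j \<in> \<sigma>")
        case True
        then show ?thesis
          using j \<rho>(1) by (simp add: ext_sign_def)
      next
        case False
        then have j\<rho>: "j \<notin> \<rho>" "j \<noteq> i"
          using \<rho>(1) by auto
        have "ext_sign {j} (insert i \<rho>) * ext_sign {i} (insert j \<rho>) =
            (ext_sign {j} (insert i \<rho>) * ext_sign {i} \<rho>) * (ext_sign {i} \<rho> * ext_sign {i} (insert j \<rho>) :: 'k)"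
          using ext_sign_square[of "{i}" \<rho>, where 'k = 'k] \<rho>(2) by (simp add: mult_ac)
        also have "\<dots> = - (ext_sign {i} \<rho> * ext_sign {j} \<rho>) * (ext_sign {i} (insert j \<rho>) * ext_sign {i} (insert j \<rho>))"
          using ext_sign_insert_anticommute[of \<rho> i j, where 'k = 'k] \<rho> j\<rho> by (simp add: mult_ac)
        also have "\<dots> = - (ext_sign {i} \<rho> * ext_sign {j} \<rho>)"
          using ext_sign_square[of "{i}" "insert j \<rho>", where 'k = 'k] \<rho>(2) j\<rho> by simp
        finally have sgn: "ext_sign {j} \<sigma> * ext_sign {i} (insert j \<rho>) = (- (ext_sign {i} \<rho> * ext_sign {j} \<rho>) :: 'k)"
          by (simp only: \<rho>(1))
        have "insert j \<sigma> - {i} = insert j \<rho>" "add_mset j \<tau> - {#i#} = add_mset j (\<tau> - {#i#})"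
          using \<rho> j\<rho> by auto
        then have "?summand j = kscale (ext_sign {j} \<sigma> * ext_sign {i} (insert j \<rho>)) (gen (insert j \<rho>, add_mset j (\<tau> - {#i#})))"
          using hom[of j] j False \<open>i \<in> \<sigma>\<close> by simp
        then show ?thesis
          unfolding sgn by simp
      qed
    qed
    finally show ?thesis
      unfolding hd split by (simp add: mem0[OF True])
  qed
qed

lemma in_parity_index:
  "(\<sigma>, \<tau>) \<in> parity_index n \<longleftrightarrow>
    (\<sigma>, \<tau>) \<in> ext_poly_index n \<and> (even (card \<sigma> + size \<tau>) \<or> (\<sigma>, \<tau>) = ({1..n}, {#}))"
  by (auto simp: parity_index_def gen_in_ext_poly_index minus_one_power_iff)

lemma parity_span_eq: "parity_span n = (free_mod (parity_index n) :: 'k::field ext_poly set)"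
proof
  show "parity_span n \<subseteq> (free_mod (parity_index n) :: 'k ext_poly set)"
    unfolding parity_span_def by (rule kmod.span_minimal[OF _ subspace_free_mod]) auto
  show "free_mod (parity_index n) \<subseteq> (parity_span n :: 'k ext_poly set)"
  proof
    fix t :: "'k ext_poly" assume "t \<in> free_mod (parity_index n)"
    then have "klin gen t \<in> kmod.span (gen ` parity_index n)"
      by (rule klin_in_subspace[OF kmod.subspace_span]) (auto intro: kmod.span_base)
    then show "t \<in> parity_span n"
      by (simp add: parity_span_def)
  qed
qed

lemma parity_span_subset: "(parity_span n :: 'k::field ext_poly set) \<subseteq> ext_poly_carrier n"
  unfolding parity_span_eq by (rule free_mod_mono) (auto simp: in_parity_index)

lemma parity_proj_gen: "parity_proj n (gen s) = (if s \<in> parity_index n then gen s else 0)"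
  by (simp add: parity_proj_def)

lemma klinear_parity_proj: "klinear (parity_proj n)"
  unfolding parity_proj_def by (rule klinear_klin)

lemmas parity_proj_dist = klinear_dist[OF klinear_parity_proj]

lemma parity_proj_in_span: "parity_proj n z \<in> parity_span n"
  unfolding parity_span_eq
  by (rule klinear_in_free_mod[OF klinear_parity_proj free_mod_UNIV]) (simp add: parity_proj_gen)

lemma parity_proj_id: "z \<in> parity_span n \<Longrightarrow> parity_proj n z = z"
  unfolding parity_span_eq
  by (rule klinear_eqI[OF klinear_parity_proj klinear_id, of z "parity_index n"]) (auto simp: parity_proj_gen)

lemma ext_poly_d_parity_span: "v \<in> parity_span n \<Longrightarrow> ext_poly_d n v = 0"
  unfolding parity_span_eq
proof (rule klinear_eqI[OF klinear_ext_poly_d klinear_const_0])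
  fix s assume s: "s \<in> parity_index n"
  then show "ext_poly_d n (gen s) = 0"
    by (cases s) (auto simp: in_parity_index gen_in_ext_poly_index ext_poly_d_gen finite_ext_index koszul_d_top)
qed

lemma parity_proj_ext_poly_d:
  assumes "z \<in> (ext_poly_carrier n :: 'k::field ext_poly set)"
  shows "parity_proj n (ext_poly_d n z) = 0"
proof (rule klinear_eqI[OF klinear_comp[OF klinear_parity_proj klinear_ext_poly_d] klinear_const_0 assms])
  fix s assume "s \<in> ext_poly_index n"
  then obtain \<sigma> \<tau> where s: "s = (\<sigma>, \<tau>)" "finite \<sigma>"
    using finite_ext_index by (cases s) (auto simp: gen_in_ext_poly_index)
  show "parity_proj n (ext_poly_d n (gen s)) = (0 :: 'k ext_poly)"
  proof (cases "even (card \<sigma> + size \<tau>)")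
    case False
    have "kscale (ext_sign {i} \<sigma>) (parity_proj n (gen (insert i \<sigma>, add_mset i \<tau>))) = (0 :: 'k ext_poly)" for i
      using False s(2) by (cases "i \<in> \<sigma>") (simp_all add: ext_sign_def parity_proj_gen in_parity_index)
    then have "parity_proj n (koszul_d n (gen s)) = (0 :: 'k ext_poly)"
      unfolding s(1) koszul_d_gen parity_proj_dist by (intro sum.neutral ballI)
    then show ?thesis
      using s False by (simp add: ext_poly_d_gen parity_proj_dist)
  qed (simp add: s ext_poly_d_gen parity_proj_dist)
qed

lemma matching_homotopy_cases:
  assumes "(\<sigma>, \<tau>) \<in> ext_poly_index n"
  obtains "matching_homotopy n (gen (\<sigma>, \<tau>)) = (0 :: 'k::field ext_poly)"
  | \<rho> \<upsilon> c where "matching_homotopy n (gen (\<sigma>, \<tau>)) = (kscale c (gen (\<rho>, \<upsilon>)) :: 'k ext_poly)"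
    "(\<rho>, \<upsilon>) \<in> ext_poly_index n" "even (card \<rho> + size \<upsilon>) \<longleftrightarrow> even (card \<sigma> + size \<tau>)"
proof (cases "defect_set n \<sigma> \<tau> \<noteq> {} \<and> Min (defect_set n \<sigma> \<tau>) \<in> \<sigma>")
  case False
  then show ?thesis
    by (intro that(1)) (auto simp: matching_homotopy_def)
next
  case True
  define i where "i = Min (defect_set n \<sigma> \<tau>)"
  have "finite (defect_set n \<sigma> \<tau>)"
    by (simp add: defect_set_def)
  then have "i \<in> defect_set n \<sigma> \<tau>"
    unfolding i_def using True by (intro Min_in) auto
  then have i: "i \<in> \<sigma>" "i \<in># \<tau>"
    using True by (auto simp: defect_set_def i_def)
  have fin: "finite \<sigma>"
    using assms finite_ext_index[of \<sigma> n] by (simp add: gen_in_ext_poly_index)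
  show ?thesis
  proof (rule that(2))
    show "matching_homotopy n (gen (\<sigma>, \<tau>)) =
        (kscale (ext_sign {i} (\<sigma> - {i})) (gen (\<sigma> - {i}, \<tau> - {#i#})) :: 'k ext_poly)"
      using True by (simp add: matching_homotopy_def i_def)
    show "(\<sigma> - {i}, \<tau> - {#i#}) \<in> ext_poly_index n"
      using assms by (auto simp: gen_in_ext_poly_index dest: in_diffD)
    have "card \<sigma> = Suc (card (\<sigma> - {i}))" "size \<tau> = Suc (size (\<tau> - {#i#}))"
      using card_Suc_Diff1[OF fin i(1)] size_Suc_Diff1[OF i(2)] by simp_all
    then show "even (card (\<sigma> - {i}) + size (\<tau> - {#i#})) \<longleftrightarrow> even (card \<sigma> + size \<tau>)"
      by simp
  qed
qed

lemma matching_homotopy_closed: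
  assumes "z \<in> (ext_poly_carrier n :: 'k::field ext_poly set)"
  shows "matching_homotopy n z \<in> ext_poly_carrier n"
proof (rule klinear_in_free_mod[OF klinear_matching_homotopy assms])
  fix s assume s: "s \<in> ext_poly_index n"
  obtain \<sigma> \<tau> where st: "s = (\<sigma>, \<tau>)"
    by (cases s)
  show "matching_homotopy n (gen s :: 'k ext_poly) \<in> ext_poly_carrier n"
    by (rule matching_homotopy_cases[OF s[unfolded st], where 'k = 'k]) (simp_all add: st free_mod_closed)
qed

lemma ext_poly_d_matching:
  assumes char: "CHAR('k::field) \<noteq> 2" and z: "z \<in> (ext_poly_carrier n :: 'k ext_poly set)"
  shows "kscale (1 / 2) (ext_poly_d n (matching_homotopy n z) + matching_homotopy n (ext_poly_d n z)) = z - parity_proj n z"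
proof (rule klinear_eqI[OF _ _ z])
  show "klinear (\<lambda>z. kscale (1 / 2) (ext_poly_d n (matching_homotopy n z) + matching_homotopy n (ext_poly_d n z)))"
    by (intro klin_intros klinear_comp[OF klinear_ext_poly_d klinear_matching_homotopy]
        klinear_comp[OF klinear_matching_homotopy klinear_ext_poly_d])
  show "klinear (\<lambda>z. z - parity_proj n z)"
    by (intro klin_intros klinear_parity_proj)
  have two: "(2 :: 'k) \<noteq> 0"
  proof
    assume "(2 :: 'k) = 0"
    then have "CHAR('k) dvd 2"
      using of_nat_eq_0_iff_char_dvd[of 2, where 'a = 'k] by simp
    then have "CHAR('k) \<le> 2" "CHAR('k) \<noteq> 0"
      by (auto dest: dvd_imp_le intro: Nat.gr0I)
    then show False
      using char CHAR_not_1'[where 'a = 'k] by linarith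
  qed
  fix s assume s: "s \<in> ext_poly_index n"
  obtain \<sigma> \<tau> where st: "s = (\<sigma>, \<tau>)"
    by (cases s)
  have \<sigma>: "\<sigma> \<subseteq> {1..n}" "set_mset \<tau> \<subseteq> {1..n}" "finite \<sigma>"
    using s finite_ext_index by (auto simp only: st gen_in_ext_poly_index)
  have dm: "ext_poly_d n (matching_homotopy n (gen (\<sigma>, \<tau>))) =
      (if even (card \<sigma> + size \<tau>) then 0 else kscale 2 (koszul_d n (matching_homotopy n (gen (\<sigma>, \<tau>)) :: 'k ext_poly)))"
    using s[unfolded st]
  proof (cases rule: matching_homotopy_cases[where 'k = 'k])
    case 1
    then show ?thesis
      by (simp add: ext_poly_d_dist koszul_dist)
  next
    case (2 \<rho> \<upsilon> c)
    then have "finite \<rho>"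
      using finite_ext_index[of \<rho> n] by (simp add: gen_in_ext_poly_index)
    then show ?thesis
      using 2 by (simp add: ext_poly_d_dist koszul_dist ext_poly_d_gen mult.commute)
  qed
  show "kscale (1 / 2) (ext_poly_d n (matching_homotopy n (gen s)) + matching_homotopy n (ext_poly_d n (gen s))) =
      gen s - parity_proj n (gen s :: 'k ext_poly)"
  proof (cases "s \<in> parity_index n")
    case True
    then have "ext_poly_d n (gen s) = (0 :: 'k ext_poly)"
      by (intro ext_poly_d_parity_span) (simp add: parity_span_eq)
    moreover have "ext_poly_d n (matching_homotopy n (gen s)) = (0 :: 'k ext_poly)"
      using True dm by (auto simp: st in_parity_index matching_homotopy_top ext_poly_d_dist)
    ultimately show ?thesis
      using True by (simp add: parity_proj_gen koszul_dist)
  next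
    case False
    then have odd: "odd (card \<sigma> + size \<tau>)" "(\<sigma>, \<tau>) \<noteq> ({1..n}, {#})"
      using s by (auto simp: st in_parity_index)
    have "ext_poly_d n (matching_homotopy n (gen s)) + matching_homotopy n (ext_poly_d n (gen s)) = kscale 2 (gen s :: 'k ext_poly)"
      using dm odd koszul_matching[OF \<sigma>(1,2) odd(2), where 'k = 'k]
      by (simp add: st ext_poly_d_gen[OF \<sigma>(3)] koszul_dist flip: kmod.scale_right_distrib)
    then show ?thesis
      using False two by (simp add: parity_proj_gen)
  qed
qed

lemma cycle_minus_parity_proj:
  assumes "CHAR('k::field) \<noteq> 2" "z \<in> (ext_poly_carrier n :: 'k ext_poly set)" "ext_poly_d n z = 0"
  shows "z - parity_proj n z \<in> ext_poly_boundaries n"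
proof -
  have "z - parity_proj n z = kscale (1 / 2) (ext_poly_d n (matching_homotopy n z))"
    using ext_poly_d_matching[OF assms(1,2)] assms(3) by (simp add: koszul_dist)
  then show ?thesis
    using matching_homotopy_closed[OF assms(2)]
    by (simp add: ext_poly_boundaries_closed(3) ext_poly_boundaries_def[THEN equalityD2, THEN subsetD, OF imageI])
qed

lemma parity_fiber_alg_iso:
  fixes A :: "('k::field, 'k ext_poly) module"
  assumes char: "CHAR('k) \<noteq> 2" and carrier: "carrier A = parity_span n"
    and mult: "\<And>u v. u \<in> parity_span n \<Longrightarrow> v \<in> parity_span n \<Longrightarrow>
      u \<otimes>\<^bsub>A\<^esub> v = parity_proj n (ext_poly_mult u v)"
    and ops: "\<one>\<^bsub>A\<^esub> = gen ({}, {#})" "\<And>u v. u \<oplus>\<^bsub>A\<^esub> v = u + v" "\<And>c v. c \<odot>\<^bsub>A\<^esub> v = kscale c v"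
  shows "hoch_fiber n \<in> alg_iso A (HH n)"
proof (rule hoch_fiber_alg_iso)
  show "kmod.subspace (carrier A)"
    unfolding carrier parity_span_eq by (rule subspace_free_mod)
  show "carrier A \<subseteq> ext_poly_carrier n"
    unfolding carrier by (rule parity_span_subset)
  show "ext_poly_d n v = 0" if "v \<in> carrier A" for v
    using that carrier ext_poly_d_parity_span by simp
  show "v = 0" if "v \<in> carrier A" "v \<in> ext_poly_boundaries n" for v
  proof -
    obtain w where "w \<in> ext_poly_carrier n" "v = ext_poly_d n w"
      using \<open>v \<in> ext_poly_boundaries n\<close> by (auto simp: ext_poly_boundaries_def)
    then show ?thesis
      using parity_proj_ext_poly_d[of w n] parity_proj_id[of v n] that(1) carrier by simp
  qed
  show "\<exists>v\<in>carrier A. z - v \<in> ext_poly_boundaries n" if "z \<in> ext_poly_carrier n" "ext_poly_d n z = 0" for z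
    using cycle_minus_parity_proj[OF char that] parity_proj_in_span[of n z] by (auto simp: carrier)
  show "u \<otimes>\<^bsub>A\<^esub> v \<in> carrier A \<and> ext_poly_mult u v - u \<otimes>\<^bsub>A\<^esub> v \<in> ext_poly_boundaries n"
    if u: "u \<in> carrier A" and v: "v \<in> carrier A" for u v
  proof -
    have uv: "u \<in> ext_poly_carrier n" "v \<in> ext_poly_carrier n" "ext_poly_d n u = 0" "ext_poly_d n v = 0"
      using u v parity_span_subset[of n, where 'k = 'k] ext_poly_d_parity_span by (auto simp: carrier)
    then have "ext_poly_d n (ext_poly_mult u v) = 0"
      by (simp add: ext_poly_d_mult ext_poly_mult_dist)
    then show ?thesis
      using u v uv mult cycle_minus_parity_proj[OF char ext_poly_mult_closed]
      by (simp add: carrier parity_proj_in_span)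
  qed
qed (rule ops)+

lemma parity_span_mult_closed:
  assumes "even n" "u \<in> parity_span n" "v \<in> (parity_span n :: 'k::field ext_poly set)"
  shows "ext_poly_mult u v \<in> parity_span n"
  using assms(2,3) unfolding parity_span_eq
proof -
  assume u: "u \<in> free_mod (parity_index n)" and v: "v \<in> free_mod (parity_index n)"
  show "ext_poly_mult u v \<in> free_mod (parity_index n)"
  proof (rule klinear_in_free_mod[OF klinear_ext_poly_mult_left[OF klinear_id] u])
    fix s assume s: "s \<in> parity_index n"
    show "ext_poly_mult (gen s) v \<in> free_mod (parity_index n)"
    proof (rule klinear_in_free_mod[OF klinear_ext_poly_mult_right[OF klinear_id] v])
      fix s' assume s': "s' \<in> parity_index n"
      obtain \<sigma> \<tau> \<sigma>' \<tau>' where st: "s = (\<sigma>, \<tau>)" "s' = (\<sigma>', \<tau>')"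
        by (cases s; cases s')
      have even: "even (card \<sigma> + size \<tau>)" "even (card \<sigma>' + size \<tau>')"
        and sub: "\<sigma> \<subseteq> {1..n}" "\<sigma>' \<subseteq> {1..n}" "set_mset \<tau> \<subseteq> {1..n}" "set_mset \<tau>' \<subseteq> {1..n}"
        using s s' assms(1) by (auto simp: st in_parity_index gen_in_ext_poly_index)
      show "ext_poly_mult (gen s) (gen s') \<in> free_mod (parity_index n)"
      proof (cases "\<sigma> \<inter> \<sigma>' = {}")
        case True
        then have "card (\<sigma> \<union> \<sigma>') = card \<sigma> + card \<sigma>'"
          using sub finite_ext_index by (intro card_Un_disjoint) auto
        then have "even (card (\<sigma> \<union> \<sigma>') + size (\<tau> + \<tau>'))"
          using even by simp
        then have "(\<sigma> \<union> \<sigma>', \<tau> + \<tau>') \<in> parity_index n"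
          using sub by (simp add: in_parity_index gen_in_ext_poly_index)
        then show ?thesis
          by (simp add: st free_mod_closed)
      qed (simp add: st ext_sign_meet)
    qed
  qed
qed

lemma parity_one: "gen ({}, {#}) \<in> parity_span n"
  by (simp add: parity_span_eq in_parity_index gen_in_ext_poly_index)

lemma parity_span_subalgebra:
  assumes "even n"
  shows "is_subalgebra (parity_span n) (ext_poly_alg n :: ('k::field, 'k ext_poly) module)"
proof -
  let ?A = "ext_poly_alg n :: ('k, 'k ext_poly) module"
  have sub: "x \<in> ext_poly_carrier n" if "x \<in> parity_span n" for x :: "'k ext_poly"
    using that parity_span_subset by blast
  have inv: "inv\<^bsub>add_monoid ?A\<^esub> x = - x" if "x \<in> ext_poly_carrier n" for x
    unfolding m_inv_def
  proof (rule the_equality)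
    show "- x \<in> carrier (add_monoid ?A) \<and> x \<otimes>\<^bsub>add_monoid ?A\<^esub> - x = \<one>\<^bsub>add_monoid ?A\<^esub> \<and>
        - x \<otimes>\<^bsub>add_monoid ?A\<^esub> x = \<one>\<^bsub>add_monoid ?A\<^esub>"
      using that by (simp add: ext_poly_alg_def)
    fix y assume "y \<in> carrier (add_monoid ?A) \<and> x \<otimes>\<^bsub>add_monoid ?A\<^esub> y = \<one>\<^bsub>add_monoid ?A\<^esub> \<and>
        y \<otimes>\<^bsub>add_monoid ?A\<^esub> x = \<one>\<^bsub>add_monoid ?A\<^esub>"
    then have "y + x = 0"
      by (simp add: ext_poly_alg_def)
    then show "y = - x"
      by (simp add: eq_neg_iff_add_eq_0)
  qed
  have "subgroup (parity_span n) (add_monoid ?A)"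
  proof (rule subgroup.intro)
    fix x :: "'k ext_poly" assume x: "x \<in> parity_span n"
    then show "inv\<^bsub>add_monoid ?A\<^esub> x \<in> parity_span n"
      unfolding inv[OF sub[OF x]] by (simp add: parity_span_eq)
  qed (use sub in \<open>auto simp: ext_poly_alg_def parity_span_eq\<close>)
  moreover have "submonoid (parity_span n) ?A"
    by (rule submonoid.intro)
      (use sub parity_span_mult_closed[OF assms] parity_one in \<open>auto simp: ext_poly_alg_def\<close>)
  ultimately show ?thesis
    by (simp add: is_subalgebra_def subring_def) (simp add: ext_poly_alg_def parity_span_eq)
qed

theorem theorem5:
  fixes n :: nat
  shows
    "(CHAR('k::field) = 2 \<longrightarrow>
       (\<exists>g :: nat \<Rightarrow> 'k tens \<Rightarrow> 'k small. homotopy_inverse n g) \<and>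
       (\<exists>\<Phi> \<in> alg_iso (ext_poly_alg n :: ('k, 'k ext_poly) module) (HH n).
          \<forall>g \<sigma> \<tau>. homotopy_inverse n g \<and> \<sigma> \<subseteq> {1..n} \<and> set_mset \<tau> \<subseteq> {1..n} \<longrightarrow>
            \<Phi> (gen (\<sigma>, \<tau>)) = phi_class n g \<tau> \<sigma>)) \<and>
     (CHAR('k) \<noteq> 2 \<longrightarrow>
       (even n \<longrightarrow>
          is_subalgebra (parity_span n) (ext_poly_alg n :: ('k, 'k ext_poly) module) \<and>
          alg_iso (parity_alg n :: ('k, 'k ext_poly) module) (HH n) \<noteq> {}) \<and>
       (odd n \<longrightarrow>
          alg_iso (parity_alg_trunc n :: ('k, 'k ext_poly) module) (HH n) \<noteq> {}))"
proof (intro conjI impI)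
  show "\<exists>g :: nat \<Rightarrow> 'k tens \<Rightarrow> 'k small. homotopy_inverse n g"
    using homotopy_inverse_exists by blast
next
  assume char: "CHAR('k) = 2"
  have d: "ext_poly_d n z = 0" if "z \<in> ext_poly_carrier n" for z :: "'k ext_poly"
    by (rule ext_poly_d_char_2[OF char that])
  then have bd: "ext_poly_boundaries n = ({0} :: 'k ext_poly set)"
    by (auto simp: ext_poly_boundaries_def intro!: image_eqI[of _ _ 0])
  have "hoch_fiber n \<in> alg_iso (ext_poly_alg n :: ('k, 'k ext_poly) module) (HH n)"
    by (rule hoch_fiber_alg_iso)
      (simp_all add: ext_poly_alg_def d bd subspace_free_mod ext_poly_mult_closed)
  moreover have "hoch_fiber n (gen (\<sigma>, \<tau>)) = phi_class n g \<tau> \<sigma>"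
    if "homotopy_inverse n g" "\<sigma> \<subseteq> {1..n}" "set_mset \<tau> \<subseteq> {1..n}"
    for g :: "nat \<Rightarrow> 'k tens \<Rightarrow> 'k small" and \<sigma> \<tau>
    using that d by (intro phi_class_eq_fiber[symmetric]) (simp_all add: gen_in_ext_poly_index)
  ultimately show "\<exists>\<Phi> \<in> alg_iso (ext_poly_alg n :: ('k, 'k ext_poly) module) (HH n).
      \<forall>g \<sigma> \<tau>. homotopy_inverse n g \<and> \<sigma> \<subseteq> {1..n} \<and> set_mset \<tau> \<subseteq> {1..n} \<longrightarrow>
        \<Phi> (gen (\<sigma>, \<tau>)) = phi_class n g \<tau> \<sigma>"
    by (intro bexI[of _ "hoch_fiber n"]) auto
next
  assume "even n"
  then show "is_subalgebra (parity_span n) (ext_poly_alg n :: ('k, 'k ext_poly) module)"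
    by (rule parity_span_subalgebra)
next
  assume "CHAR('k) \<noteq> 2" "even n"
  then have "hoch_fiber n \<in> alg_iso (parity_alg n :: ('k, 'k ext_poly) module) (HH n)"
    by (intro parity_fiber_alg_iso)
      (simp_all add: parity_alg_def ext_poly_alg_def parity_span_mult_closed parity_proj_id)
  then show "alg_iso (parity_alg n :: ('k, 'k ext_poly) module) (HH n) \<noteq> {}"
    by blast
next
  assume "CHAR('k) \<noteq> 2" "odd n"
  then have "hoch_fiber n \<in> alg_iso (parity_alg_trunc n :: ('k, 'k ext_poly) module) (HH n)"
    by (intro parity_fiber_alg_iso) (simp_all add: parity_alg_trunc_def parity_alg_def ext_poly_alg_def)
  then show "alg_iso (parity_alg_trunc n :: ('k, 'k ext_poly) module) (HH n) \<noteq> {}"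
    by blast
qed

end
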